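(* Let $\mathcal{A},\mathcal{B}$ be finite non-empty alphabets, let $\sigma:\mathcal{A}^*\to\mathcal{B}^*$ be any non-erasing monoid morphism, let $X\subseteq\mathcal{A}^{\mathbb{Z}}$ be any subshift over $\mathcal{A}$, and let $Y:=\sigma(X)\subseteq\mathcal{B}^{\mathbb{Z}}$ be its image subshift. Then the induced measure transfer map $\sigma^{\mathcal{M}}:\mathcal{M}(\mathcal{A}^{\mathbb{Z}})\to\mathcal{M}(\mathcal{B}^{\mathbb{Z}})$ restricts and co-restricts to a well defined map $\sigma_X^{\mathcal{M}}:\mathcal{M}(X)\to\mathcal{M}(Y)$, $\mu\mapsto\mu^\sigma$, which has the following properties: (1) $\sigma_X^{\mathcal{M}}$ is an $\mathbb{R}_{\ge 0}$-linear map of cones. (2) $\sigma_X^{\mathcal{M}}$ is continuous (for the weak$^*$-topologies). (3) $\sigma_X^{\mathcal{M}}$ is functorial: for every non-erasing morphism $\sigma':\mathcal{B}^*\to\mathcal{C}^*$ (with $\mathcal{C}$ a finite non-empty alphabet) one has $(\sigma'\circ\sigma)_X^{\mathcal{M}}={\sigma'}_{\sigma(X)}^{\mathcal{M}}\circ\sigma_X^{\mathcal{M}}$. (4) If the subshift $X'\subseteq X$ is the support of a measure $\mu\in\mathcal{M}(X)$, then $\sigma(X')$ is the support of $\sigma_X^{\mathcal{M}}(\mu)$. (5) If a measure $\mu\in\mathcal{M}(X)$ is ergodic, then so is $\mu^\sigma\in\mathcal{M}(Y)$. In addition, the map $\sigma_X^{\mathcal{M}}:\mathcal{M}(X)\to\mathcal{M}(Y)$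 is surjective.
   Context: For a finite non-empty alphabet $\mathcal{A}$, $\mathcal{A}^*$ is the free monoid of finite words, $|w|$ is word length. The full shift $\mathcal{A}^{\mathbb{Z}}$ carries the product topology and the shift $T$, $(T\mathbf{x})_k=x_{k+1}$. The cylinder of $w\in\mathcal{A}^*$ is $[w]=\{\mathbf{x}: x_1x_2\cdots x_{|w|}=w\}$. A subshift is a non-empty closed subset $X\subseteq\mathcal{A}^{\mathbb{Z}}$ with $T(X)=X$. A monoid morphism $\sigma:\mathcal{A}^*\to\mathcal{B}^*$ is non-erasing if $|\sigma(a)|\ge1$ for all $a\in\mathcal{A}$. It induces $\sigma^{\mathbb{Z}}:\mathcal{A}^{\mathbb{Z}}\to\mathcal{B}^{\mathbb{Z}}$ by concatenating the words $\sigma(x_i)$, with $\sigma(x_1)$ starting at position $1$. The image subshift $\sigma(X)$ of a subshift $X$ is the intersection of all subshifts of $\mathcal{B}^{\mathbb{Z}}$ containing $\sigma^{\mathbb{Z}}(X)$. An invariant measure on $X$ is a finite $T$-invariant Borel measure on $\mathcal{A}^{\mathbb{Z}}$ with support in $X$; $\mathcal{M}(X)$ is the cone of such measures (so $\mathcal{M}(X)\subseteq\mathcal{M}(\mathcal{A}^{\mathbb{Z}})$), with the weak$^*$-topology (equivalently, the topology of convergence of $\mu([w])$ for every $w$). An invariant measure $\mu$ is ergodic if it cannot be written as a sum $\mu_1+\mu_2$ of invariant measures with $\mu_1\ne0\ne\mu_2$ and $\mu_1\ne\lambda\mu_2$ for all $\lambda>0$. Measure transfer: for non-erasing $\sigma$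 let $\mathcal{A}_\sigma$ be the alphabet of letters $a(k)$ with $a\in\mathcal{A}$, $1\le k\le|\sigma(a)|$; let $\pi_\sigma:\mathcal{A}^*\to\mathcal{A}_\sigma^*$, $a\mapsto a(1)a(2)\cdots a(|\sigma(a)|)$, and let $\alpha_\sigma:\mathcal{A}_\sigma^*\to\mathcal{B}^*$ send $a(k)$ to the $k$-th letter of $\sigma(a)$, so that $\sigma=\alpha_\sigma\circ\pi_\sigma$. For a non-empty word $u\in\mathcal{A}_\sigma^*$ let $\hat u\in\mathcal{A}^*$ be the shortest word such that $u$ is a factor (contiguous subword) of $\pi_\sigma(\hat u)$ (it is unique if it exists); if no such word exists, put formally $\mu([\hat u])=0$. For $\mu\in\mathcal{M}(\mathcal{A}^{\mathbb{Z}})$, the transferred measure $\mu^\sigma=\sigma^{\mathcal{M}}(\mu)\in\mathcal{M}(\mathcal{B}^{\mathbb{Z}})$ is the invariant measure determined by $\mu^\sigma([w])=\sum_{u\in\alpha_\sigma^{-1}(w)}\mu([\hat u])$ for all non-empty $w\in\mathcal{B}^*$. *)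

theory Defs
  imports "HOL-Analysis.Analysis" "HOL-Library.Sublist" "HOL-Library.FuncSet"
begin

text \<open>
  A finite non-empty alphabet is a type of class \<open>finite\<close>, words are lists and
  bi-infinite words are functions on \<open>int\<close>.
\<close>

subsection \<open>Full shift, cylinders and subshifts\<close>

definition full_shift :: "(int \<Rightarrow> 'a::finite) topology" where
  "full_shift = product_topology (\<lambda>_. discrete_topology UNIV) UNIV"

definition shift :: "(int \<Rightarrow> 'a) \<Rightarrow> int \<Rightarrow> 'a" where
  "shift x = (\<lambda>k. x (k + 1))"

definition cylinder :: "'a list \<Rightarrow> (int \<Rightarrow> 'a) set" where
  "cylinder w = {x. map x [1..int (length w)] = w}"

definition subshift :: "(int \<Rightarrow> 'a::finite) set \<Rightarrow> bool" where
  "subshift X \<longleftrightarrow> X \<noteq> {} \<and> closedin full_shift X \<and> shift ` X = X"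

subsection \<open>Non-erasing morphisms\<close>

definition nonerasing_morphism :: "('a list \<Rightarrow> 'b list) \<Rightarrow> bool" where
  "nonerasing_morphism \<sigma> \<longleftrightarrow>
     \<sigma> [] = [] \<and> (\<forall>u v. \<sigma> (u @ v) = \<sigma> u @ \<sigma> v) \<and> (\<forall>a. length (\<sigma> [a]) \<ge> 1)"

text \<open>
  \<open>block_start \<sigma> x n\<close> is the position at which the block \<open>\<sigma> (x\<^sub>n)\<close> begins in the
  image of \<open>x\<close>. The block of \<open>x\<^sub>1\<close> begins at position 1; for \<open>n \<ge> 1\<close> the second sum
  is empty, for \<open>n \<le> 1\<close> the first one is.
\<close>

definition block_start :: "('a list \<Rightarrow> 'b list) \<Rightarrow> (int \<Rightarrow> 'a) \<Rightarrow> int \<Rightarrow> int" where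
  "block_start \<sigma> x n =
     1 + (\<Sum>i\<in>{1..<n}. int (length (\<sigma> [x i]))) - (\<Sum>i\<in>{n..<1}. int (length (\<sigma> [x i])))"

definition morphism_Z :: "('a list \<Rightarrow> 'b list) \<Rightarrow> (int \<Rightarrow> 'a) \<Rightarrow> int \<Rightarrow> 'b" where
  "morphism_Z \<sigma> x =
     (THE y. \<forall>n. \<forall>j < length (\<sigma> [x n]). y (block_start \<sigma> x n + int j) = \<sigma> [x n] ! j)"

definition image_subshift ::
    "('a::finite list \<Rightarrow> 'b::finite list) \<Rightarrow> (int \<Rightarrow> 'a) set \<Rightarrow> (int \<Rightarrow> 'b) set" where
  "image_subshift \<sigma> X = \<Inter> {Y. subshift Y \<and> morphism_Z \<sigma> ` X \<subseteq> Y}"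

subsection \<open>Invariant measures\<close>

definition shift_borel :: "(int \<Rightarrow> 'a::finite) measure" where
  "shift_borel = sigma UNIV {U. openin full_shift U}"

definition supp :: "(int \<Rightarrow> 'a::finite) measure \<Rightarrow> (int \<Rightarrow> 'a) set" where
  "supp \<mu> = UNIV - \<Union> {U. openin full_shift U \<and> emeasure \<mu> U = 0}"

definition inv_measures :: "(int \<Rightarrow> 'a::finite) set \<Rightarrow> (int \<Rightarrow> 'a) measure set" where
  "inv_measures X =
     {\<mu>. finite_measure \<mu> \<and> sets \<mu> = sets shift_borel \<and>
         (\<forall>A\<in>sets \<mu>. emeasure \<mu> (shift -` A) = emeasure \<mu> A) \<and> supp \<mu> \<subseteq> X}"

text \<open>Sum of two measures with the same \<open>\<sigma>\<close>-algebra.\<close>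

definition add_measure :: "'x measure \<Rightarrow> 'x measure \<Rightarrow> 'x measure" where
  "add_measure \<mu> \<nu> = measure_of (space \<mu>) (sets \<mu>) (\<lambda>A. emeasure \<mu> A + emeasure \<nu> A)"

text \<open>As the definition is not restricted to probability measures, the zero measure
  counts as ergodic.\<close>

definition ergodic :: "(int \<Rightarrow> 'a::finite) measure \<Rightarrow> bool" where
  "ergodic \<mu> \<longleftrightarrow> \<mu> \<in> inv_measures UNIV \<and>
     \<not> (\<exists>\<mu>1\<in>inv_measures UNIV. \<exists>\<mu>2\<in>inv_measures UNIV.
          \<mu> = add_measure \<mu>1 \<mu>2 \<and>
          \<mu>1 \<noteq> null_measure shift_borel \<and> \<mu>2 \<noteq> null_measure shift_borel \<and>
          (\<forall>l::real. l > 0 \<longrightarrow> \<mu>1 \<noteq> scale_measure (ennreal l) \<mu>2))"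

text \<open>
  The weak-* topology: the coarsest topology on \<open>inv_measures X\<close> for which integration of
  every continuous real function on the full shift is continuous.
\<close>

definition weak_star :: "(int \<Rightarrow> 'a::finite) set \<Rightarrow> (int \<Rightarrow> 'a) measure topology" where
  "weak_star X =
     (let C = {f. continuous_map full_shift euclideanreal f} in
      pullback_topology (inv_measures X) (\<lambda>\<mu>. \<lambda>f\<in>C. (\<integral>x. f x \<partial>\<mu>))
        (product_topology (\<lambda>_. euclideanreal) C))"

subsection \<open>Measure transfer\<close>

text \<open>The letter \<open>a(k)\<close> is the pair \<open>(a, k)\<close>, with \<open>k\<close> counted from 1.\<close>

definition subdivided_alphabet :: "('a list \<Rightarrow> 'b list) \<Rightarrow> ('a \<times> nat) set" where
  "subdivided_alphabet \<sigma> = {(a, k). 1 \<le> k \<and> k \<le> length (\<sigma> [a])}"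

definition pi_word :: "('a list \<Rightarrow> 'b list) \<Rightarrow> 'a list \<Rightarrow> ('a \<times> nat) list" where
  "pi_word \<sigma> w = concat (map (\<lambda>a. map (Pair a) [1..<Suc (length (\<sigma> [a]))]) w)"

definition alpha_word :: "('a list \<Rightarrow> 'b list) \<Rightarrow> ('a \<times> nat) list \<Rightarrow> 'b list" where
  "alpha_word \<sigma> u = map (\<lambda>(a, k). \<sigma> [a] ! (k - 1)) u"

lemma alpha_pi_word:
  assumes "nonerasing_morphism \<sigma>"
  shows "alpha_word \<sigma> (pi_word \<sigma> w) = \<sigma> w"
proof (induction w)
  case Nil
  then show ?case
    using assms by (simp add: alpha_word_def pi_word_def nonerasing_morphism_def)
next
  case (Cons a w)
  have "\<sigma> (a # w) = \<sigma> [a] @ \<sigma> w"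
    using assms unfolding nonerasing_morphism_def by (metis append_Cons append_Nil)
  moreover have "alpha_word \<sigma> (map (Pair a) [1..<Suc (length (\<sigma> [a]))]) = \<sigma> [a]"
    by (rule nth_equalityI) (simp_all add: alpha_word_def del: upt_Suc)
  ultimately show ?case
    using Cons by (simp add: alpha_word_def pi_word_def del: upt_Suc)
qed

definition hat_word :: "('a list \<Rightarrow> 'b list) \<Rightarrow> ('a \<times> nat) list \<Rightarrow> 'a list" where
  "hat_word \<sigma> u = (ARG_MIN length v. sublist u (pi_word \<sigma> v))"

definition hat_weight ::
    "('a list \<Rightarrow> 'b list) \<Rightarrow> (int \<Rightarrow> 'a) measure \<Rightarrow> ('a \<times> nat) list \<Rightarrow> real" where
  "hat_weight \<sigma> \<mu> u =
     (if \<exists>v. sublist u (pi_word \<sigma> v) then measure \<mu> (cylinder (hat_word \<sigma> u)) else 0)"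

definition transfer ::
    "('a::finite list \<Rightarrow> 'b::finite list) \<Rightarrow> (int \<Rightarrow> 'a) measure \<Rightarrow> (int \<Rightarrow> 'b) measure" where
  "transfer \<sigma> \<mu> =
     (THE \<nu>. \<nu> \<in> inv_measures UNIV \<and>
        (\<forall>w. w \<noteq> [] \<longrightarrow>
           measure \<nu> (cylinder w) =
             (\<Sum>u | u \<in> lists (subdivided_alphabet \<sigma>) \<and> alpha_word \<sigma> u = w. hat_weight \<sigma> \<mu> u)))"

definition transfer_on ::
    "('a::finite list \<Rightarrow> 'b::finite list) \<Rightarrow> (int \<Rightarrow> 'a) set \<Rightarrow>
     (int \<Rightarrow> 'a) measure \<Rightarrow> (int \<Rightarrow> 'b) measure" where
  "transfer_on \<sigma> X = restrict (transfer \<sigma>) (inv_measures X)"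

end

theory Submission
  imports Defs
begin

text \<open>The transferred measure has an explicit form. Over a point \<open>x\<close> of the base shift stands a tower whose
levels are the points \<open>T\<^sup>j \<sigma>(x)\<close> with \<open>0 \<le> j < |\<sigma>(x\<^sub>1)|\<close>, and the measure of \<open>B\<close> is the
\<open>\<mu>\<close>-integral of the number of levels in \<open>B\<close> (\<open>tower_measure\<close>). The level after the top of the tower
over \<open>x\<close> is the bottom of the tower over \<open>T x\<close>, because \<open>\<sigma>(T x) = T\<^sup>r \<sigma>(x)\<close> with
\<open>r = |\<sigma>(x\<^sub>1)|\<close>; so the invariance of \<open>\<mu>\<close> makes this measure invariant. A word \<open>u\<close> over the subdivided
alphabet that begins with \<open>a(k)\<close> can only be read off at level \<open>k - 1\<close> of a tower over a point with
\<open>x\<^sub>1 = a\<close>, and it is read there exactly when \<open>x\<close> lies in the cylinder of the hat word of \<open>u\<close>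
(\<open>hat_set_eq_cylinder\<close>). Hence the cylinder sums that define the transfer are the values of the tower
measure, and as cylinders determine an invariant measure the two agree
(\<open>transfer_eq_tower_measure\<close>).

Most of the claims are read off from the formula
\<open>\<integral> g d\<mu>\<^sup>\<sigma> = \<integral> (\<Sum>j<|\<sigma>(x\<^sub>1)|. g (T\<^sup>j \<sigma>(x))) d\<mu>(x)\<close>. It is linear in \<open>\<mu>\<close>. For continuous \<open>g\<close> the
inner sum is continuous in \<open>x\<close>, which is weak-* continuity. Functoriality holds because the
\<open>\<tau>\<close>-towers over the levels of a \<open>\<sigma>\<close>-tower, stacked on each other, form the tower of \<open>\<tau> \<circ> \<sigma>\<close>
(\<open>nested_level_sum\<close>). An open set is null for \<open>\<mu>\<^sup>\<sigma>\<close> iff almost no tower meets it, which together with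
the minimality of the image subshift gives the supports.

For ergodicity, let \<open>\<mu>\<^sup>\<sigma> = \<nu>\<^sub>1 + \<nu>\<^sub>2\<close> with invariant summands. Each \<open>\<nu>\<^sub>i\<close> has a density
\<open>f\<^sub>i\<close>, which is almost everywhere shift invariant and therefore constant along towers; so \<open>\<nu>\<^sub>i\<close> is
the transfer of the invariant measure with density \<open>f\<^sub>i \<circ> \<sigma>\<close> with respect to \<open>\<mu>\<close>
(\<open>density_tower_measure\<close>). A decomposition of the transferred measure thus lifts to one of \<open>\<mu>\<close>.

For surjectivity, an invariant measure \<open>\<nu>\<close> on the image subshift is lifted by averaging. For each
\<open>n\<close> choose, depending only on a finite window of \<open>y\<close>, a point \<open>\<xi>(y)\<close> of \<open>X\<close> whose tower shadows \<open>y\<close> on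
that window, and count how often the first blocks of \<open>\<xi>(y)\<close>, covering about \<open>n\<close> letters, visit a set
\<open>A\<close>. The mean over \<open>y\<close>, divided by \<open>n\<close>, is additive in \<open>A\<close>, invariant up to \<open>O(1/n)\<close>, and transfers to
\<open>\<nu>\<close> up to \<open>O(1/n)\<close> (\<open>approximate_lift_exists\<close>). A subsequence converges on the countable algebra of
finitely determined sets, and by compactness the limit extends to a measure, which is an exact lift
(\<open>tower_measure_surjective\<close>).\<close>

section \<open>The full shift and its finitely determined sets\<close>

definition agree :: "nat \<Rightarrow> (int \<Rightarrow> 'a) \<Rightarrow> (int \<Rightarrow> 'a) \<Rightarrow> bool" where
  "agree n x y \<longleftrightarrow> (\<forall>i. \<bar>i\<bar> \<le> int n \<longrightarrow> x i = y i)"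

lemma agree_refl [simp]: "agree n x x"
  by (simp add: agree_def)

lemma agree_sym: "agree n x y \<Longrightarrow> agree n y x"
  by (simp add: agree_def)

lemma agree_trans: "agree n x y \<Longrightarrow> agree n y z \<Longrightarrow> agree n x z"
  by (simp add: agree_def)

lemma agree_mono: "agree n x y \<Longrightarrow> m \<le> n \<Longrightarrow> agree m x y"
  by (auto simp: agree_def)

text \<open>Two-sided windows are a neighbourhood base of the product topology. All topology below goes through
this criterion.\<close>

lemma openin_full_shift_iff:
  "openin full_shift U \<longleftrightarrow> (\<forall>x\<in>U. \<exists>n. \<forall>y. agree n x y \<longrightarrow> y \<in> U)"
proof
  assume U: "openin full_shift U"
  show "\<forall>x\<in>U. \<exists>n. \<forall>y. agree n x y \<longrightarrow> y \<in> U"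
  proof
    fix x assume "x \<in> U"
    then obtain V where fin: "finite {i. V i \<noteq> UNIV}"
      and x: "x \<in> Pi\<^sub>E UNIV V" and V: "Pi\<^sub>E UNIV V \<subseteq> U"
      using U unfolding full_shift_def openin_product_topology_alt by auto
    obtain n where n: "\<And>i. i \<in> {i. V i \<noteq> UNIV} \<Longrightarrow> nat \<bar>i\<bar> \<le> n"
      using finite_nat_set_iff_bounded_le[of "(\<lambda>i. nat \<bar>i\<bar>) ` {i. V i \<noteq> UNIV}"] fin by blast
    have "y \<in> U" if "agree n x y" for y
    proof -
      have "y i \<in> V i" for i
      proof (cases "V i = UNIV")
        case False
        then have "\<bar>i\<bar> \<le> int n" using n[of i] by auto
        then have "y i = x i" using that by (simp add: agree_def)
        then show ?thesis using x by (auto simp: PiE_iff)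
      qed simp
      then show ?thesis using V by (auto simp: PiE_iff)
    qed
    then show "\<exists>n. \<forall>y. agree n x y \<longrightarrow> y \<in> U" by blast
  qed
next
  assume *: "\<forall>x\<in>U. \<exists>n. \<forall>y. agree n x y \<longrightarrow> y \<in> U"
  show "openin full_shift U"
    unfolding full_shift_def openin_product_topology_alt
  proof
    fix x assume "x \<in> U"
    then obtain n where n: "\<And>y. agree n x y \<Longrightarrow> y \<in> U" using * by blast
    define V where "V i = (if \<bar>i\<bar> \<le> int n then {x i} else UNIV)" for i
    have "{i. V i \<noteq> UNIV} \<subseteq> {- int n..int n}" by (auto simp: V_def abs_le_iff)
    then have "finite {i. V i \<noteq> UNIV}" by (rule finite_subset) simp
    moreover have "y \<in> U" if "\<And>i. y i \<in> V i" for y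
    proof (rule n)
      show "agree n x y" unfolding agree_def
        using that by (metis V_def singletonD)
    qed
    ultimately show "\<exists>V. finite {i \<in> UNIV. V i \<noteq> topspace (discrete_topology UNIV)} \<and>
        (\<forall>i\<in>UNIV. openin (discrete_topology UNIV) (V i)) \<and> x \<in> Pi\<^sub>E UNIV V \<and> Pi\<^sub>E UNIV V \<subseteq> U"
      by (intro exI[of _ V]) (auto simp: PiE_iff V_def)
  qed
qed

lemma topspace_full_shift [simp]: "topspace full_shift = UNIV"
  by (simp add: full_shift_def)

lemma compact_full_shift: "compact_space full_shift"
  unfolding full_shift_def
  by (simp add: compact_space_product_topology compact_space_discrete_topology)

lemma closedin_full_shift_iff:
  "closedin full_shift Z \<longleftrightarrow> (\<forall>x. (\<forall>n. \<exists>y\<in>Z. agree n x y) \<longrightarrow> x \<in> Z)"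
  unfolding closedin_def openin_full_shift_iff by simp blast

lemma continuous_full_shiftI:
  assumes "\<And>n x. \<exists>m. \<forall>y. agree m x y \<longrightarrow> agree n (f x) (f y)"
  shows "continuous_map full_shift full_shift f"
  unfolding continuous_map_def openin_full_shift_iff
  using assms by simp blast

text \<open>The sets that depend on finitely many coordinates, which for a finite alphabet are the clopen sets of
the full shift. They form a countable algebra that generates the Borel sets, so both uniqueness and
existence of measures are settled on it.\<close>

definition window_sets :: "(int \<Rightarrow> 'a) set set" where
  "window_sets = {A. \<exists>n. \<forall>x y. agree n x y \<longrightarrow> (x \<in> A \<longleftrightarrow> y \<in> A)}"

lemma agree_class_window: "{y. agree n x y} \<in> window_sets"
  unfolding window_sets_def by (blast intro: agree_trans agree_sym)

lemma algebra_window_sets: "algebra UNIV window_sets"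
  unfolding algebra_iff_Un
proof (intro conjI ballI)
  fix A B :: "(int \<Rightarrow> 'a) set" assume "A \<in> window_sets" "B \<in> window_sets"
  then obtain m n where "\<forall>x y. agree m x y \<longrightarrow> (x \<in> A \<longleftrightarrow> y \<in> A)"
    "\<forall>x y. agree n x y \<longrightarrow> (x \<in> B \<longleftrightarrow> y \<in> B)"
    by (auto simp: window_sets_def)
  then have "\<forall>x y. agree (max m n) x y \<longrightarrow> (x \<in> A \<union> B \<longleftrightarrow> y \<in> A \<union> B)"
    by (metis Un_iff agree_mono max.cobounded1 max.cobounded2)
  then show "A \<union> B \<in> window_sets" unfolding window_sets_def by blast
qed (auto simp: window_sets_def)

lemma countable_window_sets: "countable (window_sets :: (int \<Rightarrow> 'a::finite) set set)"
proof -
  define W where "W n = {A :: (int \<Rightarrow> 'a) set. \<forall>x y. agree n x y \<longrightarrow> (x \<in> A \<longleftrightarrow> y \<in> A)}" for n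
  have "finite (W n)" for n
  proof (rule finite_imageD)
    let ?I = "{- int n..int n}"
    let ?f = "\<lambda>A :: (int \<Rightarrow> 'a) set. (\<lambda>x. restrict x ?I) ` A"
    have "?f ` W n \<subseteq> Pow (Pi\<^sub>E ?I (\<lambda>_. UNIV))" by auto
    then show "finite (?f ` W n)" by (rule finite_subset) (simp add: finite_PiE)
    have *: "A = {x. restrict x ?I \<in> ?f A}" if "A \<in> W n" for A
    proof -
      have "x \<in> A" if "y \<in> A" "restrict x ?I = restrict y ?I" for x y
      proof -
        have "agree n y x" unfolding agree_def
          using fun_cong[OF that(2)] by (metis abs_le_iff atLeastAtMost_iff minus_le_iff restrict_apply')
        then show ?thesis using \<open>A \<in> W n\<close> that(1) by (auto simp: W_def)
      qed
      then show ?thesis by blast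
    qed
    show "inj_on ?f (W n)" by (rule inj_onI) (metis *)
  qed
  moreover have "window_sets = (\<Union>n. W n)" by (auto simp: W_def window_sets_def)
  ultimately show ?thesis by (metis countable_UN countable_finite uncountable_infinite countableI_type)
qed

lemma open_window_set: "A \<in> window_sets \<Longrightarrow> openin full_shift A"
  unfolding openin_full_shift_iff window_sets_def by blast

lemma closed_window_set: "A \<in> window_sets \<Longrightarrow> closedin full_shift A"
  using algebra.compl_sets[OF algebra_window_sets, of A] 
  by (simp add: closedin_def open_window_set)

lemma open_Union_window_sets:
  assumes "openin full_shift U"
  shows "U = \<Union> {A \<in> window_sets. A \<subseteq> U}"
proof
  show "U \<subseteq> \<Union> {A \<in> window_sets. A \<subseteq> U}"
  proof
    fix x assume "x \<in> U"
    then obtain n where "{y. agree n x y} \<subseteq> U"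
      using assms unfolding openin_full_shift_iff by blast
    then show "x \<in> \<Union> {A \<in> window_sets. A \<subseteq> U}"
      by (intro UnionI[of "{y. agree n x y}"]) (auto simp: agree_class_window)
  qed
qed blast

lemma space_shift_borel [simp]: "space shift_borel = UNIV"
  by (simp add: shift_borel_def space_measure_of_conv)

lemma sets_shift_borel: "sets shift_borel = sigma_sets UNIV {U. openin full_shift U}"
  by (simp add: shift_borel_def)

lemma open_in_shift_borel: "openin full_shift U \<Longrightarrow> U \<in> sets shift_borel"
  by (auto simp: sets_shift_borel)

lemma sets_shift_borel_window: "sets shift_borel = sigma_sets UNIV (window_sets :: (int \<Rightarrow> 'a::finite) set set)"
  unfolding sets_shift_borel
proof (rule sigma_sets_eqI)
  fix U :: "(int \<Rightarrow> 'a) set" assume "U \<in> {U. openin full_shift U}"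
  then have "U = \<Union> {A \<in> window_sets. A \<subseteq> U}" using open_Union_window_sets by blast
  moreover have "\<Union> {A \<in> window_sets. A \<subseteq> U} \<in> sigma_sets UNIV window_sets"
    by (rule sigma_sets_UNION) (auto intro: countable_subset[OF _ countable_window_sets])
  ultimately show "U \<in> sigma_sets UNIV window_sets" by simp
qed (auto intro: open_window_set)

lemma window_set_in_shift_borel: "A \<in> window_sets \<Longrightarrow> A \<in> sets shift_borel"
  by (simp add: open_window_set open_in_shift_borel)

lemma measurable_continuous_full_shift:
  assumes "continuous_map full_shift full_shift f"
  shows "f \<in> measurable shift_borel shift_borel"
  using assms unfolding shift_borel_def
  by (intro measurable_sigma_sets[OF sets_measure_of])
     (auto simp: continuous_map_def vimage_def space_measure_of_conv)

lemma measurable_continuous_real: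
  fixes f :: "(int \<Rightarrow> 'a::finite) \<Rightarrow> real"
  assumes "continuous_map full_shift euclideanreal f"
  shows "f \<in> borel_measurable shift_borel"
proof (rule borel_measurableI)
  fix S :: "real set" assume "open S"
  then have "openin full_shift (f -` S)"
    using openin_continuous_map_preimage[OF assms, of S] by (simp add: vimage_def)
  then show "f -` S \<inter> space shift_borel \<in> sets shift_borel" by (simp add: open_in_shift_borel)
qed

lemma measurable_window_determined:
  assumes "\<And>x y. agree n x y \<Longrightarrow> f x = f y"
  shows "f \<in> measurable shift_borel (count_space UNIV)"
proof (rule measurableI)
  fix A
  have "f -` A \<in> window_sets"
    unfolding window_sets_def mem_Collect_eq vimage_eq by (intro exI[of _ n]) (metis assms)
  then show "f -` A \<inter> space shift_borel \<in> sets shift_borel" by (simp add: window_set_in_shift_borel)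
qed auto

text \<open>Compactness enters here: it makes every finitely additive set function on the algebra continuous at
the empty set, as the extension theorem for measures requires.\<close>

lemma compact_window_sets_decseq:
  fixes A :: "nat \<Rightarrow> (int \<Rightarrow> 'a::finite) set"
  assumes "\<And>i. A i \<in> window_sets" "decseq A" "(\<Inter>i. A i) = {}"
  shows "\<exists>i. A i = {}"
proof (rule ccontr)
  assume "\<not> ?thesis"
  then have "(\<Inter>i. A i) \<noteq> {}"
    using assms by (intro compact_space_imp_nest[OF compact_full_shift]) (auto intro: closed_window_set)
  then show False using assms(3) by simp
qed

section \<open>Concatenating the images of the letters\<close>

lemma nonerasing_Nil: "nonerasing_morphism \<sigma> \<Longrightarrow> \<sigma> [] = []"
  and nonerasing_append: "nonerasing_morphism \<sigma> \<Longrightarrow> \<sigma> (u @ v) = \<sigma> u @ \<sigma> v"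
  and nonerasing_pos: "nonerasing_morphism \<sigma> \<Longrightarrow> 1 \<le> length (\<sigma> [a])"
  by (simp_all add: nonerasing_morphism_def)

lemma nonerasing_Cons: "nonerasing_morphism \<sigma> \<Longrightarrow> \<sigma> (a # v) = \<sigma> [a] @ \<sigma> v"
  using nonerasing_append[of \<sigma> "[a]" v] by simp

lemma nonerasing_not_Nil: "nonerasing_morphism \<sigma> \<Longrightarrow> \<sigma> [a] \<noteq> []"
  using nonerasing_pos[of \<sigma> a] by auto

lemma nonerasing_length_ge: "nonerasing_morphism \<sigma> \<Longrightarrow> length w \<le> length (\<sigma> w)"
proof (induction w)
  case (Cons a w)
  then show ?case
    using nonerasing_pos[of \<sigma> a] by (simp add: nonerasing_Cons[of \<sigma> a w])
qed simp

lemma nonerasing_comp: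
  assumes "nonerasing_morphism \<sigma>" "nonerasing_morphism \<tau>"
  shows "nonerasing_morphism (\<tau> \<circ> \<sigma>)"
  unfolding nonerasing_morphism_def
proof (intro conjI allI)
  show "1 \<le> length ((\<tau> \<circ> \<sigma>) [a])" for a
    using nonerasing_length_ge[OF assms(2), of "\<sigma> [a]"] nonerasing_pos[OF assms(1), of a]
    unfolding o_def by linarith
qed (simp_all add: nonerasing_Nil nonerasing_append assms)

lemma block_start_1 [simp]: "block_start \<sigma> x 1 = 1"
  by (simp add: block_start_def)

lemma block_start_Suc: "block_start \<sigma> x (n + 1) = block_start \<sigma> x n + int (length (\<sigma> [x n]))"
proof (cases "n \<ge> 1")
  case True
  then have "{1..<n + 1} = insert n {1..<n}" by auto
  with True show ?thesis by (simp add: block_start_def)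
next
  case False
  then have "{n..<1} = insert n {n + 1..<1}" by auto
  with False show ?thesis by (simp add: block_start_def)
qed

lemma block_start_add_le:
  assumes "nonerasing_morphism \<sigma>"
  shows "block_start \<sigma> x n + int d \<le> block_start \<sigma> x (n + int d)"
proof (induction d)
  case (Suc d)
  then show ?case
    using block_start_Suc[of \<sigma> x "n + int d"] nonerasing_pos[OF assms, of "x (n + int d)"]
    by (simp add: add_ac)
qed simp

lemma block_start_diff_le:
  assumes "nonerasing_morphism \<sigma>" "m \<le> n"
  shows "block_start \<sigma> x m + (n - m) \<le> block_start \<sigma> x n"
  using block_start_add_le[OF assms(1), of x m "nat (n - m)"] assms(2) by simp

text \<open>Blocks have length at least 1 and block 1 starts at position 1, so \<open>block_start\<close> lies above the
identity on the right and below it on the left. Hence position \<open>k\<close> belongs to a block with index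
between \<open>-\<bar>k\<bar>\<close> and \<open>\<bar>k\<bar>\<close>; these bounds are what makes the induced map continuous.\<close>

lemma block_exists:
  assumes "nonerasing_morphism \<sigma>"
  obtains n where "block_start \<sigma> x n \<le> k" "k < block_start \<sigma> x (n + 1)" "- \<bar>k\<bar> \<le> n" "n \<le> \<bar>k\<bar>"
proof -
  define S where "S = {n \<in> {- \<bar>k\<bar>..\<bar>k\<bar> + 1}. block_start \<sigma> x n \<le> k}"
  have lo: "block_start \<sigma> x (- \<bar>k\<bar>) \<le> k"
    using block_start_diff_le[OF assms, of "- \<bar>k\<bar>" 1 x] unfolding block_start_1 by linarith
  have hi: "k < block_start \<sigma> x (\<bar>k\<bar> + 1)"
    using block_start_diff_le[OF assms, of 1 "\<bar>k\<bar> + 1" x] by simp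
  have fin: "finite S" unfolding S_def by (rule finite_Collect_conjI) simp
  have ne: "- \<bar>k\<bar> \<in> S" using lo by (simp add: S_def)
  define n where "n = Max S"
  have n: "n \<in> S" using Max_in[OF fin] ne by (auto simp: n_def)
  then have "n \<noteq> \<bar>k\<bar> + 1" using hi by (auto simp: S_def)
  then have le: "n \<le> \<bar>k\<bar>" using n by (auto simp: S_def)
  have "n + 1 \<notin> S" using Max_ge[OF fin, of "n + 1"] by (auto simp: n_def)
  then have "k < block_start \<sigma> x (n + 1)" using le n by (auto simp: S_def)
  then show thesis using that[of n] n le by (auto simp: S_def)
qed

lemma block_unique:
  assumes "nonerasing_morphism \<sigma>"
    and "block_start \<sigma> x n \<le> k" "k < block_start \<sigma> x (n + 1)"
    and "block_start \<sigma> x m \<le> k" "k < block_start \<sigma> x (m + 1)"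
  shows "n = m"
proof (rule ccontr)
  assume "n \<noteq> m"
  then consider "n + 1 \<le> m" | "m + 1 \<le> n" by linarith
  then show False
    using assms block_start_diff_le[OF assms(1), of "n + 1" m x]
      block_start_diff_le[OF assms(1), of "m + 1" n x] by cases auto
qed

lemma position_in_block:
  assumes "nonerasing_morphism \<sigma>"
  obtains n j where "k = block_start \<sigma> x n + int j" "j < length (\<sigma> [x n])" "\<bar>n\<bar> \<le> \<bar>k\<bar>"
proof -
  obtain n where n: "block_start \<sigma> x n \<le> k" "k < block_start \<sigma> x (n + 1)" "\<bar>n\<bar> \<le> \<bar>k\<bar>"
    using block_exists[OF assms, of x k] by (metis abs_le_iff minus_le_iff)
  show thesis
    using that[of n "nat (k - block_start \<sigma> x n)"] n block_start_Suc[of \<sigma> x n] by simp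
qed

lemma morphism_Z_unique:
  assumes "nonerasing_morphism \<sigma>"
    and y: "\<And>n j. j < length (\<sigma> [x n]) \<Longrightarrow> y (block_start \<sigma> x n + int j) = \<sigma> [x n] ! j"
    and z: "\<And>n j. j < length (\<sigma> [x n]) \<Longrightarrow> z (block_start \<sigma> x n + int j) = \<sigma> [x n] ! j"
  shows "y = z"
proof
  fix k
  obtain n j where "k = block_start \<sigma> x n + int j" "j < length (\<sigma> [x n])"
    using position_in_block[OF assms(1)] by metis
  then show "y k = z k" by (simp add: y z)
qed

lemma morphism_Z_eqI:
  assumes "nonerasing_morphism \<sigma>"
    and "\<And>n j. j < length (\<sigma> [x n]) \<Longrightarrow> y (block_start \<sigma> x n + int j) = \<sigma> [x n] ! j"
  shows "morphism_Z \<sigma> x = y"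
  unfolding morphism_Z_def
  by (rule the_equality) (auto intro: morphism_Z_unique[OF assms(1)] assms(2))

lemma morphism_Z_block:
  assumes "nonerasing_morphism \<sigma>" "j < length (\<sigma> [x n])"
  shows "morphism_Z \<sigma> x (block_start \<sigma> x n + int j) = \<sigma> [x n] ! j"
proof -
  \<comment> \<open>a candidate with the required values: look up the block that contains position \<open>k\<close>\<close>
  define N where "N k = (THE n. block_start \<sigma> x n \<le> k \<and> k < block_start \<sigma> x (n + 1))" for k
  define y where "y k = \<sigma> [x (N k)] ! nat (k - block_start \<sigma> x (N k))" for k
  have y: "y (block_start \<sigma> x n + int j) = \<sigma> [x n] ! j" if "j < length (\<sigma> [x n])" for n j
  proof -
    have "N (block_start \<sigma> x n + int j) = n"
      unfolding N_def
    proof (rule the_equality)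
      show "block_start \<sigma> x n \<le> block_start \<sigma> x n + int j \<and>
          block_start \<sigma> x n + int j < block_start \<sigma> x (n + 1)"
        using that by (simp add: block_start_Suc)
      then show "m = n" if "block_start \<sigma> x m \<le> block_start \<sigma> x n + int j \<and>
          block_start \<sigma> x n + int j < block_start \<sigma> x (m + 1)" for m
        using that by (auto intro: block_unique[OF assms(1)])
    qed
    then show ?thesis by (simp add: y_def)
  qed
  then have "morphism_Z \<sigma> x = y" by (intro morphism_Z_eqI[OF assms(1)])
  then show ?thesis by (simp add: y assms(2))
qed

text \<open>Composition of morphisms and the reading of hat words both reduce to following one finite word
through the induced map.\<close>

lemma morphism_Z_word:
  assumes \<sigma>: "nonerasing_morphism \<sigma>" and "\<And>i. i < length u \<Longrightarrow> x (m + int i) = u ! i"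
  shows "block_start \<sigma> x (m + int (length u)) = block_start \<sigma> x m + int (length (\<sigma> u))"
    and "j < length (\<sigma> u) \<Longrightarrow> morphism_Z \<sigma> x (block_start \<sigma> x m + int j) = \<sigma> u ! j"
proof -
  let ?y = "morphism_Z \<sigma> x" and ?b = "block_start \<sigma> x"
  have "(\<forall>i<length u. x (m + int i) = u ! i) \<Longrightarrow>
      ?b (m + int (length u)) = ?b m + int (length (\<sigma> u)) \<and>
      (\<forall>j<length (\<sigma> u). ?y (?b m + int j) = \<sigma> u ! j)"
  proof (induction u rule: rev_induct)
    case Nil
    then show ?case by (simp add: nonerasing_Nil[OF \<sigma>])
  next
    case (snoc a u)
    have "\<forall>i<length u. x (m + int i) = u ! i"
      using snoc.prems by (auto simp: nth_append)
    then have bs: "?b (m + int (length u)) = ?b m + int (length (\<sigma> u))"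
      and y: "\<And>j. j < length (\<sigma> u) \<Longrightarrow> ?y (?b m + int j) = \<sigma> u ! j"
      using snoc.IH by auto
    have xa: "x (m + int (length u)) = a"
      using snoc.prems by (auto simp: nth_append)
    note s = nonerasing_append[OF \<sigma>, of u "[a]"]
    have "?y (?b m + int j) = \<sigma> (u @ [a]) ! j" if j: "j < length (\<sigma> (u @ [a]))" for j
    proof (cases "j < length (\<sigma> u)")
      case True
      then show ?thesis by (simp add: y s nth_append)
    next
      case False
      define i where "i = j - length (\<sigma> u)"
      then have i: "j = length (\<sigma> u) + i" using False by simp
      then have "i < length (\<sigma> [x (m + int (length u))])" using j by (simp add: s xa)
      then have "?y (?b (m + int (length u)) + int i) = \<sigma> [a] ! i"
        using morphism_Z_block[OF \<sigma>] by (metis xa)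
      then show ?thesis by (simp add: bs s i nth_append add_ac)
    qed
    then show ?case
      using block_start_Suc[of \<sigma> x "m + int (length u)"] bs xa by (simp add: s add_ac)
  qed
  then show "?b (m + int (length u)) = ?b m + int (length (\<sigma> u))"
    and "j < length (\<sigma> u) \<Longrightarrow> ?y (?b m + int j) = \<sigma> u ! j"
    using assms(2) by auto
qed

lemma length_image_word:
  assumes \<sigma>: "nonerasing_morphism \<sigma>"
  shows "length (\<sigma> w) = (\<Sum>i<length w. length (\<sigma> [w ! i]))"
proof (induction w rule: rev_induct)
  case (snoc a w)
  then show ?case by (simp add: nonerasing_append[OF \<sigma>] nth_append)
qed (simp add: nonerasing_Nil[OF \<sigma>])

lemma morphism_Z_comp:
  assumes \<sigma>: "nonerasing_morphism \<sigma>" and \<tau>: "nonerasing_morphism \<tau>"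
  shows "morphism_Z (\<tau> \<circ> \<sigma>) x = morphism_Z \<tau> (morphism_Z \<sigma> x)"
proof (rule morphism_Z_eqI[OF nonerasing_comp[OF \<sigma> \<tau>]])
  let ?y = "morphism_Z \<sigma> x"
  note word = morphism_Z_word[OF \<tau>, of "\<sigma> [x n]" ?y "block_start \<sigma> x n" for n,
      OF morphism_Z_block[OF \<sigma>]]
  have step: "block_start \<tau> ?y (block_start \<sigma> x (n + 1)) =
      block_start \<tau> ?y (block_start \<sigma> x n) + int (length (\<tau> (\<sigma> [x n])))" for n
    using word(1)[of n] by (simp add: block_start_Suc)
  have bs: "block_start (\<tau> \<circ> \<sigma>) x n = block_start \<tau> ?y (block_start \<sigma> x n)" for n
  proof (induction n rule: int_induct[of _ 1])
    case base
    show ?case by simp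
  next
    case (step1 i)
    then show ?case using step[of i] block_start_Suc[of "\<tau> \<circ> \<sigma>" x i] by (simp add: o_def)
  next
    case (step2 i)
    then show ?case using step[of "i - 1"] block_start_Suc[of "\<tau> \<circ> \<sigma>" x "i - 1"] by (simp add: o_def)
  qed
  show "morphism_Z \<tau> ?y (block_start (\<tau> \<circ> \<sigma>) x n + int j) = (\<tau> \<circ> \<sigma>) [x n] ! j"
    if "j < length ((\<tau> \<circ> \<sigma>) [x n])" for n j
    using word(2)[of n j] that by (simp add: bs)
qed

section \<open>Morphisms and the shift\<close>

lemma funpow_shift: "(shift ^^ n) x = (\<lambda>k. x (k + int n))"
  by (induction n) (simp_all add: shift_def add_ac)

lemma bij_shift: "bij (shift :: (int \<Rightarrow> 'a) \<Rightarrow> _)"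
  by (rule bij_betw_byWitness[where f' = "\<lambda>x k. x (k - 1)"]) (auto simp: shift_def)

lemma agree_shift: "agree (Suc n) x y \<Longrightarrow> agree n (shift x) (shift y)"
  by (auto simp: agree_def shift_def)

lemma agree_unshift: "agree (Suc n) (shift x) (shift y) \<Longrightarrow> agree n x y"
  unfolding agree_def
proof (intro allI impI)
  fix i assume "\<forall>i. \<bar>i\<bar> \<le> int (Suc n) \<longrightarrow> shift x i = shift y i" "\<bar>i\<bar> \<le> int n"
  then have "shift x (i - 1) = shift y (i - 1)" by (simp add: abs_le_iff)
  then show "x i = y i" by (simp add: shift_def)
qed

lemma agree_funpow_shift: "agree (n + j) x y \<Longrightarrow> agree n ((shift ^^ j) x) ((shift ^^ j) y)"
  by (auto simp: agree_def funpow_shift)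

text \<open>Deleting the first letter of \<open>x\<close> deletes the whole first block of the image; this is why the towers
over \<open>x\<close> and \<open>shift x\<close> fit together.\<close>

lemma morphism_Z_shift:
  assumes \<sigma>: "nonerasing_morphism \<sigma>"
  shows "morphism_Z \<sigma> (shift x) = (shift ^^ length (\<sigma> [x 1])) (morphism_Z \<sigma> x)"
proof (rule morphism_Z_eqI[OF \<sigma>])
  have bs: "block_start \<sigma> (shift x) n = block_start \<sigma> x (n + 1) - int (length (\<sigma> [x 1]))" for n
  proof (induction n rule: int_induct[of _ 1])
    case base
    show ?case using block_start_Suc[of \<sigma> x 1] by simp
  next
    case (step1 i)
    then show ?case
      using block_start_Suc[of \<sigma> x "i + 1"] block_start_Suc[of \<sigma> "shift x" i] by (simp add: shift_def)
  next
    case (step2 i)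
    then show ?case
      using block_start_Suc[of \<sigma> x i] block_start_Suc[of \<sigma> "shift x" "i - 1"] by (simp add: shift_def)
  qed
  show "(shift ^^ length (\<sigma> [x 1])) (morphism_Z \<sigma> x) (block_start \<sigma> (shift x) n + int j) =
      \<sigma> [shift x n] ! j" if "j < length (\<sigma> [shift x n])" for n j
    using morphism_Z_block[OF \<sigma>, of j x "n + 1"] that unfolding funpow_shift bs
    by (simp add: shift_def)
qed

lemma morphism_Z_funpow_shift:
  assumes \<sigma>: "nonerasing_morphism \<sigma>"
  shows "morphism_Z \<sigma> ((shift ^^ n) x) =
    (shift ^^ (\<Sum>i<n. length (\<sigma> [(shift ^^ i) x 1]))) (morphism_Z \<sigma> x)"
proof (induction n)
  case (Suc n)
  then show ?case
    by (simp add: morphism_Z_shift[OF \<sigma>] funpow_add[symmetric, THEN fun_cong, unfolded o_def] add.commute)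
qed simp

lemma morphism_Z_agree:
  assumes \<sigma>: "nonerasing_morphism \<sigma>" and "agree (Suc n) x y"
  shows "agree n (morphism_Z \<sigma> x) (morphism_Z \<sigma> y)"
  unfolding agree_def
proof (intro allI impI)
  fix k assume k: "\<bar>k\<bar> \<le> int n"
  have xy: "x i = y i" if "\<bar>i\<bar> \<le> int n + 1" for i
    using assms(2) that by (simp add: agree_def)
  have bs: "block_start \<sigma> x i = block_start \<sigma> y i" if "\<bar>i\<bar> \<le> int n" for i
    unfolding block_start_def using that by (intro arg_cong2[of _ _ _ _ minus] arg_cong2[of _ _ _ _ plus] refl sum.cong) (auto simp: xy)
  obtain i j where i: "k = block_start \<sigma> x i + int j" "j < length (\<sigma> [x i])" "\<bar>i\<bar> \<le> \<bar>k\<bar>"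
    by (rule position_in_block[OF \<sigma>])
  then show "morphism_Z \<sigma> x k = morphism_Z \<sigma> y k"
    using morphism_Z_block[OF \<sigma>, of j x i] morphism_Z_block[OF \<sigma>, of j y i] bs[of i] xy[of i] k by simp
qed

section \<open>Invariant measures\<close>

lemma inv_measuresD:
  assumes "\<mu> \<in> inv_measures X"
  shows "finite_measure \<mu>" "sets \<mu> = sets shift_borel" "space \<mu> = UNIV" "supp \<mu> \<subseteq> X"
    "A \<in> sets shift_borel \<Longrightarrow> emeasure \<mu> (shift -` A) = emeasure \<mu> A"
proof -
  show "sets \<mu> = sets shift_borel" using assms by (simp add: inv_measures_def)
  then show "space \<mu> = UNIV" using sets_eq_imp_space_eq[of \<mu> shift_borel] by simp
qed (use assms in \<open>auto simp: inv_measures_def\<close>)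

lemma inv_measures_mono: "\<mu> \<in> inv_measures X \<Longrightarrow> X \<subseteq> Y \<Longrightarrow> \<mu> \<in> inv_measures Y"
  by (auto simp: inv_measures_def)

lemma inv_measures_iff_UNIV: "\<mu> \<in> inv_measures X \<longleftrightarrow> \<mu> \<in> inv_measures UNIV \<and> supp \<mu> \<subseteq> X"
  by (auto simp: inv_measures_def)

lemma continuous_shift: "continuous_map full_shift full_shift shift"
  by (rule continuous_full_shiftI) (blast intro: agree_shift)

lemma continuous_morphism_Z:
  "nonerasing_morphism \<sigma> \<Longrightarrow> continuous_map full_shift full_shift (morphism_Z \<sigma>)"
  by (rule continuous_full_shiftI) (blast intro: morphism_Z_agree)

lemma measurable_shift [measurable]: "shift \<in> measurable shift_borel shift_borel"
  by (rule measurable_continuous_full_shift[OF continuous_shift])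

lemma measurable_funpow_shift [measurable]: "(shift ^^ n) \<in> measurable shift_borel shift_borel"
  by (induction n) simp_all

lemma measurable_morphism_Z:
  "nonerasing_morphism \<sigma> \<Longrightarrow> morphism_Z \<sigma> \<in> measurable shift_borel shift_borel"
  by (rule measurable_continuous_full_shift[OF continuous_morphism_Z])

lemma vimage_in_shift_borel:
  "f \<in> measurable shift_borel shift_borel \<Longrightarrow> A \<in> sets shift_borel \<Longrightarrow> f -` A \<in> sets shift_borel"
  using measurable_sets[of f shift_borel shift_borel A] by simp

lemma inv_measures_funpow:
  assumes "\<mu> \<in> inv_measures X" "A \<in> sets shift_borel"
  shows "emeasure \<mu> ((shift ^^ n) -` A) = emeasure \<mu> A"
proof (induction n)
  case (Suc n)
  have "(shift ^^ Suc n) -` A = shift -` ((shift ^^ n) -` A)"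
    by (auto simp: funpow_swap1)
  then show ?case
    unfolding \<open>(shift ^^ Suc n) -` A = _\<close>
    using Suc inv_measuresD(5)[OF assms(1) vimage_in_shift_borel[OF measurable_funpow_shift assms(2)]]
    by simp
qed simp

subsection \<open>Supports\<close>

lemma in_supp_iff: "x \<in> supp \<mu> \<longleftrightarrow> (\<forall>U. openin full_shift U \<longrightarrow> x \<in> U \<longrightarrow> emeasure \<mu> U \<noteq> 0)"
  unfolding supp_def by blast

lemma closed_supp: "closedin full_shift (supp \<mu>)"
  unfolding supp_def by (intro closedin_diff) (auto intro: closedin_topspace[of full_shift, simplified])

lemma emeasure_open_outside_supp:
  assumes "sets \<mu> = sets shift_borel" "openin full_shift U" "U \<inter> supp \<mu> = {}"
  shows "emeasure \<mu> U = 0"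
proof -
  let ?N = "{A \<in> window_sets. emeasure \<mu> A = 0}"
  have "U \<subseteq> \<Union> ?N"
  proof
    fix x assume "x \<in> U"
    then obtain V where V: "openin full_shift V" "x \<in> V" "emeasure \<mu> V = 0"
      using assms(3) unfolding disjoint_iff in_supp_iff by blast
    then obtain A where A: "A \<in> window_sets" "A \<subseteq> V" "x \<in> A"
      using open_Union_window_sets[OF V(1)] by blast
    have "emeasure \<mu> A \<le> emeasure \<mu> V"
      using A V open_in_shift_borel assms(1) by (intro emeasure_mono) auto
    then show "x \<in> \<Union> ?N" using A V by auto
  qed
  moreover have N: "\<Union> ?N \<in> null_sets \<mu>"
    using null_sets_UN'[of ?N "\<lambda>A. A" \<mu>] countable_subset[OF _ countable_window_sets, of ?N]
      window_set_in_shift_borel assms(1) by (auto simp: null_sets_def)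
  ultimately have "emeasure \<mu> U \<le> emeasure \<mu> (\<Union> ?N)"
    by (intro emeasure_mono) auto
  then show ?thesis using N by auto
qed

lemma supp_subset_iff:
  assumes "sets \<mu> = sets shift_borel" "closedin full_shift Y"
  shows "supp \<mu> \<subseteq> Y \<longleftrightarrow> emeasure \<mu> (- Y) = 0"
proof -
  have "openin full_shift (- Y)"
    using assms(2) by (simp add: closedin_def Compl_eq_Diff_UNIV)
  then show ?thesis
    using emeasure_open_outside_supp[OF assms(1), of "- Y"] by (auto simp: in_supp_iff)
qed

lemma supp_AE:
  assumes "sets \<mu> = sets shift_borel" "closedin full_shift Y" "supp \<mu> \<subseteq> Y"
  shows "AE x in \<mu>. x \<in> Y"
proof (rule AE_I[of _ _ "- Y"])
  show "emeasure \<mu> (- Y) = 0" using supp_subset_iff assms by blast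
  show "- Y \<in> sets \<mu>"
    using assms(1,2) open_in_shift_borel[of "- Y"] by (simp add: closedin_def Compl_eq_Diff_UNIV)
qed auto

lemma homeomorphism_shift_open:
  assumes "openin full_shift U"
  shows "openin full_shift (shift -` U)" "openin full_shift (shift ` U)"
proof -
  show "openin full_shift (shift -` U)"
    using openin_continuous_map_preimage[OF continuous_shift assms] by (simp add: vimage_def)
  show "openin full_shift (shift ` U)"
    unfolding openin_full_shift_iff
  proof
    fix y assume "y \<in> shift ` U"
    then obtain x where x: "x \<in> U" "y = shift x" by blast
    then obtain n where n: "\<And>z. agree n x z \<Longrightarrow> z \<in> U" using assms by (auto simp: openin_full_shift_iff)
    have "z \<in> shift ` U" if "agree (Suc n) y z" for z
    proof -
      obtain v where "z = shift v" using bij_shift by (metis bij_pointE)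
      then show ?thesis using that n agree_unshift[of n x v] x by auto
    qed
    then show "\<exists>n. \<forall>z. agree n y z \<longrightarrow> z \<in> shift ` U" by blast
  qed
qed

lemma shift_supp:
  assumes "\<mu> \<in> inv_measures X"
  shows "shift ` supp \<mu> = supp \<mu>"
proof -
  have inv: "emeasure \<mu> (shift -` U) = emeasure \<mu> U" if "openin full_shift U" for U
    using inv_measuresD(5)[OF assms] open_in_shift_borel that by blast
  have *: "shift x \<in> supp \<mu> \<longleftrightarrow> x \<in> supp \<mu>" for x
  proof
    assume sx: "shift x \<in> supp \<mu>"
    show "x \<in> supp \<mu>" unfolding in_supp_iff
    proof (intro allI impI)
      fix U assume U: "openin full_shift U" "x \<in> U"
      have "shift -` (shift ` U) = U" using bij_is_inj[OF bij_shift] by (rule inj_vimage_image_eq)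
      then have "emeasure \<mu> U = emeasure \<mu> (shift ` U)"
        using inv[OF homeomorphism_shift_open(2)[OF U(1)]] by simp
      then show "emeasure \<mu> U \<noteq> 0"
        using sx homeomorphism_shift_open(2)[OF U(1)] U(2) by (auto simp: in_supp_iff)
    qed
  next
    assume "x \<in> supp \<mu>"
    then have x: "openin full_shift V \<longrightarrow> x \<in> V \<longrightarrow> emeasure \<mu> V \<noteq> 0" for V
      unfolding in_supp_iff by blast
    show "shift x \<in> supp \<mu>" unfolding in_supp_iff
    proof (intro allI impI)
      fix U assume U: "openin full_shift U" "shift x \<in> U"
      then show "emeasure \<mu> U \<noteq> 0"
        using x[of "shift -` U"] homeomorphism_shift_open(1)[OF U(1)] inv[OF U(1)] by simp
    qed
  qed
  show ?thesis
  proof (intro equalityI subsetI)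
    fix y assume "y \<in> supp \<mu>"
    moreover obtain x where "y = shift x" using bij_shift by (metis bij_pointE)
    ultimately show "y \<in> shift ` supp \<mu>" using * by blast
  qed (use * in auto)
qed

subsection \<open>Cylinders determine an invariant measure\<close>

lemma in_cylinder_iff: "x \<in> cylinder w \<longleftrightarrow> (\<forall>i<length w. x (1 + int i) = w ! i)"
proof -
  have "x \<in> cylinder w \<longleftrightarrow> map x [1..int (length w)] = w" by (simp add: cylinder_def)
  also have "\<dots> \<longleftrightarrow> (\<forall>i<length w. map x [1..int (length w)] ! i = w ! i)"
    by (subst list_eq_iff_nth_eq) simp
  also have "\<dots> \<longleftrightarrow> (\<forall>i<length w. x (1 + int i) = w ! i)"
    by (intro all_cong) (simp add: nth_upto)
  finally show ?thesis .
qed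

lemma cylinder_window_set: "cylinder w \<in> window_sets"
proof -
  have "agree (length w) x y \<Longrightarrow> x \<in> cylinder w \<longleftrightarrow> y \<in> cylinder w" for x y :: "int \<Rightarrow> 'a"
    by (auto simp: in_cylinder_iff agree_def)
  then show ?thesis unfolding window_sets_def by blast
qed

lemma cylinder_in_shift_borel: "cylinder w \<in> sets shift_borel"
  by (simp add: cylinder_window_set window_set_in_shift_borel)

lemma in_cylinder_map: "x \<in> cylinder (map x [1..int n])"
  by (simp add: cylinder_def)

lemma in_cylinder_map_iff: "y \<in> cylinder (map x [1..int n]) \<longleftrightarrow> (\<forall>i<n. y (1 + int i) = x (1 + int i))"
  by (simp add: in_cylinder_iff nth_upto)

lemma cylinder_disjoint:
  "length v = length w \<Longrightarrow> x \<in> cylinder v \<Longrightarrow> x \<in> cylinder w \<Longrightarrow> v = w"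
  by (simp add: cylinder_def)

lemma finite_words: "finite {w :: 'a::finite list. length w = n}"
  using finite_lists_length_eq[of "UNIV :: 'a set" n] by simp

text \<open>Cylinders only constrain positive coordinates. Shifting a two-sided window to the positive side turns
a finitely determined set into a finite disjoint union of cylinders, so that for invariant measures
nothing is lost.\<close>

lemma window_set_cylinders:
  fixes A :: "(int \<Rightarrow> 'a::finite) set"
  assumes "A \<in> window_sets"
  obtains m n P where "P \<subseteq> {w. length w = Suc n}" "(shift ^^ m) -` A = (\<Union>w\<in>P. cylinder w)"
proof -
  obtain n where n: "\<forall>x y. agree n x y \<longrightarrow> (x \<in> A \<longleftrightarrow> y \<in> A)"
    using assms by (auto simp: window_sets_def)
  let ?B = "(shift ^^ Suc n) -` A"
  define P where "P = {w. length w = Suc (2 * n) \<and> cylinder w \<subseteq> ?B}"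
  have "x \<in> (\<Union>w\<in>P. cylinder w)" if x: "x \<in> ?B" for x
  proof -
    let ?w = "map x [1..int (Suc (2 * n))]"
    have "y \<in> ?B" if y: "y \<in> cylinder ?w" for y
    proof -
      have "y (1 + int i) = x (1 + int i)" if "i < Suc (2 * n)" for i
        using y that unfolding in_cylinder_map_iff by blast
      note * = this
      have "y (k + int (Suc n)) = x (k + int (Suc n))" if "\<bar>k\<bar> \<le> int n" for k
      proof -
        have "nat (k + int n) < Suc (2 * n)" "k + int (Suc n) = 1 + int (nat (k + int n))"
          using that by linarith+
        then show ?thesis using *[of "nat (k + int n)"] by (simp only:)
      qed
      then have "agree n ((shift ^^ Suc n) y) ((shift ^^ Suc n) x)"
        unfolding agree_def funpow_shift by blast
      then show ?thesis using n x by blast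
    qed
    moreover have "length ?w = Suc (2 * n)" by (simp only: length_map length_upto)
    ultimately have "?w \<in> P" unfolding P_def by blast
    then show ?thesis using in_cylinder_map[of x "Suc (2 * n)"] by blast
  qed
  moreover have "cylinder w \<subseteq> ?B" if "w \<in> P" for w using that unfolding P_def by blast
  ultimately have "?B = (\<Union>w\<in>P. cylinder w)" by blast
  moreover have "P \<subseteq> {w. length w = Suc (2 * n)}" unfolding P_def by blast
  ultimately show thesis by (rule that[rotated])
qed

lemma measure_eqI_window_sets:
  fixes \<mu> \<nu> :: "(int \<Rightarrow> 'a::finite) measure"
  assumes "finite_measure \<mu>" "sets \<mu> = sets shift_borel" "sets \<nu> = sets shift_borel"
    and "\<And>A. A \<in> window_sets \<Longrightarrow> emeasure \<mu> A = emeasure \<nu> A"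
  shows "\<mu> = \<nu>"
proof (rule measure_eqI_generator_eq[of window_sets UNIV \<mu> \<nu> "\<lambda>_. UNIV"])
  show "Int_stable (window_sets :: (int \<Rightarrow> 'a) set set)"
    using algebra_window_sets unfolding Int_stable_def algebra_iff_Int by blast
  show "range (\<lambda>_. UNIV) \<subseteq> (window_sets :: (int \<Rightarrow> 'a) set set)"
    by (auto simp: window_sets_def)
  show "emeasure \<mu> UNIV \<noteq> \<infinity>" using finite_measure.emeasure_finite[OF assms(1)] by simp
qed (auto simp: assms(4) assms(2,3)[THEN trans, OF sets_shift_borel_window])

lemma inv_measure_eqI:
  assumes "\<mu> \<in> inv_measures UNIV" "\<nu> \<in> inv_measures UNIV"
    and eq: "\<And>w. w \<noteq> [] \<Longrightarrow> measure \<mu> (cylinder w) = measure \<nu> (cylinder w)"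
  shows "\<mu> = \<nu>"
proof -
  interpret M: finite_measure \<mu> using inv_measuresD(1)[OF assms(1)] .
  interpret N: finite_measure \<nu> using inv_measuresD(1)[OF assms(2)] .
  note sets = inv_measuresD(2)[OF assms(1)] inv_measuresD(2)[OF assms(2)]
  have win: "emeasure \<mu> A = emeasure \<nu> A" if A: "A \<in> window_sets" for A
  proof -
    obtain m n P where P: "P \<subseteq> {w. length w = Suc n}" "(shift ^^ m) -` A = (\<Union>w\<in>P. cylinder w)"
      using window_set_cylinders[OF A] .
    have fin: "finite P" using P(1) finite_words by (rule finite_subset)
    have "cylinder v \<inter> cylinder w = {}" if "v \<in> P" "w \<in> P" "v \<noteq> w" for v w
    proof -
      have "length v = Suc n" "length w = Suc n" using P(1) that(1,2) by auto
      then show ?thesis using cylinder_disjoint[of v w] that(3) by auto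
    qed
    then have dis: "disjoint_family_on cylinder P"
      unfolding disjoint_family_on_def by blast
    have "measure \<mu> (\<Union>w\<in>P. cylinder w) = (\<Sum>w\<in>P. measure \<mu> (cylinder w))"
      using dis by (intro M.finite_measure_finite_Union[OF fin]) (auto simp: sets cylinder_in_shift_borel)
    also have "\<dots> = (\<Sum>w\<in>P. measure \<nu> (cylinder w))" using P(1) by (intro sum.cong refl eq) auto
    also have "\<dots> = measure \<nu> (\<Union>w\<in>P. cylinder w)"
      using dis by (intro N.finite_measure_finite_Union[OF fin, symmetric])
        (auto simp: sets cylinder_in_shift_borel)
    finally have "emeasure \<mu> ((shift ^^ m) -` A) = emeasure \<nu> ((shift ^^ m) -` A)"
      by (simp add: P(2) M.emeasure_eq_measure N.emeasure_eq_measure)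
    then show ?thesis
      using inv_measures_funpow[OF assms(1)] inv_measures_funpow[OF assms(2)]
        window_set_in_shift_borel[OF A] by simp
  qed
  show ?thesis by (rule measure_eqI_window_sets[OF M.finite_measure_axioms sets win])
qed

subsection \<open>Sums and multiples of measures\<close>

lemma sets_add_measure [simp, measurable_cong]: "sets (add_measure \<mu> \<nu>) = sets \<mu>"
  by (simp add: add_measure_def sets.sigma_sets_eq)

lemma emeasure_add_measure:
  assumes "sets \<mu> = sets \<nu>"
  shows "emeasure (add_measure \<mu> \<nu>) A = emeasure \<mu> A + emeasure \<nu> A"
proof (cases "A \<in> sets \<mu>")
  case True
  show ?thesis unfolding add_measure_def
  proof (rule emeasure_measure_of_sigma[OF sets.sigma_algebra_axioms _ _ True])
    show "positive (sets \<mu>) (\<lambda>A. emeasure \<mu> A + emeasure \<nu> A)" by (simp add: positive_def)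
    show "countably_additive (sets \<mu>) (\<lambda>A. emeasure \<mu> A + emeasure \<nu> A)"
      unfolding countably_additive_def
      using assms by (auto simp: suminf_add[symmetric] suminf_emeasure)
  qed
next
  case False
  then show ?thesis using assms by (simp add: emeasure_notin_sets)
qed

lemma add_measure_in_inv:
  assumes "\<mu> \<in> inv_measures X" "\<nu> \<in> inv_measures X"
  shows "add_measure \<mu> \<nu> \<in> inv_measures X"
proof -
  interpret M: finite_measure \<mu> using inv_measuresD(1)[OF assms(1)] .
  interpret N: finite_measure \<nu> using inv_measuresD(1)[OF assms(2)] .
  note sets = inv_measuresD(2)[OF assms(1)] inv_measuresD(2)[OF assms(2)]
  have em: "emeasure (add_measure \<mu> \<nu>) A = emeasure \<mu> A + emeasure \<nu> A" for A
    by (simp add: emeasure_add_measure sets)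
  have "finite_measure (add_measure \<mu> \<nu>)"
    by (rule finite_measureI) (simp add: em M.emeasure_finite N.emeasure_finite ennreal_add_eq_top)
  moreover have "supp (add_measure \<mu> \<nu>) \<subseteq> X"
  proof
    fix x assume x: "x \<in> supp (add_measure \<mu> \<nu>)"
    show "x \<in> X"
    proof (rule ccontr)
      assume "x \<notin> X"
      then have "x \<notin> supp \<mu>" "x \<notin> supp \<nu>" using inv_measuresD(4) assms by blast+
      then obtain U V where U: "openin full_shift U" "x \<in> U" "emeasure \<mu> U = 0"
        and V: "openin full_shift V" "x \<in> V" "emeasure \<nu> V = 0" by (auto simp: in_supp_iff)
      have "emeasure \<mu> (U \<inter> V) \<le> emeasure \<mu> U" "emeasure \<nu> (U \<inter> V) \<le> emeasure \<nu> V"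
        using emeasure_mono[of "U \<inter> V" U \<mu>] emeasure_mono[of "U \<inter> V" V \<nu>] U(1) V(1)
        by (simp_all add: sets open_in_shift_borel)
      then have "emeasure (add_measure \<mu> \<nu>) (U \<inter> V) = 0" using U V by (simp add: em)
      then show False using x U V openin_Int[of full_shift U V] unfolding in_supp_iff by blast
    qed
  qed
  ultimately show ?thesis
    using inv_measuresD(5)[OF assms(1)] inv_measuresD(5)[OF assms(2)]
    by (simp add: inv_measures_def em sets)
qed

lemma scale_measure_in_inv:
  assumes "\<mu> \<in> inv_measures X"
  shows "scale_measure (ennreal c) \<mu> \<in> inv_measures X"
proof -
  interpret M: finite_measure \<mu> using inv_measuresD(1)[OF assms] .
  have "finite_measure (scale_measure (ennreal c) \<mu>)"
    by (rule finite_measureI) (simp add: ennreal_mult_eq_top_iff M.emeasure_finite)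
  moreover have "supp (scale_measure (ennreal c) \<mu>) \<subseteq> supp \<mu>"
    by (auto simp: in_supp_iff)
  ultimately show ?thesis
    using inv_measuresD[OF assms] by (auto simp: inv_measures_def)
qed

section \<open>The transferred measure as an integral over a tower\<close>

lemma measurable_cong_shift_borel:
  "sets \<mu> = sets shift_borel \<Longrightarrow> f \<in> measurable shift_borel N \<Longrightarrow> f \<in> measurable \<mu> N"
  using measurable_cong_sets[of \<mu> shift_borel N N] by blast

lemma distr_shift:
  assumes "\<mu> \<in> inv_measures X"
  shows "distr \<mu> shift_borel shift = \<mu>"
proof (rule measure_eqI)
  note m = measurable_cong_shift_borel[OF inv_measuresD(2)[OF assms] measurable_shift]
  fix A assume "A \<in> sets (distr \<mu> shift_borel shift)"
  then have A: "A \<in> sets shift_borel" by simp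
  show "emeasure (distr \<mu> shift_borel shift) A = emeasure \<mu> A"
    unfolding emeasure_distr[OF m A] inv_measuresD(3)[OF assms] Int_UNIV_right
    by (rule inv_measuresD(5)[OF assms A])
qed (simp add: inv_measuresD(2)[OF assms])

lemma nn_integral_shift:
  assumes "\<mu> \<in> inv_measures X" "f \<in> borel_measurable shift_borel"
  shows "(\<integral>\<^sup>+x. f (shift x) \<partial>\<mu>) = (\<integral>\<^sup>+x. f x \<partial>\<mu>)"
proof -
  note m = measurable_cong_shift_borel[OF inv_measuresD(2)[OF assms(1)] measurable_shift]
  show ?thesis
    using nn_integral_distr[OF m, of f] measurable_cong_shift_borel[OF inv_measuresD(2)[OF assms(1)] assms(2)]
    unfolding distr_shift[OF assms(1)] by simp
qed

text \<open>The points \<open>(x, j)\<close> with \<open>j < |\<sigma>(x\<^sub>1)|\<close> form the tower over the base shift. Its natural measure, of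
total mass \<open>\<integral> |\<sigma>(x\<^sub>1)| d\<mu>\<close>, is pushed forward by the map that sends \<open>(x, j)\<close> to level \<open>j\<close>.\<close>

definition tower_measure ::
    "('a::finite list \<Rightarrow> 'b::finite list) \<Rightarrow> (int \<Rightarrow> 'a) measure \<Rightarrow> (int \<Rightarrow> 'b) measure" where
  "tower_measure \<sigma> \<mu> =
     distr (density (\<mu> \<Otimes>\<^sub>M count_space UNIV) (\<lambda>(x, j). indicator {..<length (\<sigma> [x 1])} j))
       shift_borel (\<lambda>(x, j). (shift ^^ j) (morphism_Z \<sigma> x))"

lemma sets_tower_measure [simp, measurable_cong]: "sets (tower_measure \<sigma> \<mu>) = sets shift_borel"
  by (simp add: tower_measure_def)

lemma space_tower_measure [simp]: "space (tower_measure \<sigma> \<mu>) = UNIV"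
  by (simp add: tower_measure_def)

lemma nn_integral_count_space_initial:
  fixes f :: "nat \<Rightarrow> ennreal"
  shows "(\<integral>\<^sup>+j. indicator {..<n} j * f j \<partial>count_space UNIV) = (\<Sum>j<n. f j)"
proof -
  have "(\<integral>\<^sup>+j. indicator {..<n} j * f j \<partial>count_space UNIV) = (\<integral>\<^sup>+j. f j * indicator {..<n} j \<partial>count_space UNIV)"
    by (simp add: mult.commute)
  also have "\<dots> = (\<integral>\<^sup>+j. f j \<partial>count_space {..<n})"
    by (simp add: nn_integral_count_space_indicator)
  finally show ?thesis by (simp add: nn_integral_count_space_finite)
qed

lemma measurable_letter: "(\<lambda>x. f (x i)) \<in> measurable shift_borel (count_space UNIV)"
  by (rule measurable_window_determined[of "nat \<bar>i\<bar>"]) (simp add: agree_def)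

lemma nn_integral_tower_measure:
  assumes \<sigma>: "nonerasing_morphism \<sigma>" and sets: "sets \<mu> = sets shift_borel"
    and g: "g \<in> borel_measurable shift_borel"
  shows "(\<integral>\<^sup>+y. g y \<partial>tower_measure \<sigma> \<mu>) =
    (\<integral>\<^sup>+x. (\<Sum>j<length (\<sigma> [x 1]). g ((shift ^^ j) (morphism_Z \<sigma> x))) \<partial>\<mu>)"
proof -
  let ?P = "\<mu> \<Otimes>\<^sub>M count_space (UNIV :: nat set)"
  let ?h = "\<lambda>(x, j). (shift ^^ j) (morphism_Z \<sigma> x)"
  let ?d = "\<lambda>(x :: int \<Rightarrow> 'a, j :: nat). indicator {..<length (\<sigma> [x 1])} j :: ennreal"
  interpret C: sigma_finite_measure "count_space (UNIV :: nat set)"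
    by (rule sigma_finite_measure_count_space)
  have fst: "fst \<in> measurable ?P shift_borel"
    using measurable_fst[of \<mu> "count_space (UNIV :: nat set)"] measurable_cong_sets[OF refl sets] by auto
  have "(\<lambda>p. (shift ^^ j) (morphism_Z \<sigma> (fst p))) \<in> measurable ?P shift_borel" for j
    by (intro measurable_compose[OF _ measurable_funpow_shift]
        measurable_compose[OF _ measurable_morphism_Z[OF \<sigma>]] fst)
  then have h: "?h \<in> measurable ?P shift_borel"
    using measurable_compose_countable[of "\<lambda>j p. (shift ^^ j) (morphism_Z \<sigma> (fst p))" ?P shift_borel snd]
    by (simp add: case_prod_beta')
  have "(\<lambda>p. indicator {..<length (\<sigma> [fst p 1])} j :: ennreal) \<in> borel_measurable ?P" for j
    using measurable_compose[OF fst measurable_letter[of "\<lambda>a. indicator {..<length (\<sigma> [a])} j :: ennreal" 1]]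
    by (rule measurable_compose) simp
  then have d: "?d \<in> borel_measurable ?P"
    using measurable_compose_countable[of "\<lambda>j p. indicator {..<length (\<sigma> [fst p 1])} j :: ennreal" ?P borel snd]
    by (simp add: case_prod_beta')
  have gh: "(\<lambda>p. g (?h p)) \<in> borel_measurable ?P" by (rule measurable_compose[OF h g])
  have "(\<integral>\<^sup>+y. g y \<partial>tower_measure \<sigma> \<mu>) = (\<integral>\<^sup>+p. g (?h p) \<partial>density ?P ?d)"
    unfolding tower_measure_def by (rule nn_integral_distr) (use h g in simp_all)
  also have "\<dots> = (\<integral>\<^sup>+p. ?d p * g (?h p) \<partial>?P)"
    by (rule nn_integral_density[OF d gh])
  also have "\<dots> = (\<integral>\<^sup>+x. (\<integral>\<^sup>+j. ?d (x, j) * g (?h (x, j)) \<partial>count_space UNIV) \<partial>\<mu>)"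
    by (rule C.nn_integral_fst[symmetric]) (rule borel_measurable_times_ennreal[OF d gh])
  also have "\<dots> = (\<integral>\<^sup>+x. (\<Sum>j<length (\<sigma> [x 1]). g ((shift ^^ j) (morphism_Z \<sigma> x))) \<partial>\<mu>)"
    by (simp add: nn_integral_count_space_initial)
  finally show ?thesis .
qed

lemma measurable_level_sum:
  fixes g :: "(int \<Rightarrow> 'b::finite) \<Rightarrow> 'c::{second_countable_topology,topological_comm_monoid_add}"
  assumes \<sigma>: "nonerasing_morphism \<sigma>" and sets: "sets \<mu> = sets shift_borel"
    and g: "g \<in> borel_measurable shift_borel"
  shows "(\<lambda>x. \<Sum>j<length (\<sigma> [x 1]). g ((shift ^^ j) (morphism_Z \<sigma> x))) \<in> borel_measurable \<mu>"
proof -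
  have "(\<lambda>x. \<Sum>j<n. g ((shift ^^ j) (morphism_Z \<sigma> x))) \<in> borel_measurable shift_borel" for n
    by (intro borel_measurable_sum measurable_compose[OF _ g] measurable_morphism_Z[OF \<sigma>]
        measurable_compose[OF _ measurable_funpow_shift])
  then have "(\<lambda>x. \<Sum>j<length (\<sigma> [x 1]). g ((shift ^^ j) (morphism_Z \<sigma> x))) \<in> borel_measurable shift_borel"
    by (rule measurable_compose_countable) (rule measurable_letter)
  then show ?thesis by (rule measurable_cong_shift_borel[OF sets])
qed

lemma emeasure_tower_measure:
  assumes "nonerasing_morphism \<sigma>" "sets \<mu> = sets shift_borel" "B \<in> sets shift_borel"
  shows "emeasure (tower_measure \<sigma> \<mu>) B =
    (\<integral>\<^sup>+x. (\<Sum>j<length (\<sigma> [x 1]). indicator B ((shift ^^ j) (morphism_Z \<sigma> x))) \<partial>\<mu>)"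
  using nn_integral_tower_measure[OF assms(1,2), of "indicator B"] assms(3) by simp

lemma length_image_bounded: "\<exists>R. \<forall>a :: 'a::finite. length (\<sigma> [a]) \<le> R"
  using member_le_sum[of _ UNIV "\<lambda>a :: 'a. length (\<sigma> [a])"] by auto

text \<open>Shifting all levels removes the bottom of the tower over \<open>x\<close> and adds the bottom of the tower over
\<open>shift x\<close>. The removed term is moved to the other side so that the identity also makes sense in
\<open>ennreal\<close>.\<close>

lemma shift_tower_step:
  fixes g :: "(int \<Rightarrow> 'b) \<Rightarrow> 'c::comm_monoid_add"
  assumes "nonerasing_morphism \<sigma>"
  shows "(\<Sum>j<length (\<sigma> [x 1]). g (shift ((shift ^^ j) (morphism_Z \<sigma> x)))) + g (morphism_Z \<sigma> x) =
    (\<Sum>j<length (\<sigma> [x 1]). g ((shift ^^ j) (morphism_Z \<sigma> x))) + g (morphism_Z \<sigma> (shift x))"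
  using sum.lessThan_Suc_shift[of "\<lambda>j. g ((shift ^^ j) (morphism_Z \<sigma> x))" "length (\<sigma> [x 1])"]
  by (simp add: morphism_Z_shift[OF assms] add.commute)

text \<open>After integration of \<open>shift_tower_step\<close> the two extra terms are equal by the invariance of \<open>\<mu>\<close>, and
they cancel because they are finite.\<close>

lemma tower_measure_invariant:
  assumes \<sigma>: "nonerasing_morphism \<sigma>" and \<mu>: "\<mu> \<in> inv_measures X"
  shows "tower_measure \<sigma> \<mu> \<in> inv_measures UNIV"
proof -
  let ?\<nu> = "tower_measure \<sigma> \<mu>" and ?S = "morphism_Z \<sigma>"
  interpret M: finite_measure \<mu> using inv_measuresD(1)[OF \<mu>] .
  note sets = inv_measuresD(2)[OF \<mu>]
  note em = emeasure_tower_measure[OF \<sigma> sets]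
  obtain R where R: "\<And>a. length (\<sigma> [a]) \<le> R"
    using length_image_bounded[of \<sigma>] by blast
  have S: "?S \<in> measurable \<mu> shift_borel"
    by (rule measurable_cong_shift_borel[OF sets measurable_morphism_Z[OF \<sigma>]])
  note levels = measurable_level_sum[OF \<sigma> sets]
  have fin: "finite_measure ?\<nu>"
  proof (rule finite_measureI)
    have "emeasure ?\<nu> UNIV = (\<integral>\<^sup>+x. of_nat (length (\<sigma> [x 1])) \<partial>\<mu>)"
      using em[of UNIV] sets.top[of "shift_borel :: (int \<Rightarrow> 'b) measure"] by simp
    also have "\<dots> \<le> (\<integral>\<^sup>+x. of_nat R \<partial>\<mu>)"
      by (intro nn_integral_mono) (simp add: R)
    also have "\<dots> < \<infinity>"
      by (simp add: ennreal_mult_eq_top_iff M.emeasure_finite less_top[symmetric])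
    finally show "emeasure ?\<nu> (space ?\<nu>) \<noteq> \<infinity>" by simp
  qed
  have "emeasure ?\<nu> (shift -` A) = emeasure ?\<nu> A" if A: "A \<in> sets shift_borel" for A
  proof -
    let ?g = "indicator A :: (int \<Rightarrow> 'b) \<Rightarrow> ennreal"
    have g: "?g \<in> borel_measurable shift_borel" using A by simp
    have gS: "(\<lambda>x. ?g (?S x)) \<in> borel_measurable \<mu>" by (rule measurable_compose[OF S g])
    have gS': "(\<lambda>x. ?g (?S (shift x))) \<in> borel_measurable \<mu>"
      by (intro measurable_cong_shift_borel[OF sets]
          measurable_compose[OF measurable_shift measurable_compose[OF measurable_morphism_Z[OF \<sigma>] g]])
    have gsh: "(\<lambda>x. ?g (shift x)) \<in> borel_measurable shift_borel"
      by (rule measurable_compose[OF measurable_shift g])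
    have "emeasure ?\<nu> (shift -` A) + (\<integral>\<^sup>+x. ?g (?S x) \<partial>\<mu>) =
        (\<integral>\<^sup>+x. (\<Sum>j<length (\<sigma> [x 1]). ?g (shift ((shift ^^ j) (?S x)))) + ?g (?S x) \<partial>\<mu>)"
      using em[OF vimage_in_shift_borel[OF measurable_shift A]] nn_integral_add[OF levels[OF gsh] gS]
      by (simp add: indicator_vimage[symmetric] o_def indicator_def)
    also have "\<dots> = (\<integral>\<^sup>+x. (\<Sum>j<length (\<sigma> [x 1]). ?g ((shift ^^ j) (?S x))) + ?g (?S (shift x)) \<partial>\<mu>)"
      by (simp add: shift_tower_step[OF \<sigma>])
    also have "\<dots> = emeasure ?\<nu> A + (\<integral>\<^sup>+x. ?g (?S (shift x)) \<partial>\<mu>)"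
      by (simp add: nn_integral_add[OF levels[OF g] gS'] em[OF A])
    also have "(\<integral>\<^sup>+x. ?g (?S (shift x)) \<partial>\<mu>) = (\<integral>\<^sup>+x. ?g (?S x) \<partial>\<mu>)"
      by (rule nn_integral_shift[OF \<mu>]) (rule measurable_compose[OF measurable_morphism_Z[OF \<sigma>] g])
    finally have eq: "emeasure ?\<nu> (shift -` A) + (\<integral>\<^sup>+x. ?g (?S x) \<partial>\<mu>) =
        emeasure ?\<nu> A + (\<integral>\<^sup>+x. ?g (?S x) \<partial>\<mu>)" .
    have "(\<integral>\<^sup>+x. ?g (?S x) \<partial>\<mu>) \<le> (\<integral>\<^sup>+x. 1 \<partial>\<mu>)"
      by (intro nn_integral_mono) (simp add: indicator_def)
    then have "(\<integral>\<^sup>+x. ?g (?S x) \<partial>\<mu>) \<noteq> \<infinity>"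
      using M.emeasure_finite[of "space \<mu>"] by (auto simp: top_unique)
    then show ?thesis using eq by (simp add: ennreal_add_left_cancel add.commute)
  qed
  then show ?thesis using fin by (simp add: inv_measures_def)
qed

section \<open>The defining cylinder sums\<close>

lemma pi_word_Nil [simp]: "pi_word \<sigma> [] = []"
  and pi_word_append: "pi_word \<sigma> (u @ v) = pi_word \<sigma> u @ pi_word \<sigma> v"
  and pi_word_single: "pi_word \<sigma> [a] = map (Pair a) [1..<Suc (length (\<sigma> [a]))]"
  by (simp_all add: pi_word_def)

lemma length_pi_word_single [simp]: "length (pi_word \<sigma> [a]) = length (\<sigma> [a])"
  by (simp add: pi_word_single del: upt_Suc)

lemma pi_word_single_nth: "j < length (\<sigma> [a]) \<Longrightarrow> pi_word \<sigma> [a] ! j = (a, Suc j)"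
  by (simp add: pi_word_single del: upt_Suc)

lemma nonerasing_pi_word: "nonerasing_morphism \<sigma> \<Longrightarrow> nonerasing_morphism (pi_word \<sigma>)"
  unfolding nonerasing_morphism_def by (simp add: pi_word_append)

lemma block_start_pi_word: "block_start (pi_word \<sigma>) = block_start \<sigma>"
  by (intro ext) (simp add: block_start_def)

lemma subdivided_point:
  assumes \<sigma>: "nonerasing_morphism \<sigma>"
  obtains n j where "k = block_start \<sigma> x n + int j" "j < length (\<sigma> [x n])"
    "morphism_Z (pi_word \<sigma>) x k = (x n, Suc j)" "morphism_Z \<sigma> x k = \<sigma> [x n] ! j"
proof -
  obtain n j where *: "k = block_start \<sigma> x n + int j" "j < length (\<sigma> [x n])"
    by (rule position_in_block[OF \<sigma>])
  then show thesis
    using that[OF *] morphism_Z_block[OF nonerasing_pi_word[OF \<sigma>], of j x n] morphism_Z_block[OF \<sigma>, of j x n]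
    by (simp add: block_start_pi_word pi_word_single_nth)
qed

lemma morphism_Z_subdivided:
  assumes \<sigma>: "nonerasing_morphism \<sigma>"
  shows "morphism_Z (pi_word \<sigma>) x k \<in> subdivided_alphabet \<sigma>"
    and "(\<lambda>(a, k). \<sigma> [a] ! (k - 1)) (morphism_Z (pi_word \<sigma>) x k) = morphism_Z \<sigma> x k"
  by (rule subdivided_point[OF \<sigma>, of k x]; simp add: subdivided_alphabet_def)+

lemma morphism_Z_pi_first_block:
  assumes \<sigma>: "nonerasing_morphism \<sigma>" and "j < length (\<sigma> [x 1])"
  shows "morphism_Z (pi_word \<sigma>) x (1 + int j) = (x 1, Suc j)"
  using morphism_Z_block[OF nonerasing_pi_word[OF \<sigma>], of j x 1] assms(2)
  by (simp add: pi_word_single_nth)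

text \<open>The points of the base in whose tower \<open>u\<close> is read, starting at the level that the first letter of
\<open>u\<close> names.\<close>

definition hat_set :: "('a list \<Rightarrow> 'b list) \<Rightarrow> ('a \<times> nat) list \<Rightarrow> (int \<Rightarrow> 'a) set" where
  "hat_set \<sigma> u =
     {x. x 1 = fst (hd u) \<and> (shift ^^ (snd (hd u) - 1)) (morphism_Z (pi_word \<sigma>) x) \<in> cylinder u}"

lemma hat_setD:
  assumes "x \<in> hat_set \<sigma> u" "i < length u"
  shows "x 1 = fst (hd u)" "morphism_Z (pi_word \<sigma>) x (1 + int (snd (hd u) - 1 + i)) = u ! i"
  using assms by (auto simp: hat_set_def in_cylinder_iff funpow_shift add_ac)

lemma hat_set_window_set:
  assumes \<sigma>: "nonerasing_morphism \<sigma>"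
  shows "hat_set \<sigma> u \<in> window_sets"
proof -
  let ?k = "snd (hd u) - 1"
  obtain n where n: "\<forall>x y. agree n x y \<longrightarrow> (x \<in> cylinder u \<longleftrightarrow> y \<in> cylinder u)"
    using cylinder_window_set[of u] by (auto simp: window_sets_def)
  have "x \<in> hat_set \<sigma> u \<longleftrightarrow> y \<in> hat_set \<sigma> u" if xy: "agree (Suc (n + ?k)) x y" for x y
  proof -
    have "x 1 = y 1" using xy by (simp add: agree_def)
    moreover have "agree n ((shift ^^ ?k) (morphism_Z (pi_word \<sigma>) x)) ((shift ^^ ?k) (morphism_Z (pi_word \<sigma>) y))"
      by (intro agree_funpow_shift morphism_Z_agree[OF nonerasing_pi_word[OF \<sigma>]] xy)
    ultimately show ?thesis using n by (simp add: hat_set_def)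
  qed
  then show ?thesis unfolding window_sets_def by blast
qed

lemma hat_word_minimal:
  assumes "sublist u (pi_word \<sigma> v)"
  shows "sublist u (pi_word \<sigma> (hat_word \<sigma> u))"
    and "sublist u (pi_word \<sigma> w) \<Longrightarrow> length (hat_word \<sigma> u) \<le> length w"
  using arg_min_nat_lemma[of "\<lambda>v. sublist u (pi_word \<sigma> v)" v length] assms
  by (simp_all add: hat_word_def)

lemma sublist_of_suffix:
  assumes "p @ u @ s = q @ r" "length q \<le> length p"
  shows "sublist u r"
proof -
  have "r = drop (length q) p @ u @ s"
    using assms by (metis append_eq_append_conv_if append_take_drop_id append_eq_conv_conj drop_append
        diff_is_0_eq' drop0)
  then show ?thesis by (auto simp: sublist_def)
qed

lemma sublist_of_prefix:
  assumes "p @ u @ s = q @ r" "length p + length u \<le> length q"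
  shows "sublist u q"
proof -
  have "q = take (length q) ((p @ u) @ s)" using assms(1) by simp
  also have "\<dots> = p @ u @ take (length q - length (p @ u)) s" using assms(2) by simp
  finally show ?thesis by (auto simp: sublist_def)
qed

text \<open>Write \<open>\<pi>(v) = p u s\<close> for the hat word \<open>v\<close>. By minimality \<open>u\<close> begins inside the first block of
\<open>\<pi>(v)\<close> and ends inside the last one, since otherwise an outer letter of \<open>v\<close> could be dropped. So \<open>u\<close>
meets every block of \<open>\<pi>(v)\<close>, and as each letter \<open>a(k)\<close> reveals both its block \<open>a\<close> and its place in
it, reading \<open>u\<close> at the right level forces the letters of \<open>v\<close> one after the other.\<close>

lemma hat_set_eq_cylinder:
  assumes \<sigma>: "nonerasing_morphism \<sigma>" and u: "u \<noteq> []" and ex: "sublist u (pi_word \<sigma> w)"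
  shows "hat_set \<sigma> u = cylinder (hat_word \<sigma> u)"
proof -
  let ?\<pi> = "pi_word \<sigma>" and ?v = "hat_word \<sigma> u"
  note \<pi> = nonerasing_pi_word[OF \<sigma>]
  obtain p s where ps: "?\<pi> ?v = p @ u @ s"
    using hat_word_minimal(1)[OF ex] by (auto simp: sublist_def)
  have v: "?v \<noteq> []" using ps u by auto
  then obtain a v' where av: "?v = a # v'" by (cases ?v) auto
  obtain v'' c where cv: "?v = v'' @ [c]" using v by (metis rev_exhaust)
  have \<pi>av: "?\<pi> ?v = ?\<pi> [a] @ ?\<pi> v'" using av nonerasing_Cons[OF \<pi>] by metis
  have \<pi>cv: "?\<pi> ?v = ?\<pi> v'' @ ?\<pi> [c]" using cv by (simp add: pi_word_append)
  have p: "length p < length (\<sigma> [a])"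
  proof (rule ccontr)
    assume "\<not> ?thesis"
    then have "sublist u (?\<pi> v')" using sublist_of_suffix[of p u s "?\<pi> [a]"] ps \<pi>av by simp
    then show False using hat_word_minimal(2)[OF ex, of v'] av by simp
  qed
  have q: "length (?\<pi> v'') < length p + length u"
  proof (rule ccontr)
    assume "\<not> ?thesis"
    then have "sublist u (?\<pi> v'')" using ps \<pi>cv by (intro sublist_of_prefix[of p u s _ "?\<pi> [c]"]) simp_all
    then show False using hat_word_minimal(2)[OF ex, of v''] cv by simp
  qed
  have "hd u = ?\<pi> ?v ! length p" using ps u by (simp add: nth_append hd_conv_nth)
  also have "\<dots> = (a, Suc (length p))" using p \<pi>av by (simp add: nth_append pi_word_single_nth)
  finally have hd: "hd u = (a, Suc (length p))" .
  show ?thesis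
  proof (intro equalityI subsetI)
    fix x assume x: "x \<in> cylinder ?v"
    then have "morphism_Z ?\<pi> x (1 + int j) = ?\<pi> ?v ! j" if "j < length (?\<pi> ?v)" for j
      using morphism_Z_word(2)[OF \<pi>, of ?v x 1 j] that by (simp add: in_cylinder_iff)
    from this[of "length p + i" for i]
    have "morphism_Z ?\<pi> x (1 + int (length p + i)) = u ! i" if "i < length u" for i
      using that by (simp add: ps nth_append)
    moreover have "x 1 = a" using x av by (force simp: in_cylinder_iff)
    ultimately show "x \<in> hat_set \<sigma> u"
      by (simp add: hat_set_def hd in_cylinder_iff funpow_shift add_ac)
  next
    fix x assume x: "x \<in> hat_set \<sigma> u"
    have ux: "morphism_Z ?\<pi> x (1 + int (length p + i)) = u ! i" if "i < length u" for i
      using hat_setD(2)[OF x that] by (simp add: hd)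
    have "x (1 + int i) = ?v ! i" if "i < length ?v" for i
      using that
    proof (induction i rule: less_induct)
      case (less i)
      show ?case
      proof (cases "i = 0")
        case True
        then show ?thesis using hat_setD(1)[OF x, of 0] u av hd by simp
      next
        case False
        have take: "take i ?v = a # take (i - 1) v'" using False av by (cases i) auto
        have split: "?\<pi> ?v = ?\<pi> (take i ?v) @ ?\<pi> [?v ! i] @ ?\<pi> (drop (Suc i) ?v)"
          using id_take_nth_drop[OF less.prems] by (metis pi_word_append append_Cons append_Nil)
        define q where "q = length (?\<pi> (take i ?v))"
        have qp: "length p < q"
          using p nonerasing_Cons[OF \<pi>, of a "take (i - 1) v'"] unfolding q_def take by simp
        have "take i ?v = take i v''" using less.prems cv by simp
        then have "q \<le> length (?\<pi> v'')"
          unfolding q_def by (metis append_take_drop_id length_append pi_word_append le_add1)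
        then have qu: "q - length p < length u" using q qp by simp
        have "block_start ?\<pi> x (1 + int i) = 1 + int q"
          using morphism_Z_word(1)[OF \<pi>, of "take i ?v" x 1] less by (simp add: q_def)
        then have "morphism_Z ?\<pi> x (1 + int q) = (x (1 + int i), 1)"
          using morphism_Z_block[OF \<pi>, of 0 x "1 + int i"] nonerasing_not_Nil[OF \<sigma>, of "x (1 + int i)"]
          by (simp add: pi_word_single_nth)
        moreover have "morphism_Z ?\<pi> x (1 + int q) = u ! (q - length p)"
          using ux[OF qu] qp by simp
        moreover have "?\<pi> ?v ! q = (?v ! i, 1)"
          unfolding split using nonerasing_not_Nil[OF \<sigma>, of "?v ! i"]
          by (simp add: q_def nth_append pi_word_single_nth)
        moreover have "?\<pi> ?v ! q = u ! (q - length p)"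
          using ps qp qu by (simp add: nth_append)
        ultimately show ?thesis by simp
      qed
    qed
    then show "x \<in> cylinder ?v" by (simp add: in_cylinder_iff)
  qed
qed

text \<open>A point of \<open>hat_set \<sigma> u\<close> would have a prefix whose subdivision contains \<open>u\<close>.\<close>

lemma hat_set_empty:
  assumes \<sigma>: "nonerasing_morphism \<sigma>" and u: "u \<in> lists (subdivided_alphabet \<sigma>)" "u \<noteq> []"
    and ex: "\<nexists>w. sublist u (pi_word \<sigma> w)"
  shows "hat_set \<sigma> u = {}"
proof (rule ccontr)
  let ?\<pi> = "pi_word \<sigma>"
  note \<pi> = nonerasing_pi_word[OF \<sigma>]
  assume "hat_set \<sigma> u \<noteq> {}"
  then obtain x where x: "x \<in> hat_set \<sigma> u" by blast
  define k where "k = snd (hd u) - 1"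
  define v where "v = map (\<lambda>i. x (1 + int i)) [0..<k + length u]"
  have len: "k + length u \<le> length (?\<pi> v)"
    using nonerasing_length_ge[OF \<pi>, of v] by (simp add: v_def)
  have "?\<pi> v ! (k + i) = u ! i" if "i < length u" for i
    using morphism_Z_word(2)[OF \<pi>, of v x 1 "k + i"] hat_setD(2)[OF x that] len that
    by (simp add: v_def k_def add_ac)
  then have "take (length u) (drop k (?\<pi> v)) = u"
    using len by (intro nth_equalityI) simp_all
  then have "sublist u (?\<pi> v)" by (metis sublist_drop sublist_take sublist_order.order_trans)
  then show False using ex by blast
qed

lemma hat_weight_eq:
  assumes "nonerasing_morphism \<sigma>" "u \<in> lists (subdivided_alphabet \<sigma>)" "u \<noteq> []"
  shows "hat_weight \<sigma> \<mu> u = measure \<mu> (hat_set \<sigma> u)"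
  using hat_set_eq_cylinder[OF assms(1,3)] hat_set_empty[OF assms] by (auto simp: hat_weight_def)

lemma finite_preimage_words:
  fixes \<sigma> :: "'a::finite list \<Rightarrow> 'b list"
  shows "finite {u \<in> lists (subdivided_alphabet \<sigma>). alpha_word \<sigma> u = w}"
proof -
  obtain R where R: "\<And>a. length (\<sigma> [a]) \<le> R" using length_image_bounded[of \<sigma>] by blast
  then have "subdivided_alphabet \<sigma> \<subseteq> UNIV \<times> {..R}"
    by (auto simp: subdivided_alphabet_def intro: order_trans)
  then have fin: "finite (subdivided_alphabet \<sigma>)" by (rule finite_subset) simp
  have "{u \<in> lists (subdivided_alphabet \<sigma>). alpha_word \<sigma> u = w} \<subseteq>
      {u. set u \<subseteq> subdivided_alphabet \<sigma> \<and> length u = length w}"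
    by (auto simp: alpha_word_def)
  then show ?thesis using finite_lists_length_eq[OF fin] by (rule finite_subset)
qed

lemma sum_indicator_card:
  "finite A \<Longrightarrow> (\<Sum>i\<in>A. indicator (B i) (f i) :: 'c::semiring_1) = of_nat (card {i \<in> A. f i \<in> B i})"
proof -
  assume "finite A"
  moreover have "{i \<in> A. f i \<in> B i} = A \<inter> {i. f i \<in> B i}" by auto
  ultimately show ?thesis by (simp add: indicator_def)
qed

text \<open>Level \<open>j\<close> of the tower over \<open>x\<close> carries exactly one word of length \<open>|w|\<close> over the subdivided alphabet.
Its first letter is \<open>x\<^sub>1(j + 1)\<close>, so different levels carry different words: the levels in the cylinder
of \<open>w\<close> correspond bijectively to the preimages of \<open>w\<close> whose hat set contains \<open>x\<close>.\<close>

lemma level_count_eq: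
  fixes \<sigma> :: "'a::finite list \<Rightarrow> 'b list"
  assumes \<sigma>: "nonerasing_morphism \<sigma>" and w: "w \<noteq> []"
  shows "(\<Sum>j<length (\<sigma> [x 1]). indicator (cylinder w) ((shift ^^ j) (morphism_Z \<sigma> x)) :: ennreal) =
    (\<Sum>u | u \<in> lists (subdivided_alphabet \<sigma>) \<and> alpha_word \<sigma> u = w. indicator (hat_set \<sigma> u) x)"
proof -
  let ?z = "morphism_Z (pi_word \<sigma>) x" and ?\<alpha> = "\<lambda>(a, k). \<sigma> [a] ! (k - 1)"
  let ?U = "{u \<in> lists (subdivided_alphabet \<sigma>). alpha_word \<sigma> u = w}"
  define J where "J = {j. j < length (\<sigma> [x 1]) \<and> (shift ^^ j) (morphism_Z \<sigma> x) \<in> cylinder w}"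
  define f where "f j = map (\<lambda>i. ?z (1 + int (j + i))) [0..<length w]" for j
  have len: "length (f j) = length w" for j by (simp add: f_def)
  have hd: "hd (f j) = (x 1, Suc j)" if "j < length (\<sigma> [x 1])" for j
    using w morphism_Z_pi_first_block[of \<sigma> j x, OF \<sigma> that] by (simp add: f_def hd_map)
  have \<alpha>: "alpha_word \<sigma> (f j) = map (\<lambda>i. morphism_Z \<sigma> x (1 + int (j + i))) [0..<length w]" for j
    using morphism_Z_subdivided(2)[OF \<sigma>, of x] by (simp add: alpha_word_def f_def)
  have "bij_betw f J {u \<in> ?U. x \<in> hat_set \<sigma> u}"
  proof (rule bij_betwI')
    show "f i = f j \<longleftrightarrow> i = j" if "i \<in> J" "j \<in> J" for i j
    proof
      assume "f i = f j"
      then have "hd (f i) = hd (f j)" by simp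
      then show "i = j" using hd[of i] hd[of j] that by (simp add: J_def)
    qed simp
    show "f j \<in> {u \<in> ?U. x \<in> hat_set \<sigma> u}" if j: "j \<in> J" for j
    proof -
      have "f j \<in> lists (subdivided_alphabet \<sigma>)"
        using morphism_Z_subdivided(1)[OF \<sigma>, of x] unfolding f_def in_lists_conv_set by auto
      moreover have "alpha_word \<sigma> (f j) = w"
        unfolding \<alpha> using j
        by (intro nth_equalityI) (simp_all add: J_def in_cylinder_iff funpow_shift add_ac)
      moreover have "x \<in> hat_set \<sigma> (f j)"
      proof -
        have "hd (f j) = (x 1, Suc j)" using hd j by (simp add: J_def)
        then show ?thesis by (simp add: hat_set_def in_cylinder_iff len funpow_shift) (simp add: f_def add_ac)
      qed
      ultimately show ?thesis by blast
    qed
    show "\<exists>j\<in>J. u = f j" if u: "u \<in> {u \<in> ?U. x \<in> hat_set \<sigma> u}" for u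
    proof -
      define j where "j = snd (hd u) - 1"
      have lu: "length u = length w" using u by (auto simp: alpha_word_def)
      have ne: "u \<noteq> []" using lu w by auto
      have "hd u \<in> subdivided_alphabet \<sigma>" using u ne by (auto simp: in_lists_conv_set)
      moreover have x1: "x 1 = fst (hd u)" using u hat_setD(1)[of x \<sigma> u 0] ne by simp
      ultimately have j: "j < length (\<sigma> [x 1])"
        by (cases "hd u") (auto simp: subdivided_alphabet_def j_def)
      have uf: "u = f j"
        using u hat_setD(2)[of x \<sigma> u] by (intro nth_equalityI) (auto simp: f_def lu j_def)
      have "alpha_word \<sigma> (f j) = w" using u uf by simp
      then have \<alpha>w: "alpha_word \<sigma> (f j) ! i = w ! i" for i by simp
      have "morphism_Z \<sigma> x (1 + int (j + i)) = w ! i" if "i < length w" for i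
        using \<alpha>w[of i] that by (simp add: \<alpha>)
      then have "j \<in> J" using j by (simp add: J_def in_cylinder_iff funpow_shift add_ac)
      then show ?thesis using uf by blast
    qed
  qed
  then have "card J = card {u \<in> ?U. x \<in> hat_set \<sigma> u}" by (rule bij_betw_same_card)
  moreover have "(\<Sum>j<length (\<sigma> [x 1]). indicator (cylinder w) ((shift ^^ j) (morphism_Z \<sigma> x)) :: ennreal) =
      of_nat (card J)"
  proof -
    have "J = {j \<in> {..<length (\<sigma> [x 1])}. (shift ^^ j) (morphism_Z \<sigma> x) \<in> cylinder w}"
      by (auto simp: J_def)
    then show ?thesis by (simp add: sum_indicator_card)
  qed
  moreover have "(\<Sum>u\<in>?U. indicator (hat_set \<sigma> u) x :: ennreal) = of_nat (card {u \<in> ?U. x \<in> hat_set \<sigma> u})"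
    using sum_indicator_card[OF finite_preimage_words, of "\<lambda>u. hat_set \<sigma> u" "\<lambda>_. x" \<sigma> w] by simp
  ultimately show ?thesis by simp
qed

lemma transfer_eq_tower_measure:
  assumes \<sigma>: "nonerasing_morphism \<sigma>" and \<mu>: "\<mu> \<in> inv_measures X"
  shows "transfer \<sigma> \<mu> = tower_measure \<sigma> \<mu>"
proof -
  interpret M: finite_measure \<mu> using inv_measuresD(1)[OF \<mu>] .
  note sets = inv_measuresD(2)[OF \<mu>]
  note inv = tower_measure_invariant[OF \<sigma> \<mu>]
  have sums: "measure (tower_measure \<sigma> \<mu>) (cylinder w) =
      (\<Sum>u | u \<in> lists (subdivided_alphabet \<sigma>) \<and> alpha_word \<sigma> u = w. hat_weight \<sigma> \<mu> u)" (is "_ = sum _ ?U")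
    if w: "w \<noteq> []" for w
  proof -
    have hat: "hat_set \<sigma> u \<in> sets \<mu>" for u
      using hat_set_window_set[OF \<sigma>] window_set_in_shift_borel sets by blast
    have "emeasure (tower_measure \<sigma> \<mu>) (cylinder w) = (\<integral>\<^sup>+x. (\<Sum>u\<in>?U. indicator (hat_set \<sigma> u) x) \<partial>\<mu>)"
      using emeasure_tower_measure[OF \<sigma> sets cylinder_in_shift_borel[of w]] by (simp add: level_count_eq[OF \<sigma> w])
    also have "\<dots> = (\<Sum>u\<in>?U. emeasure \<mu> (hat_set \<sigma> u))"
      by (subst nn_integral_sum) (use hat in auto)
    also have "\<dots> = (\<Sum>u\<in>?U. ennreal (hat_weight \<sigma> \<mu> u))"
    proof (rule sum.cong)
      fix u assume "u \<in> ?U"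
      then have "u \<in> lists (subdivided_alphabet \<sigma>)" "u \<noteq> []" using w by (auto simp: alpha_word_def)
      then show "emeasure \<mu> (hat_set \<sigma> u) = ennreal (hat_weight \<sigma> \<mu> u)"
        by (simp add: hat_weight_eq[OF \<sigma>] M.emeasure_eq_measure)
    qed simp
    also have "\<dots> = ennreal (\<Sum>u\<in>?U. hat_weight \<sigma> \<mu> u)"
      by (rule sum_ennreal) (simp add: hat_weight_def)
    finally show ?thesis
      by (simp add: measure_def sum_nonneg hat_weight_def)
  qed
  show ?thesis unfolding transfer_def
  proof (rule the_equality)
    fix \<nu> assume \<nu>: "\<nu> \<in> inv_measures UNIV \<and> (\<forall>w. w \<noteq> [] \<longrightarrow> measure \<nu> (cylinder w) =
        (\<Sum>u | u \<in> lists (subdivided_alphabet \<sigma>) \<and> alpha_word \<sigma> u = w. hat_weight \<sigma> \<mu> u))"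
    then show "\<nu> = tower_measure \<sigma> \<mu>"
      by (intro inv_measure_eqI inv) (auto simp: sums)
  qed (use inv sums in auto)
qed

section \<open>Supports and image subshifts\<close>

lemma subshiftI:
  assumes "X \<noteq> {}" "closedin full_shift X" "\<And>x. shift x \<in> X \<longleftrightarrow> x \<in> X"
  shows "subshift X"
proof -
  have "y \<in> shift ` X" if y: "y \<in> X" for y
  proof -
    obtain x where "y = shift x" using bij_shift by (metis bij_pointE)
    then show ?thesis using assms(3) y by blast
  qed
  then show ?thesis using assms by (auto simp: subshift_def)
qed

lemma subshiftD:
  assumes "subshift X"
  shows "X \<noteq> {}" "closedin full_shift X" "shift x \<in> X \<longleftrightarrow> x \<in> X"
  using assms bij_is_inj[OF bij_shift] unfolding subshift_def by (auto dest: injD)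

lemma subshift_funpow: "subshift X \<Longrightarrow> (shift ^^ n) x \<in> X \<longleftrightarrow> x \<in> X"
  by (induction n) (simp_all add: subshiftD(3))

lemma image_subshift_least: "subshift Z \<Longrightarrow> morphism_Z \<sigma> ` X \<subseteq> Z \<Longrightarrow> image_subshift \<sigma> X \<subseteq> Z"
  by (auto simp: image_subshift_def)

lemma image_subshift_contains: "x \<in> X \<Longrightarrow> morphism_Z \<sigma> x \<in> image_subshift \<sigma> X"
  by (auto simp: image_subshift_def)

lemma subshift_image_subshift:
  assumes "subshift X"
  shows "subshift (image_subshift \<sigma> X)"
proof (rule subshiftI)
  show "image_subshift \<sigma> X \<noteq> {}" using subshiftD(1)[OF assms] image_subshift_contains by blast
  have "subshift (UNIV :: (int \<Rightarrow> 'b) set)"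
    by (rule subshiftI) (use closedin_topspace[of full_shift] in simp_all)
  then have ne: "{Y. subshift Y \<and> morphism_Z \<sigma> ` X \<subseteq> Y} \<noteq> {}" by blast
  show "closedin full_shift (image_subshift \<sigma> X)"
    unfolding image_subshift_def by (rule closedin_Inter[OF ne]) (auto dest: subshiftD(2))
  show "shift x \<in> image_subshift \<sigma> X \<longleftrightarrow> x \<in> image_subshift \<sigma> X" for x
    unfolding image_subshift_def by (auto simp: subshiftD(3))
qed

lemma tower_point_in_image_subshift:
  "subshift X \<Longrightarrow> x \<in> X \<Longrightarrow> (shift ^^ j) (morphism_Z \<sigma> x) \<in> image_subshift \<sigma> X"
  by (simp add: subshift_funpow subshift_image_subshift image_subshift_contains)

lemma supp_tower_measure_subset:
  assumes \<sigma>: "nonerasing_morphism \<sigma>" and X: "subshift X" and \<mu>: "\<mu> \<in> inv_measures X"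
  shows "supp (tower_measure \<sigma> \<mu>) \<subseteq> image_subshift \<sigma> X"
proof -
  let ?Y = "image_subshift \<sigma> X"
  note sets = inv_measuresD(2)[OF \<mu>]
  have Y: "closedin full_shift ?Y" using subshiftD(2)[OF subshift_image_subshift[OF X]] .
  then have "- ?Y \<in> sets shift_borel"
    by (intro open_in_shift_borel) (simp add: closedin_def Compl_eq_Diff_UNIV)
  then have "emeasure (tower_measure \<sigma> \<mu>) (- ?Y) =
      (\<integral>\<^sup>+x. (\<Sum>j<length (\<sigma> [x 1]). indicator (- ?Y) ((shift ^^ j) (morphism_Z \<sigma> x))) \<partial>\<mu>)"
    by (rule emeasure_tower_measure[OF \<sigma> sets])
  also have "\<dots> = (\<integral>\<^sup>+x. 0 \<partial>\<mu>)"
  proof (rule nn_integral_cong_AE)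
    have "AE x in \<mu>. x \<in> X" using supp_AE[OF sets subshiftD(2)[OF X] inv_measuresD(4)[OF \<mu>]] .
    then show "AE x in \<mu>. (\<Sum>j<length (\<sigma> [x 1]). indicator (- ?Y) ((shift ^^ j) (morphism_Z \<sigma> x))) = (0 :: ennreal)"
      by eventually_elim (auto simp: tower_point_in_image_subshift[OF X])
  qed
  finally show ?thesis using supp_subset_iff[OF _ Y] by simp
qed

text \<open>The support of the tower measure is itself a subshift, by invariance. It contains \<open>\<sigma>(x)\<close> for each
\<open>x\<close> in the support of \<open>\<mu>\<close>, so it contains the smallest such subshift.\<close>

lemma supp_tower_measure:
  assumes \<sigma>: "nonerasing_morphism \<sigma>" and X: "subshift X"
    and \<mu>: "\<mu> \<in> inv_measures UNIV" "supp \<mu> = X"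
  shows "supp (tower_measure \<sigma> \<mu>) = image_subshift \<sigma> X"
proof
  have \<mu>X: "\<mu> \<in> inv_measures X" using \<mu> inv_measures_iff_UNIV by blast
  note sets = inv_measuresD(2)[OF \<mu>(1)]
  show "supp (tower_measure \<sigma> \<mu>) \<subseteq> image_subshift \<sigma> X"
    by (rule supp_tower_measure_subset[OF \<sigma> X \<mu>X])
  have sub: "morphism_Z \<sigma> ` X \<subseteq> supp (tower_measure \<sigma> \<mu>)"
  proof
    fix y assume "y \<in> morphism_Z \<sigma> ` X"
    then obtain x where x: "x \<in> supp \<mu>" "y = morphism_Z \<sigma> x" using \<mu>(2) by blast
    show "y \<in> supp (tower_measure \<sigma> \<mu>)"
      unfolding in_supp_iff
    proof (intro allI impI)
      fix U assume U: "openin full_shift U" "y \<in> U"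
      let ?V = "morphism_Z \<sigma> -` U"
      have V: "openin full_shift ?V"
        using openin_continuous_map_preimage[OF continuous_morphism_Z[OF \<sigma>] U(1)] by (simp add: vimage_def)
      have "emeasure \<mu> ?V = (\<integral>\<^sup>+x. indicator ?V x \<partial>\<mu>)"
        using nn_integral_indicator[of ?V \<mu>] open_in_shift_borel[OF V] sets by simp
      also have "\<dots> \<le> (\<integral>\<^sup>+x. (\<Sum>j<length (\<sigma> [x 1]). indicator U ((shift ^^ j) (morphism_Z \<sigma> x))) \<partial>\<mu>)"
      proof (rule nn_integral_mono)
        fix x :: "int \<Rightarrow> 'a"
        have "0 < length (\<sigma> [x 1])" using nonerasing_pos[OF \<sigma>, of "x 1"] by linarith
        then have "indicator U ((shift ^^ 0) (morphism_Z \<sigma> x)) \<le>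
            (\<Sum>j<length (\<sigma> [x 1]). indicator U ((shift ^^ j) (morphism_Z \<sigma> x)) :: ennreal)"
          by (intro member_le_sum[of 0]) auto
        then show "indicator ?V x \<le> (\<Sum>j<length (\<sigma> [x 1]). indicator U ((shift ^^ j) (morphism_Z \<sigma> x)) :: ennreal)"
          by (simp add: indicator_vimage)
      qed
      also have "\<dots> = emeasure (tower_measure \<sigma> \<mu>) U"
        by (rule emeasure_tower_measure[OF \<sigma> sets open_in_shift_borel[OF U(1)], symmetric])
      finally have "emeasure \<mu> ?V \<le> emeasure (tower_measure \<sigma> \<mu>) U" .
      moreover have "emeasure \<mu> ?V \<noteq> 0" using x U(2) V by (auto simp: in_supp_iff)
      ultimately show "emeasure (tower_measure \<sigma> \<mu>) U \<noteq> 0" by auto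
    qed
  qed
  have inv: "shift ` supp (tower_measure \<sigma> \<mu>) = supp (tower_measure \<sigma> \<mu>)"
    by (rule shift_supp[OF tower_measure_invariant[OF \<sigma> \<mu>(1)]])
  have "subshift (supp (tower_measure \<sigma> \<mu>))"
    unfolding subshift_def using inv closed_supp sub subshiftD(1)[OF X] by blast
  then show "image_subshift \<sigma> X \<subseteq> supp (tower_measure \<sigma> \<mu>)"
    using sub by (rule image_subshift_least)
qed

section \<open>Functoriality\<close>

text \<open>For the inclusion from right to left, the preimage under \<open>\<tau>\<close> of the left side is a subshift that
contains \<open>\<sigma>(X)\<close>.\<close>

lemma image_subshift_comp:
  assumes \<sigma>: "nonerasing_morphism \<sigma>" and \<tau>: "nonerasing_morphism \<tau>" and X: "subshift X"
  shows "image_subshift (\<tau> \<circ> \<sigma>) X = image_subshift \<tau> (image_subshift \<sigma> X)"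
proof
  note sub = subshift_image_subshift[OF X, of \<sigma>]
  show "image_subshift (\<tau> \<circ> \<sigma>) X \<subseteq> image_subshift \<tau> (image_subshift \<sigma> X)"
  proof (rule image_subshift_least[OF subshift_image_subshift[OF sub]])
    show "morphism_Z (\<tau> \<circ> \<sigma>) ` X \<subseteq> image_subshift \<tau> (image_subshift \<sigma> X)"
      by (auto simp: morphism_Z_comp[OF \<sigma> \<tau>] image_subshift_contains)
  qed
  let ?Z = "image_subshift (\<tau> \<circ> \<sigma>) X"
  have Z: "subshift ?Z" by (rule subshift_image_subshift[OF X])
  let ?W = "morphism_Z \<tau> -` ?Z"
  have XW: "morphism_Z \<sigma> ` X \<subseteq> ?W"
    by (auto simp: morphism_Z_comp[OF \<sigma> \<tau>, symmetric] image_subshift_contains)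
  have "subshift ?W"
  proof (rule subshiftI)
    show "?W \<noteq> {}" using XW subshiftD(1)[OF X] by blast
    show "closedin full_shift ?W"
      using closedin_continuous_map_preimage[OF continuous_morphism_Z[OF \<tau>] subshiftD(2)[OF Z]]
      by (simp add: vimage_def)
    show "shift x \<in> ?W \<longleftrightarrow> x \<in> ?W" for x
      by (simp add: morphism_Z_shift[OF \<tau>] subshift_funpow[OF Z])
  qed
  then have "image_subshift \<sigma> X \<subseteq> ?W" by (rule image_subshift_least[OF _ XW])
  then show "image_subshift \<tau> (image_subshift \<sigma> X) \<subseteq> ?Z"
    by (intro image_subshift_least[OF Z]) auto
qed

lemma sum_lessThan_add:
  fixes f :: "nat \<Rightarrow> 'c::comm_monoid_add"
  shows "(\<Sum>k<m + n. f k) = (\<Sum>k<m. f k) + (\<Sum>k<n. f (m + k))"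
  by (induction n) (simp_all add: add.assoc)

lemma funpow_shift_add: "(shift ^^ j) ((shift ^^ m) x) = (shift ^^ (m + j)) x"
  by (simp add: funpow_shift add_ac)

text \<open>The \<open>\<tau>\<close>-towers over \<open>y, T y, \<dots>\<close> are consecutive pieces of the orbit of \<open>\<tau>(y)\<close>.\<close>

lemma nested_level_sum:
  fixes g :: "(int \<Rightarrow> 'b) \<Rightarrow> 'c::comm_monoid_add"
  assumes \<tau>: "nonerasing_morphism \<tau>"
  shows "(\<Sum>i<n. \<Sum>j<length (\<tau> [(shift ^^ i) y 1]). g ((shift ^^ j) (morphism_Z \<tau> ((shift ^^ i) y)))) =
    (\<Sum>k<(\<Sum>i<n. length (\<tau> [(shift ^^ i) y 1])). g ((shift ^^ k) (morphism_Z \<tau> y)))"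
  by (induction n) (simp_all add: sum_lessThan_add morphism_Z_funpow_shift[OF \<tau>] funpow_shift_add)

lemma nested_tower_height:
  assumes \<sigma>: "nonerasing_morphism \<sigma>" and \<tau>: "nonerasing_morphism \<tau>"
  shows "(\<Sum>i<length (\<sigma> [x 1]). length (\<tau> [(shift ^^ i) (morphism_Z \<sigma> x) 1])) = length (\<tau> (\<sigma> [x 1]))"
proof -
  have "(shift ^^ i) (morphism_Z \<sigma> x) 1 = \<sigma> [x 1] ! i" if "i < length (\<sigma> [x 1])" for i
    using morphism_Z_block[OF \<sigma>, of i x 1] that by (simp add: funpow_shift)
  then show ?thesis by (simp add: length_image_word[OF \<tau>, of "\<sigma> [x 1]"])
qed

lemma tower_measure_comp:
  assumes \<sigma>: "nonerasing_morphism \<sigma>" and \<tau>: "nonerasing_morphism \<tau>"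
    and sets: "sets \<mu> = sets shift_borel"
  shows "tower_measure (\<tau> \<circ> \<sigma>) \<mu> = tower_measure \<tau> (tower_measure \<sigma> \<mu>)"
proof (rule measure_eqI)
  fix B assume "B \<in> sets (tower_measure (\<tau> \<circ> \<sigma>) \<mu>)"
  then have B: "B \<in> sets shift_borel" by simp
  then have ind: "indicator B \<in> borel_measurable shift_borel" by simp
  let ?N = "\<lambda>y. \<Sum>j<length (\<tau> [y 1]). indicator B ((shift ^^ j) (morphism_Z \<tau> y)) :: ennreal"
  have "emeasure (tower_measure \<tau> (tower_measure \<sigma> \<mu>)) B = (\<integral>\<^sup>+y. ?N y \<partial>tower_measure \<sigma> \<mu>)"
    by (rule emeasure_tower_measure[OF \<tau> _ B]) simp
  also have "\<dots> = (\<integral>\<^sup>+x. (\<Sum>i<length (\<sigma> [x 1]). ?N ((shift ^^ i) (morphism_Z \<sigma> x))) \<partial>\<mu>)"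
    by (rule nn_integral_tower_measure[OF \<sigma> sets measurable_level_sum[OF \<tau> refl ind]])
  also have "\<dots> = emeasure (tower_measure (\<tau> \<circ> \<sigma>) \<mu>) B"
    unfolding emeasure_tower_measure[OF nonerasing_comp[OF \<sigma> \<tau>] sets B]
    by (simp add: nested_level_sum[OF \<tau>] nested_tower_height[OF \<sigma> \<tau>] morphism_Z_comp[OF \<sigma> \<tau>])
  finally show "emeasure (tower_measure (\<tau> \<circ> \<sigma>) \<mu>) B = emeasure (tower_measure \<tau> (tower_measure \<sigma> \<mu>)) B"
    by simp
qed simp

section \<open>Linearity and continuity\<close>

text \<open>The part of the base above which level \<open>j\<close> exists and lies in \<open>B\<close>. Through these sets the tower measure
becomes a finite sum of values of \<open>\<mu>\<close>, which is convenient for linearity and for limits of set functions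
that are not yet measures.\<close>

definition level_set :: "('a list \<Rightarrow> 'b list) \<Rightarrow> (int \<Rightarrow> 'b) set \<Rightarrow> nat \<Rightarrow> (int \<Rightarrow> 'a) set" where
  "level_set \<sigma> B j = {x. j < length (\<sigma> [x 1]) \<and> (shift ^^ j) (morphism_Z \<sigma> x) \<in> B}"

lemma level_set_measurable:
  assumes \<sigma>: "nonerasing_morphism \<sigma>" and B: "B \<in> sets shift_borel"
  shows "level_set \<sigma> B j \<in> sets shift_borel"
proof -
  have "{x. j < length (\<sigma> [x 1])} \<in> window_sets"
    unfolding window_sets_def by (intro CollectI exI[of _ 1]) (auto simp: agree_def)
  moreover have "(\<lambda>x. (shift ^^ j) (morphism_Z \<sigma> x)) -` B \<in> sets shift_borel"
    using vimage_in_shift_borel[OF measurable_compose[OF measurable_morphism_Z[OF \<sigma>] measurable_funpow_shift] B] .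
  moreover have "level_set \<sigma> B j = {x. j < length (\<sigma> [x 1])} \<inter> (\<lambda>x. (shift ^^ j) (morphism_Z \<sigma> x)) -` B"
    by (auto simp: level_set_def)
  ultimately show ?thesis by (simp add: sets.Int window_set_in_shift_borel)
qed

lemma level_set_window_set:
  assumes \<sigma>: "nonerasing_morphism \<sigma>" and B: "B \<in> window_sets"
  shows "level_set \<sigma> B j \<in> window_sets"
proof -
  obtain n where n: "\<forall>x y. agree n x y \<longrightarrow> (x \<in> B \<longleftrightarrow> y \<in> B)"
    using B by (auto simp: window_sets_def)
  have "x \<in> level_set \<sigma> B j \<longleftrightarrow> y \<in> level_set \<sigma> B j" if xy: "agree (Suc (n + j)) x y" for x y
  proof -
    have "x 1 = y 1" using xy by (simp add: agree_def)
    moreover have "agree n ((shift ^^ j) (morphism_Z \<sigma> x)) ((shift ^^ j) (morphism_Z \<sigma> y))"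
      by (intro agree_funpow_shift morphism_Z_agree[OF \<sigma>] xy)
    ultimately show ?thesis using n by (simp add: level_set_def)
  qed
  then show ?thesis unfolding window_sets_def by blast
qed

lemma level_sum_eq_level_sets:
  fixes x :: "int \<Rightarrow> 'a" and \<sigma> :: "'a list \<Rightarrow> 'b list"
  assumes "\<And>a. length (\<sigma> [a]) \<le> R"
  shows "(\<Sum>j<length (\<sigma> [x 1]). indicator B ((shift ^^ j) (morphism_Z \<sigma> x))) =
    (\<Sum>j<R. indicator (level_set \<sigma> B j) x :: 'c::semiring_1)"
proof -
  have "(\<Sum>j<R. indicator (level_set \<sigma> B j) x :: 'c) =
      (\<Sum>j\<in>{..<R}. if j \<in> {..<length (\<sigma> [x 1])} then indicator B ((shift ^^ j) (morphism_Z \<sigma> x)) else 0)"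
    by (intro sum.cong) (auto simp: level_set_def indicator_def)
  also have "\<dots> = (\<Sum>j\<in>{..<R} \<inter> {..<length (\<sigma> [x 1])}. indicator B ((shift ^^ j) (morphism_Z \<sigma> x)))"
    by (rule sum.inter_restrict[symmetric]) simp
  also have "{..<R} \<inter> {..<length (\<sigma> [x 1])} = {..<length (\<sigma> [x 1])}" using assms[of "x 1"] by auto
  finally show ?thesis by simp
qed

lemma emeasure_tower_measure_level_sets:
  assumes \<sigma>: "nonerasing_morphism \<sigma>" and sets: "sets \<mu> = sets shift_borel" and B: "B \<in> sets shift_borel"
    and R: "\<And>a. length (\<sigma> [a]) \<le> R"
  shows "emeasure (tower_measure \<sigma> \<mu>) B = (\<Sum>j<R. emeasure \<mu> (level_set \<sigma> B j))"
proof -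
  have "emeasure (tower_measure \<sigma> \<mu>) B = (\<integral>\<^sup>+x. (\<Sum>j<R. indicator (level_set \<sigma> B j) x) \<partial>\<mu>)"
    by (simp add: emeasure_tower_measure[OF \<sigma> sets B] level_sum_eq_level_sets[of \<sigma> R, OF R])
  also have "\<dots> = (\<Sum>j<R. emeasure \<mu> (level_set \<sigma> B j))"
    using level_set_measurable[OF \<sigma> B] sets by (subst nn_integral_sum) auto
  finally show ?thesis .
qed

lemma tower_measure_linear:
  assumes \<sigma>: "nonerasing_morphism \<sigma>"
    and \<mu>: "sets \<mu> = sets shift_borel" and \<nu>: "sets \<nu> = sets shift_borel"
  shows "tower_measure \<sigma> (add_measure (scale_measure c \<mu>) (scale_measure d \<nu>)) =
    add_measure (scale_measure c (tower_measure \<sigma> \<mu>)) (scale_measure d (tower_measure \<sigma> \<nu>))"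
    (is "tower_measure \<sigma> ?M = ?\<rho>")
proof (rule measure_eqI)
  fix B assume "B \<in> sets (tower_measure \<sigma> ?M)"
  then have B: "B \<in> sets shift_borel" by simp
  obtain R where R: "\<And>a. length (\<sigma> [a]) \<le> R" using length_image_bounded[of \<sigma>] by blast
  have sM: "sets ?M = sets shift_borel" using \<mu> by simp
  have add: "emeasure ?M A = c * emeasure \<mu> A + d * emeasure \<nu> A" for A
    by (subst emeasure_add_measure) (simp_all add: \<mu> \<nu>)
  have "emeasure ?\<rho> B = c * emeasure (tower_measure \<sigma> \<mu>) B + d * emeasure (tower_measure \<sigma> \<nu>) B"
    by (subst emeasure_add_measure) simp_all
  then show "emeasure (tower_measure \<sigma> ?M) B = emeasure ?\<rho> B"
    unfolding emeasure_tower_measure_level_sets[OF \<sigma> sM B R] add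
      emeasure_tower_measure_level_sets[OF \<sigma> \<mu> B R] emeasure_tower_measure_level_sets[OF \<sigma> \<nu> B R]
    by (simp add: sum.distrib sum_distrib_left)
qed simp

lemma continuous_full_shift_bounded:
  fixes f :: "(int \<Rightarrow> 'a::finite) \<Rightarrow> real"
  assumes "continuous_map full_shift euclideanreal f"
  shows "\<exists>M. \<forall>x. \<bar>f x\<bar> \<le> M"
proof -
  have "compactin full_shift (UNIV :: (int \<Rightarrow> 'a) set)"
    using compact_full_shift by (simp add: compact_space_def)
  then have "compactin euclideanreal (range f)" using assms by (rule image_compactin)
  then have "bounded (range f)" by (simp add: compact_imp_bounded)
  then show ?thesis by (auto simp: bounded_iff)
qed

lemma continuous_level_sum:
  fixes f :: "(int \<Rightarrow> 'b::finite) \<Rightarrow> real" and \<sigma> :: "'a::finite list \<Rightarrow> 'b list"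
  assumes \<sigma>: "nonerasing_morphism \<sigma>" and f: "continuous_map full_shift euclideanreal f"
  shows "continuous_map full_shift euclideanreal
    (\<lambda>x. \<Sum>j<length (\<sigma> [x 1]). f ((shift ^^ j) (morphism_Z \<sigma> x)))"
proof -
  obtain R where R: "\<And>a. length (\<sigma> [a]) \<le> R" using length_image_bounded[of \<sigma>] by blast
  define c where "c j x = (if j < length (\<sigma> [x 1]) then 1 else 0 :: real)" for j and x :: "int \<Rightarrow> 'a"
  have c: "continuous_map full_shift euclideanreal (c j)" for j
    unfolding continuous_map_def openin_full_shift_iff
  proof (intro conjI allI impI ballI)
    fix U x assume x: "x \<in> {x \<in> topspace full_shift. c j x \<in> U}"
    have "c j y \<in> U" if "agree 1 x y" for y
    proof -
      have "x 1 = y 1" using that by (simp add: agree_def)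
      then show ?thesis using x by (simp add: c_def)
    qed
    then show "\<exists>n. \<forall>y. agree n x y \<longrightarrow> y \<in> {x \<in> topspace full_shift. c j x \<in> U}"
      by (intro exI[of _ 1]) simp
  qed auto
  have sh: "continuous_map full_shift full_shift (\<lambda>x :: int \<Rightarrow> 'b. (shift ^^ j) x)" for j
    by (rule continuous_full_shiftI) (blast intro: agree_funpow_shift)
  have "continuous_map full_shift euclideanreal (\<lambda>x. f ((shift ^^ j) (morphism_Z \<sigma> x)))" for j
    using continuous_map_compose[OF continuous_map_compose[OF continuous_morphism_Z[OF \<sigma>] sh] f]
    by (simp add: o_def)
  then have "continuous_map full_shift euclideanreal
      (\<lambda>x. \<Sum>j<R. c j x * f ((shift ^^ j) (morphism_Z \<sigma> x)))"
    by (intro continuous_map_sum continuous_map_real_mult c) auto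
  moreover have "(\<Sum>j<R. c j x * f ((shift ^^ j) (morphism_Z \<sigma> x))) =
      (\<Sum>j<length (\<sigma> [x 1]). f ((shift ^^ j) (morphism_Z \<sigma> x)))" for x
  proof -
    have "(\<Sum>j<R. c j x * f ((shift ^^ j) (morphism_Z \<sigma> x))) =
        (\<Sum>j\<in>{..<R}. if j \<in> {..<length (\<sigma> [x 1])} then f ((shift ^^ j) (morphism_Z \<sigma> x)) else 0)"
      by (intro sum.cong) (auto simp: c_def)
    also have "\<dots> = (\<Sum>j\<in>{..<R} \<inter> {..<length (\<sigma> [x 1])}. f ((shift ^^ j) (morphism_Z \<sigma> x)))"
      by (rule sum.inter_restrict[symmetric]) simp
    also have "{..<R} \<inter> {..<length (\<sigma> [x 1])} = {..<length (\<sigma> [x 1])}" using R[of "x 1"] by auto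
    finally show ?thesis .
  qed
  ultimately show ?thesis by simp
qed

lemma integral_tower_measure_nonneg:
  fixes f :: "(int \<Rightarrow> 'b::finite) \<Rightarrow> real"
  assumes \<sigma>: "nonerasing_morphism \<sigma>" and sets: "sets \<mu> = sets shift_borel"
    and f: "f \<in> borel_measurable shift_borel" "\<And>y. 0 \<le> f y"
  shows "(\<integral>y. f y \<partial>tower_measure \<sigma> \<mu>) =
    (\<integral>x. (\<Sum>j<length (\<sigma> [x 1]). f ((shift ^^ j) (morphism_Z \<sigma> x))) \<partial>\<mu>)"
proof -
  have "(\<integral>y. f y \<partial>tower_measure \<sigma> \<mu>) = enn2real (\<integral>\<^sup>+y. ennreal (f y) \<partial>tower_measure \<sigma> \<mu>)"
    by (rule integral_eq_nn_integral) (use f in auto)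
  also have "(\<integral>\<^sup>+y. ennreal (f y) \<partial>tower_measure \<sigma> \<mu>) =
      (\<integral>\<^sup>+x. ennreal (\<Sum>j<length (\<sigma> [x 1]). f ((shift ^^ j) (morphism_Z \<sigma> x))) \<partial>\<mu>)"
    using f(1) by (subst nn_integral_tower_measure[OF \<sigma> sets]) (simp_all add: f(2))
  also have "enn2real \<dots> = (\<integral>x. (\<Sum>j<length (\<sigma> [x 1]). f ((shift ^^ j) (morphism_Z \<sigma> x))) \<partial>\<mu>)"
    by (rule integral_eq_nn_integral[symmetric])
      (use f(2) in \<open>auto intro: measurable_level_sum[OF \<sigma> sets f(1)] sum_nonneg\<close>)
  finally show ?thesis .
qed

text \<open>The sign restriction of the nonnegative case is removed by adding a constant, as \<open>f\<close> is bounded and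
the measures are finite.\<close>

lemma integral_tower_measure:
  fixes f :: "(int \<Rightarrow> 'b::finite) \<Rightarrow> real"
  assumes \<sigma>: "nonerasing_morphism \<sigma>" and \<mu>: "\<mu> \<in> inv_measures X"
    and f: "f \<in> borel_measurable shift_borel" "\<And>y. \<bar>f y\<bar> \<le> M"
  shows "(\<integral>y. f y \<partial>tower_measure \<sigma> \<mu>) =
    (\<integral>x. (\<Sum>j<length (\<sigma> [x 1]). f ((shift ^^ j) (morphism_Z \<sigma> x))) \<partial>\<mu>)"
proof -
  let ?\<nu> = "tower_measure \<sigma> \<mu>"
  let ?S = "\<lambda>f x. \<Sum>j<length (\<sigma> [x 1]). f ((shift ^^ j) (morphism_Z \<sigma> x)) :: real"
  note sets = inv_measuresD(2)[OF \<mu>]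
  interpret M: finite_measure \<mu> using inv_measuresD(1)[OF \<mu>] .
  interpret N: finite_measure ?\<nu> using inv_measuresD(1)[OF tower_measure_invariant[OF \<sigma> \<mu>]] .
  obtain R where R: "\<And>a. length (\<sigma> [a]) \<le> R" using length_image_bounded[of \<sigma>] by blast
  have M: "0 \<le> M" using f(2)[of undefined] by linarith
  have fM: "0 \<le> f y + M" for y using f(2)[of y] by linarith
  have int\<nu>: "integrable ?\<nu> f" by (rule N.integrable_const_bound[of _ M]) (use f in auto)
  have int\<mu>: "integrable \<mu> (?S h)" if h: "h \<in> borel_measurable shift_borel" "\<And>y. \<bar>h y\<bar> \<le> M" for h
  proof (rule M.integrable_const_bound[of _ "real R * M"])
    show "?S h \<in> borel_measurable \<mu>" by (rule measurable_level_sum[OF \<sigma> sets h(1)])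
    have "\<bar>?S h x\<bar> \<le> real R * M" for x
    proof -
      have "\<bar>?S h x\<bar> \<le> (\<Sum>j<length (\<sigma> [x 1]). M)"
        by (rule order_trans[OF sum_abs]) (intro sum_mono h(2))
      also have "\<dots> \<le> real R * M" using R[of "x 1"] M by (simp add: mult_right_mono)
      finally show ?thesis .
    qed
    then show "AE x in \<mu>. norm (?S h x) \<le> real R * M" by simp
  qed
  have "(\<integral>y. f y \<partial>?\<nu>) + (\<integral>y. M \<partial>?\<nu>) = (\<integral>y. f y + M \<partial>?\<nu>)"
    using int\<nu> by (intro Bochner_Integration.integral_add[symmetric]) auto
  also have "\<dots> = (\<integral>x. ?S (\<lambda>y. f y + M) x \<partial>\<mu>)"
    by (rule integral_tower_measure_nonneg[OF \<sigma> sets]) (use f(1) fM in auto)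
  also have "\<dots> = (\<integral>x. ?S f x + ?S (\<lambda>_. M) x \<partial>\<mu>)" by (simp only: sum.distrib)
  also have "\<dots> = (\<integral>x. ?S f x \<partial>\<mu>) + (\<integral>x. ?S (\<lambda>_. M) x \<partial>\<mu>)"
    by (rule Bochner_Integration.integral_add[OF int\<mu>[OF f] int\<mu>]) (use M in auto)
  also have "(\<integral>x. ?S (\<lambda>_. M) x \<partial>\<mu>) = (\<integral>y. M \<partial>?\<nu>)"
    by (rule integral_tower_measure_nonneg[OF \<sigma> sets, symmetric]) (use M in auto)
  finally show ?thesis by simp
qed

text \<open>Integrating \<open>f\<close> against the image measure is integrating the level sum of \<open>f\<close>, again a continuous
function, against \<open>\<mu>\<close>.\<close>

lemma weak_star_continuous_tower:
  fixes \<sigma> :: "'a::finite list \<Rightarrow> 'b::finite list"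
  assumes \<sigma>: "nonerasing_morphism \<sigma>"
    and F: "\<And>\<mu>. \<mu> \<in> inv_measures X \<Longrightarrow> F \<mu> = tower_measure \<sigma> \<mu> \<and> F \<mu> \<in> inv_measures Y"
  shows "continuous_map (weak_star X) (weak_star Y) F"
proof -
  let ?A = "{f :: (int \<Rightarrow> 'a) \<Rightarrow> real. continuous_map full_shift euclideanreal f}"
  let ?B = "{f :: (int \<Rightarrow> 'b) \<Rightarrow> real. continuous_map full_shift euclideanreal f}"
  let ?IA = "\<lambda>\<mu>. \<lambda>f\<in>?A. (\<integral>x. f x \<partial>\<mu>)" and ?IB = "\<lambda>\<mu>. \<lambda>f\<in>?B. (\<integral>x. f x \<partial>\<mu>)"
  have top: "topspace (weak_star X) \<subseteq> inv_measures X"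
    by (auto simp: weak_star_def Let_def topspace_pullback_topology)
  have eval: "continuous_map (weak_star X) euclideanreal (\<lambda>\<mu>. \<integral>x. g x \<partial>\<mu>)" if g: "g \<in> ?A" for g
  proof -
    have "continuous_map (weak_star X) euclideanreal ((\<lambda>h. h g) \<circ> ?IA)"
      unfolding weak_star_def Let_def
      by (intro continuous_map_pullback continuous_map_product_projection g)
    then show ?thesis using g by (simp add: o_def)
  qed
  have "continuous_map (weak_star X) (product_topology (\<lambda>_. euclideanreal) ?B) (?IB \<circ> F)"
    unfolding continuous_map_componentwise
  proof (intro conjI ballI)
    fix f assume f: "f \<in> ?B"
    then have fc: "continuous_map full_shift euclideanreal f" by simp
    obtain M where M: "\<And>y. \<bar>f y\<bar> \<le> M" using continuous_full_shift_bounded[OF fc] by blast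
    let ?g = "\<lambda>x. \<Sum>j<length (\<sigma> [x 1]). f ((shift ^^ j) (morphism_Z \<sigma> x))"
    have "?g \<in> ?A" using continuous_level_sum[OF \<sigma> fc] by simp
    then have "continuous_map (weak_star X) euclideanreal (\<lambda>\<mu>. \<integral>x. ?g x \<partial>\<mu>)" by (rule eval)
    then show "continuous_map (weak_star X) euclideanreal (\<lambda>\<mu>. (?IB \<circ> F) \<mu> f)"
    proof (rule continuous_map_eq)
      fix \<mu> assume "\<mu> \<in> topspace (weak_star X)"
      then have \<mu>: "\<mu> \<in> inv_measures X" using top by blast
      show "(\<integral>x. ?g x \<partial>\<mu>) = (?IB \<circ> F) \<mu> f"
        using integral_tower_measure[OF \<sigma> \<mu> measurable_continuous_real[OF fc] M] F[OF \<mu>] f by simp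
    qed
  qed auto
  then show ?thesis
    unfolding weak_star_def[of Y] Let_def
    by (rule continuous_map_pullback') (use top F in auto)
qed

section \<open>Ergodicity\<close>

lemma AE_tower_measure:
  assumes \<sigma>: "nonerasing_morphism \<sigma>" and sets: "sets \<mu> = sets shift_borel"
    and P: "AE y in tower_measure \<sigma> \<mu>. P y"
  shows "AE x in \<mu>. \<forall>j<length (\<sigma> [x 1]). P ((shift ^^ j) (morphism_Z \<sigma> x))"
proof -
  obtain N where N: "{y. \<not> P y} \<subseteq> N" "emeasure (tower_measure \<sigma> \<mu>) N = 0" "N \<in> sets shift_borel"
    using AE_E[OF P] by auto
  have ind: "indicator N \<in> borel_measurable shift_borel" using N(3) by simp
  have "(\<integral>\<^sup>+x. (\<Sum>j<length (\<sigma> [x 1]). indicator N ((shift ^^ j) (morphism_Z \<sigma> x))) \<partial>\<mu>) = 0"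
    using emeasure_tower_measure[OF \<sigma> sets N(3)] N(2) by simp
  then have "AE x in \<mu>. (\<Sum>j<length (\<sigma> [x 1]). indicator N ((shift ^^ j) (morphism_Z \<sigma> x)) :: ennreal) = 0"
    by (subst (asm) nn_integral_0_iff_AE[OF measurable_level_sum[OF \<sigma> sets ind]])
  then show ?thesis
  proof eventually_elim
    case (elim x)
    then have "(shift ^^ j) (morphism_Z \<sigma> x) \<notin> N" if "j < length (\<sigma> [x 1])" for j
      using that by (simp add: sum_eq_0_iff indicator_def disjoint_iff)
    then show ?case using N(1) by blast
  qed
qed

text \<open>Both \<open>f\<close> and its composition with the shift are densities of the same measure.\<close>

lemma density_shift_invariant:
  assumes \<nu>: "\<nu> \<in> inv_measures X" and f: "f \<in> borel_measurable shift_borel"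
    and inv: "density \<nu> f \<in> inv_measures Y"
  shows "AE y in \<nu>. f (shift y) = f y"
proof -
  interpret N: finite_measure \<nu> using inv_measuresD(1)[OF \<nu>] .
  note sets = inv_measuresD(2)[OF \<nu>]
  have f\<nu>: "f \<in> borel_measurable \<nu>" by (rule measurable_cong_shift_borel[OF sets f])
  have fs: "(\<lambda>y. f (shift y)) \<in> borel_measurable \<nu>"
    by (rule measurable_cong_shift_borel[OF sets measurable_compose[OF measurable_shift f]])
  let ?u = "\<lambda>x k. x (k - 1)"
  have "continuous_map full_shift full_shift (?u :: (int \<Rightarrow> 'a) \<Rightarrow> _)"
  proof (rule continuous_full_shiftI)
    fix n and x :: "int \<Rightarrow> 'a"
    show "\<exists>m. \<forall>y. agree m x y \<longrightarrow> agree n (?u x) (?u y)"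
      by (intro exI[of _ "Suc n"]) (auto simp: agree_def)
  qed
  then have u: "?u \<in> measurable shift_borel (shift_borel :: (int \<Rightarrow> 'a) measure)"
    by (rule measurable_continuous_full_shift)
  have "density \<nu> (\<lambda>y. f (shift y)) = density \<nu> f"
  proof (rule measure_eqI)
    fix B assume "B \<in> sets (density \<nu> (\<lambda>y. f (shift y)))"
    then have B: "B \<in> sets \<nu>" and B': "B \<in> sets shift_borel" using sets by simp_all
    let ?C = "?u -` B"
    have C': "?C \<in> sets shift_borel" by (rule vimage_in_shift_borel[OF u B'])
    then have C: "?C \<in> sets \<nu>" using sets by simp
    have CB: "shift -` ?C = B" by (auto simp: shift_def)
    then have "indicator B y = (indicator ?C (shift y) :: ennreal)" for y by (auto simp: indicator_def)
    then have "emeasure (density \<nu> (\<lambda>y. f (shift y))) B = (\<integral>\<^sup>+y. f (shift y) * indicator ?C (shift y) \<partial>\<nu>)"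
      by (simp add: emeasure_density[OF fs B])
    also have "\<dots> = (\<integral>\<^sup>+y. f y * indicator ?C y \<partial>\<nu>)"
      by (rule nn_integral_shift[OF \<nu>]) (intro borel_measurable_times_ennreal f borel_measurable_indicator C')
    also have "\<dots> = emeasure (density \<nu> f) ?C" by (simp add: emeasure_density[OF f\<nu> C])
    also have "\<dots> = emeasure (density \<nu> f) B" using inv_measuresD(5)[OF inv C'] CB by simp
    finally show "emeasure (density \<nu> (\<lambda>y. f (shift y))) B = emeasure (density \<nu> f) B" .
  qed simp
  then show ?thesis by (rule N.density_unique[OF fs f\<nu>])
qed

lemma shift_invariant_on_tower:
  assumes \<sigma>: "nonerasing_morphism \<sigma>" and sets: "sets \<mu> = sets shift_borel"
    and f: "AE y in tower_measure \<sigma> \<mu>. f (shift y) = f y"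
  shows "AE x in \<mu>. f (morphism_Z \<sigma> (shift x)) = f (morphism_Z \<sigma> x) \<and>
    (\<forall>j<length (\<sigma> [x 1]). f ((shift ^^ j) (morphism_Z \<sigma> x)) = f (morphism_Z \<sigma> x))"
  using AE_tower_measure[OF \<sigma> sets f]
proof eventually_elim
  fix x assume *: "\<forall>j<length (\<sigma> [x 1]). f (shift ((shift ^^ j) (morphism_Z \<sigma> x))) = f ((shift ^^ j) (morphism_Z \<sigma> x))"
  have "f ((shift ^^ j) (morphism_Z \<sigma> x)) = f (morphism_Z \<sigma> x)" if "j \<le> length (\<sigma> [x 1])" for j
    using that * by (induction j) auto
  then show "f (morphism_Z \<sigma> (shift x)) = f (morphism_Z \<sigma> x) \<and>
    (\<forall>j<length (\<sigma> [x 1]). f ((shift ^^ j) (morphism_Z \<sigma> x)) = f (morphism_Z \<sigma> x))"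
    by (simp add: morphism_Z_shift[OF \<sigma>])
qed

text \<open>An invariant measure below the transferred one comes from the base. As \<open>f\<close> is almost everywhere
constant along each tower, the density can be evaluated at the bottom level, where it depends only on
the base point; passing from the tower over \<open>x\<close> to the one over \<open>shift x\<close> does not change it either,
which gives the invariance of \<open>\<rho>\<close>.\<close>

lemma density_tower_measure:
  fixes f :: "(int \<Rightarrow> 'b::finite) \<Rightarrow> ennreal" and \<sigma> :: "'a::finite list \<Rightarrow> 'b list"
  assumes \<sigma>: "nonerasing_morphism \<sigma>" and \<mu>: "\<mu> \<in> inv_measures X"
    and f: "f \<in> borel_measurable shift_borel"
    and inv: "density (tower_measure \<sigma> \<mu>) f \<in> inv_measures Y"
  defines "\<rho> \<equiv> density \<mu> (\<lambda>x. f (morphism_Z \<sigma> x))"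
  shows "tower_measure \<sigma> \<rho> = density (tower_measure \<sigma> \<mu>) f"
    and "\<rho> \<in> inv_measures UNIV"
proof -
  let ?S = "morphism_Z \<sigma>" and ?\<nu> = "tower_measure \<sigma> \<mu>"
  note sets = inv_measuresD(2)[OF \<mu>]
  have \<rho>: "sets \<rho> = sets shift_borel" by (simp add: \<rho>_def sets)
  have fS': "(\<lambda>x. f (?S x)) \<in> borel_measurable shift_borel"
    by (rule measurable_compose[OF measurable_morphism_Z[OF \<sigma>] f])
  have fS: "(\<lambda>x. f (?S x)) \<in> borel_measurable \<mu>" by (rule measurable_cong_shift_borel[OF sets fS'])
  have f\<nu>: "f \<in> borel_measurable ?\<nu>" using f by simp
  have finv: "AE x in \<mu>. f (?S (shift x)) = f (?S x) \<and>
      (\<forall>j<length (\<sigma> [x 1]). f ((shift ^^ j) (?S x)) = f (?S x))"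
    by (rule shift_invariant_on_tower[OF \<sigma> sets
        density_shift_invariant[OF tower_measure_invariant[OF \<sigma> \<mu>] f inv]])
  show eq: "tower_measure \<sigma> \<rho> = density ?\<nu> f"
  proof (rule measure_eqI)
    fix B assume "B \<in> sets (tower_measure \<sigma> \<rho>)"
    then have B: "B \<in> sets shift_borel" by simp
    then have ind: "indicator B \<in> borel_measurable shift_borel" by simp
    let ?L = "\<lambda>g x. \<Sum>j<length (\<sigma> [x 1]). g ((shift ^^ j) (?S x)) :: ennreal"
    have "emeasure (tower_measure \<sigma> \<rho>) B = (\<integral>\<^sup>+x. ?L (indicator B) x \<partial>\<rho>)"
      by (rule emeasure_tower_measure[OF \<sigma> \<rho> B])
    also have "\<dots> = (\<integral>\<^sup>+x. f (?S x) * ?L (indicator B) x \<partial>\<mu>)"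
      unfolding \<rho>_def by (rule nn_integral_density[OF fS measurable_level_sum[OF \<sigma> sets ind]])
    also have "\<dots> = (\<integral>\<^sup>+x. ?L (\<lambda>y. f y * indicator B y) x \<partial>\<mu>)"
    proof (rule nn_integral_cong_AE)
      show "AE x in \<mu>. f (?S x) * ?L (indicator B) x = ?L (\<lambda>y. f y * indicator B y) x"
        using finv by eventually_elim (simp add: sum_distrib_left)
    qed
    also have "\<dots> = (\<integral>\<^sup>+y. f y * indicator B y \<partial>?\<nu>)"
      by (rule nn_integral_tower_measure[OF \<sigma> sets, symmetric]) (use f B in auto)
    also have "\<dots> = emeasure (density ?\<nu> f) B"
      using f\<nu> B by (simp add: emeasure_density)
    finally show "emeasure (tower_measure \<sigma> \<rho>) B = emeasure (density ?\<nu> f) B" .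
  qed simp
  have "finite_measure \<rho>"
  proof (rule finite_measureI)
    interpret D: finite_measure "density ?\<nu> f" using inv_measuresD(1)[OF inv] .
    have U: "UNIV \<in> sets (shift_borel :: (int \<Rightarrow> 'b) measure)"
      using sets.top[of "shift_borel :: (int \<Rightarrow> 'b) measure"] by simp
    have "space \<rho> = UNIV" using sets_eq_imp_space_eq[OF \<rho>] by simp
    have "emeasure \<rho> (space \<rho>) = (\<integral>\<^sup>+x. 1 \<partial>\<rho>)" by simp
    also have "\<dots> \<le> (\<integral>\<^sup>+x. of_nat (length (\<sigma> [x 1])) \<partial>\<rho>)"
    proof (rule nn_integral_mono)
      fix x show "1 \<le> (of_nat (length (\<sigma> [x 1])) :: ennreal)"
        using nonerasing_pos[OF \<sigma>, of "x 1"] of_nat_mono[of 1 "length (\<sigma> [x 1])"] by simp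
    qed
    also have "\<dots> = emeasure (tower_measure \<sigma> \<rho>) UNIV"
      using emeasure_tower_measure[OF \<sigma> \<rho> U] by simp
    finally show "emeasure \<rho> (space \<rho>) \<noteq> \<infinity>"
      using D.emeasure_finite[of UNIV] unfolding eq by (auto simp: top_unique)
  qed
  moreover have "emeasure \<rho> (shift -` A) = emeasure \<rho> A" if A': "A \<in> sets shift_borel" for A
  proof -
    have A: "A \<in> sets \<mu>" "shift -` A \<in> sets \<mu>"
      using A' sets vimage_in_shift_borel[OF measurable_shift A'] by simp_all
    have "emeasure \<rho> (shift -` A) = (\<integral>\<^sup>+x. f (?S x) * indicator A (shift x) \<partial>\<mu>)"
      unfolding \<rho>_def by (simp add: emeasure_density[OF fS A(2)] indicator_vimage)
    also have "\<dots> = (\<integral>\<^sup>+x. f (?S (shift x)) * indicator A (shift x) \<partial>\<mu>)"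
      by (rule nn_integral_cong_AE) (use finv in \<open>auto elim: eventually_mono\<close>)
    also have "\<dots> = (\<integral>\<^sup>+x. f (?S x) * indicator A x \<partial>\<mu>)"
      by (rule nn_integral_shift[OF \<mu>]) (intro borel_measurable_times_ennreal fS' borel_measurable_indicator A')
    also have "\<dots> = emeasure \<rho> A" unfolding \<rho>_def by (simp add: emeasure_density[OF fS A(1)])
    finally show ?thesis .
  qed
  ultimately show "\<rho> \<in> inv_measures UNIV" using \<rho> by (simp add: inv_measures_def)
qed

lemma absolutely_continuous_add_measure:
  assumes "sets \<mu> = sets \<nu>"
  shows "absolutely_continuous (add_measure \<mu> \<nu>) \<mu>" "absolutely_continuous (add_measure \<mu> \<nu>) \<nu>"
  using assms by (auto simp: absolutely_continuous_def null_sets_def emeasure_add_measure)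

lemma tower_measure_null: 
  assumes \<sigma>: "nonerasing_morphism \<sigma>"
  shows "tower_measure \<sigma> (null_measure shift_borel) = null_measure shift_borel"
proof (rule measure_eqI)
  fix B assume "B \<in> sets (tower_measure \<sigma> (null_measure shift_borel))"
  then have "B \<in> sets shift_borel" by simp
  then show "emeasure (tower_measure \<sigma> (null_measure shift_borel)) B = emeasure (null_measure shift_borel) B"
    using emeasure_tower_measure[OF \<sigma> sets_null_measure] by simp
qed simp

lemma tower_measure_scale: 
  assumes \<sigma>: "nonerasing_morphism \<sigma>" and sets: "sets \<mu> = sets shift_borel"
  shows "tower_measure \<sigma> (scale_measure c \<mu>) = scale_measure c (tower_measure \<sigma> \<mu>)"
proof (rule measure_eqI)
  fix B assume "B \<in> sets (tower_measure \<sigma> (scale_measure c \<mu>))"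
  then have B: "B \<in> sets shift_borel" by simp
  obtain R where R: "\<And>a. length (\<sigma> [a]) \<le> R" using length_image_bounded[of \<sigma>] by blast
  have s: "sets (scale_measure c \<mu>) = sets shift_borel" by (simp add: sets)
  show "emeasure (tower_measure \<sigma> (scale_measure c \<mu>)) B = emeasure (scale_measure c (tower_measure \<sigma> \<mu>)) B"
    by (simp add: emeasure_tower_measure_level_sets[OF \<sigma> s B R] emeasure_tower_measure_level_sets[OF \<sigma> sets B R]
        sum_distrib_left)
qed simp

text \<open>The densities of the two summands add up to 1, hence so do their lifts, and a decomposition of the
transferred measure lifts to a decomposition of \<open>\<mu>\<close>. Transferring back shows that the lifts are nonzero
and not proportional if the given summands are.\<close>

lemma ergodic_tower_measure:
  fixes \<sigma> :: "'a::finite list \<Rightarrow> 'b::finite list"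
  assumes \<sigma>: "nonerasing_morphism \<sigma>" and erg: "ergodic \<mu>"
  shows "ergodic (tower_measure \<sigma> \<mu>)"
proof -
  let ?\<nu> = "tower_measure \<sigma> \<mu>" and ?S = "morphism_Z \<sigma>"
  have \<mu>: "\<mu> \<in> inv_measures UNIV" using erg by (simp add: ergodic_def)
  note sets = inv_measuresD(2)[OF \<mu>]
  note \<nu> = tower_measure_invariant[OF \<sigma> \<mu>]
  interpret N: finite_measure ?\<nu> using inv_measuresD(1)[OF \<nu>] .
  have False
    if \<nu>1: "\<nu>1 \<in> inv_measures UNIV" and \<nu>2: "\<nu>2 \<in> inv_measures UNIV" and sum: "?\<nu> = add_measure \<nu>1 \<nu>2"
      and nz: "\<nu>1 \<noteq> null_measure shift_borel" "\<nu>2 \<noteq> null_measure shift_borel"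
      and nprop: "\<forall>l::real. l > 0 \<longrightarrow> \<nu>1 \<noteq> scale_measure (ennreal l) \<nu>2" for \<nu>1 \<nu>2
  proof -
    have s12: "sets \<nu>1 = sets \<nu>2" "sets \<nu>1 = sets ?\<nu>" "sets \<nu>2 = sets ?\<nu>"
      by (simp_all add: inv_measuresD(2)[OF \<nu>1] inv_measuresD(2)[OF \<nu>2])
    obtain f1 where f1: "f1 \<in> borel_measurable ?\<nu>" "density ?\<nu> f1 = \<nu>1"
      using N.Radon_Nikodym[OF _ s12(2)] absolutely_continuous_add_measure(1)[OF s12(1)] sum by auto
    obtain f2 where f2: "f2 \<in> borel_measurable ?\<nu>" "density ?\<nu> f2 = \<nu>2"
      using N.Radon_Nikodym[OF _ s12(3)] absolutely_continuous_add_measure(2)[OF s12(1)] sum by auto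
    have f12: "f1 \<in> borel_measurable shift_borel" "f2 \<in> borel_measurable shift_borel"
      using f1(1) f2(1) by simp_all
    define \<mu>1 where "\<mu>1 = density \<mu> (\<lambda>x. f1 (?S x))"
    define \<mu>2 where "\<mu>2 = density \<mu> (\<lambda>x. f2 (?S x))"
    have t1: "tower_measure \<sigma> \<mu>1 = \<nu>1" "\<mu>1 \<in> inv_measures UNIV"
      using density_tower_measure[OF \<sigma> \<mu> f12(1), of UNIV] f1(2) \<nu>1 by (simp_all add: \<mu>1_def)
    have t2: "tower_measure \<sigma> \<mu>2 = \<nu>2" "\<mu>2 \<in> inv_measures UNIV"
      using density_tower_measure[OF \<sigma> \<mu> f12(2), of UNIV] f2(2) \<nu>2 by (simp_all add: \<mu>2_def)
    have "density ?\<nu> (\<lambda>y. f1 y + f2 y) = density ?\<nu> (\<lambda>_. 1)"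
    proof (rule measure_eqI)
      fix B assume "B \<in> sets (density ?\<nu> (\<lambda>y. f1 y + f2 y))"
      then have B: "B \<in> sets ?\<nu>" by simp
      have "emeasure (density ?\<nu> (\<lambda>y. f1 y + f2 y)) B = (\<integral>\<^sup>+y. f1 y * indicator B y + f2 y * indicator B y \<partial>?\<nu>)"
        using f1(1) f2(1) B by (simp add: emeasure_density distrib_right)
      also have "\<dots> = (\<integral>\<^sup>+y. f1 y * indicator B y \<partial>?\<nu>) + (\<integral>\<^sup>+y. f2 y * indicator B y \<partial>?\<nu>)"
        using f1(1) f2(1) B by (intro nn_integral_add) auto
      also have "\<dots> = emeasure (density ?\<nu> f1) B + emeasure (density ?\<nu> f2) B"
        using f1(1) f2(1) B by (simp add: emeasure_density)
      also have "\<dots> = emeasure \<nu>1 B + emeasure \<nu>2 B" by (simp only: f1(2) f2(2))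
      also have "\<dots> = emeasure ?\<nu> B" by (simp add: sum emeasure_add_measure[OF s12(1)])
      finally show "emeasure (density ?\<nu> (\<lambda>y. f1 y + f2 y)) B = emeasure (density ?\<nu> (\<lambda>_. 1)) B"
        by (simp add: density_1)
    qed simp
    then have "AE y in ?\<nu>. f1 y + f2 y = 1"
      by (intro N.density_unique) (use f1(1) f2(1) in auto)
    from AE_tower_measure[OF \<sigma> sets this] have one: "AE x in \<mu>. f1 (?S x) + f2 (?S x) = 1"
    proof eventually_elim
      case (elim x)
      then show ?case using nonerasing_not_Nil[OF \<sigma>, of "x 1"] by (auto dest: spec[of _ 0])
    qed
    have fS: "(\<lambda>x. f1 (?S x)) \<in> borel_measurable \<mu>" "(\<lambda>x. f2 (?S x)) \<in> borel_measurable \<mu>"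
      by (intro measurable_cong_shift_borel[OF sets] measurable_compose[OF measurable_morphism_Z[OF \<sigma>]] f12)+
    have "\<mu> = add_measure \<mu>1 \<mu>2"
    proof (rule measure_eqI)
      show "sets \<mu> = sets (add_measure \<mu>1 \<mu>2)" by (simp add: \<mu>1_def)
      fix A assume A: "A \<in> sets \<mu>"
      have "emeasure (add_measure \<mu>1 \<mu>2) A = emeasure \<mu>1 A + emeasure \<mu>2 A"
        by (rule emeasure_add_measure) (simp add: \<mu>1_def \<mu>2_def)
      also have "\<dots> = (\<integral>\<^sup>+x. f1 (?S x) * indicator A x \<partial>\<mu>) + (\<integral>\<^sup>+x. f2 (?S x) * indicator A x \<partial>\<mu>)"
        unfolding \<mu>1_def \<mu>2_def using fS A by (simp add: emeasure_density)
      also have "\<dots> = (\<integral>\<^sup>+x. f1 (?S x) * indicator A x + f2 (?S x) * indicator A x \<partial>\<mu>)"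
        using fS A by (intro nn_integral_add[symmetric]) auto
      also have "\<dots> = (\<integral>\<^sup>+x. indicator A x \<partial>\<mu>)"
      proof (rule nn_integral_cong_AE)
        show "AE x in \<mu>. f1 (?S x) * indicator A x + f2 (?S x) * indicator A x = indicator A x"
          using one by eventually_elim (simp add: distrib_right[symmetric])
      qed
      finally show "emeasure \<mu> A = emeasure (add_measure \<mu>1 \<mu>2) A" using A by simp
    qed
    moreover have "\<mu>1 \<noteq> null_measure shift_borel" "\<mu>2 \<noteq> null_measure shift_borel"
      using nz t1(1) t2(1) tower_measure_null[OF \<sigma>] by auto
    moreover have "\<forall>l::real. l > 0 \<longrightarrow> \<mu>1 \<noteq> scale_measure (ennreal l) \<mu>2"
      using nprop t1(1) t2(1) tower_measure_scale[OF \<sigma> inv_measuresD(2)[OF t2(2)]] by auto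
    ultimately show False using erg t1(2) t2(2) unfolding ergodic_def by blast
  qed
  then show ?thesis using \<nu> unfolding ergodic_def by blast
qed

section \<open>Surjectivity\<close>

lemma measure_from_window_sets:
  fixes L :: "(int \<Rightarrow> 'a::finite) set \<Rightarrow> real"
  assumes nonneg: "\<And>A. A \<in> window_sets \<Longrightarrow> 0 \<le> L A"
    and add: "\<And>A B. A \<in> window_sets \<Longrightarrow> B \<in> window_sets \<Longrightarrow> A \<inter> B = {} \<Longrightarrow> L (A \<union> B) = L A + L B"
  obtains \<mu> where "sets \<mu> = sets shift_borel" "\<And>A. A \<in> window_sets \<Longrightarrow> emeasure \<mu> A = ennreal (L A)"
proof -
  let ?W = "window_sets :: (int \<Rightarrow> 'a) set set"
  interpret algebra UNIV ?W by (rule algebra_window_sets)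
  have empty: "L {} = 0" using add[of "{}" "{}"] empty_sets by simp
  have "\<exists>f :: (int \<Rightarrow> 'a) set \<Rightarrow> ennreal. (\<forall>A\<in>?W. f A = ennreal (L A)) \<and> measure_space UNIV (sigma_sets UNIV ?W) f"
  proof (rule caratheodory_empty_continuous)
    show "positive ?W (\<lambda>A. ennreal (L A))" by (simp add: positive_def empty)
    show "additive ?W (\<lambda>A. ennreal (L A))" by (simp add: additive_def add nonneg)
    show "(\<lambda>i. ennreal (L (A i))) \<longlonglongrightarrow> 0"
      if A: "range A \<subseteq> ?W" "decseq A" "(\<Inter>i. A i) = {}" for A
    proof -
      obtain k where k: "A k = {}" using compact_window_sets_decseq[of A] A by blast
      have "ennreal (L (A i)) = 0" if "i \<ge> k" for i
        using k decseqD[OF A(2) that] empty by simp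
      then show ?thesis by (intro tendsto_eventually) (auto simp: eventually_sequentially)
    qed
  qed simp
  then obtain f where f: "\<And>A. A \<in> ?W \<Longrightarrow> f A = ennreal (L A)"
    and ms: "measure_space UNIV (sigma_sets UNIV ?W) f" by blast
  define \<mu> where "\<mu> = measure_of UNIV (sigma_sets UNIV ?W) f"
  have sa: "sigma_algebra UNIV (sigma_sets UNIV ?W)" using ms by (simp add: measure_space_def)
  have "sets \<mu> = sigma_sets UNIV ?W" unfolding \<mu>_def
    by (simp add: sigma_algebra.sigma_sets_eq[OF sa])
  then have "sets \<mu> = sets shift_borel" by (simp add: sets_shift_borel_window)
  moreover have "emeasure \<mu> A = ennreal (L A)" if A: "A \<in> ?W" for A
  proof -
    have "emeasure \<mu> A = f A" unfolding \<mu>_def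
      using ms A by (intro emeasure_measure_of_sigma) (auto simp: measure_space_def)
    then show ?thesis using f A by simp
  qed
  ultimately show thesis by (rule that)
qed

lemma window_set_shift_vimage:
  assumes "A \<in> window_sets"
  shows "shift -` A \<in> window_sets"
proof -
  obtain n where "\<forall>x y. agree n x y \<longrightarrow> (x \<in> A \<longleftrightarrow> y \<in> A)"
    using assms by (auto simp: window_sets_def)
  then have "\<forall>x y. agree (Suc n) x y \<longrightarrow> (x \<in> shift -` A \<longleftrightarrow> y \<in> shift -` A)"
    using agree_shift by simp blast
  then show ?thesis unfolding window_sets_def by blast
qed

text \<open>A countable product of compact intervals is sequentially compact.\<close>

lemma convergent_subsequence_pointwise:
  fixes f :: "nat \<Rightarrow> 's \<Rightarrow> real"
  assumes S: "countable S" and bound: "\<And>n s. s \<in> S \<Longrightarrow> f n s \<in> {0..c}"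
  obtains r :: "nat \<Rightarrow> nat" where "strict_mono r" "\<And>s. s \<in> S \<Longrightarrow> convergent (\<lambda>n. f (r n) s)"
proof (cases "S = {}")
  case True
  then show ?thesis using that[of id] by (auto simp: strict_mono_def)
next
  case False
  define e where "e = from_nat_into S"
  have e: "range e = S" unfolding e_def by (rule range_from_nat_into[OF False S])
  let ?K = "Pi\<^sub>E (UNIV :: nat set) (\<lambda>_. {0..c})"
  have "compactin (product_topology (\<lambda>_ :: nat. euclideanreal) UNIV) ?K"
    by (subst compactin_PiE) auto
  then have "compact ?K" by (simp add: euclidean_product_topology)
  then have "seq_compact ?K" by (rule compact_imp_seq_compact)
  moreover have "(\<lambda>k. f n (e k)) \<in> ?K" for n using bound e by (auto simp: PiE_iff)
  ultimately obtain l r where r: "strict_mono r" and l: "((\<lambda>n k. f n (e k)) \<circ> r) \<longlonglongrightarrow> l"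
    using seq_compactE[of ?K "\<lambda>n k. f n (e k)"] by metis
  have "convergent (\<lambda>n. f (r n) s)" if "s \<in> S" for s
  proof -
    have "s \<in> range e" using e that by simp
    then obtain k where k: "s = e k" by blast
    have "continuous_on UNIV (\<lambda>x :: nat \<Rightarrow> real. x k)" by (rule continuous_on_product_coordinates)
    from continuous_on_tendsto_compose[OF this l] show ?thesis
      by (auto simp: convergent_def k o_def)
  qed
  then show ?thesis using r by (rule that[rotated])
qed

text \<open>The points that can be approximated by tower levels form a subshift: moving by one step from the top
or bottom of a tower leads to a neighbouring tower.\<close>

lemma image_subshift_approx:
  assumes \<sigma>: "nonerasing_morphism \<sigma>" and X: "subshift X" and y: "y \<in> image_subshift \<sigma> X"
  shows "\<exists>x\<in>X. \<exists>j<length (\<sigma> [x 1]). agree n ((shift ^^ j) (morphism_Z \<sigma> x)) y"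
proof -
  let ?D = "\<lambda>n z. \<exists>x\<in>X. \<exists>j<length (\<sigma> [x 1]). agree n ((shift ^^ j) (morphism_Z \<sigma> x)) z"
  define Z where "Z = {z. \<forall>n. ?D n z}"
  have pos: "0 < length (\<sigma> [a])" for a using nonerasing_not_Nil[OF \<sigma>] by simp
  have sub: "morphism_Z \<sigma> ` X \<subseteq> Z"
  proof
    fix z assume "z \<in> morphism_Z \<sigma> ` X"
    then obtain x where x: "x \<in> X" "z = morphism_Z \<sigma> x" by blast
    have "?D n z" for n
      by (rule bexI[OF _ x(1)], rule exI[of _ 0]) (simp add: pos[simplified] x(2))
    then show "z \<in> Z" by (simp add: Z_def)
  qed
  have "subshift Z"
  proof (rule subshiftI)
    show "Z \<noteq> {}" using sub subshiftD(1)[OF X] by blast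
    show "closedin full_shift Z"
      unfolding closedin_full_shift_iff
    proof (intro allI impI)
      fix z assume z: "\<forall>n. \<exists>w\<in>Z. agree n z w"
      have "?D n z" for n
      proof -
        obtain w where "w \<in> Z" "agree n z w" using z by blast
        then obtain x j where "x \<in> X" "j < length (\<sigma> [x 1])" "agree n ((shift ^^ j) (morphism_Z \<sigma> x)) w"
          unfolding Z_def by blast
        then show ?thesis using agree_trans agree_sym[OF \<open>agree n z w\<close>] by blast
      qed
      then show "z \<in> Z" by (simp add: Z_def)
    qed
    show "shift z \<in> Z \<longleftrightarrow> z \<in> Z" for z
    proof
      assume z: "z \<in> Z"
      have "?D n (shift z)" for n
      proof -
        obtain x j where x: "x \<in> X" "j < length (\<sigma> [x 1])" "agree (Suc n) ((shift ^^ j) (morphism_Z \<sigma> x)) z"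
          using z unfolding Z_def by blast
        have a: "agree n ((shift ^^ Suc j) (morphism_Z \<sigma> x)) (shift z)"
          using agree_shift[OF x(3)] by simp
        show ?thesis
        proof (cases "Suc j < length (\<sigma> [x 1])")
          case True
          then show ?thesis using a x(1) by blast
        next
          case False
          then have "length (\<sigma> [x 1]) = Suc j" using x(2) by simp
          then have "(shift ^^ 0) (morphism_Z \<sigma> (shift x)) = (shift ^^ Suc j) (morphism_Z \<sigma> x)"
            by (simp add: morphism_Z_shift[OF \<sigma>])
          moreover have "shift x \<in> X" using x(1) X by (simp add: subshiftD(3))
          ultimately show ?thesis using a pos by metis
        qed
      qed
      then show "shift z \<in> Z" by (simp add: Z_def)
    next
      assume z: "shift z \<in> Z"
      have "?D n z" for n
      proof -
        obtain x j where x: "x \<in> X" "j < length (\<sigma> [x 1])"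
          "agree (Suc n) ((shift ^^ j) (morphism_Z \<sigma> x)) (shift z)"
          using z unfolding Z_def by blast
        show ?thesis
        proof (cases j)
          case (Suc i)
          then have "agree n ((shift ^^ i) (morphism_Z \<sigma> x)) z" using x(3) agree_unshift by simp
          then show ?thesis using x(1,2) Suc Suc_lessD by blast
        next
          case 0
          obtain v where v: "x = shift v" using bij_shift by (metis bij_pointE)
          have vX: "v \<in> X" using x(1) v X by (simp add: subshiftD(3))
          obtain i where i: "length (\<sigma> [v 1]) = Suc i" using pos by (metis Suc_pred)
          then have "(shift ^^ j) (morphism_Z \<sigma> x) = shift ((shift ^^ i) (morphism_Z \<sigma> v))"
            by (simp add: 0 v morphism_Z_shift[OF \<sigma>])
          then have "agree n ((shift ^^ i) (morphism_Z \<sigma> v)) z" using x(3) agree_unshift by metis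
          then show ?thesis using vX i by (metis lessI)
        qed
      qed
      then show "z \<in> Z" by (simp add: Z_def)
    qed
  qed
  then have "y \<in> Z" using image_subshift_least[OF _ sub] y by blast
  then show ?thesis by (simp add: Z_def)
qed

text \<open>The choice depends on \<open>y\<close> only through the window, which is what makes the counts of visits below
measurable functions of \<open>y\<close>.\<close>

lemma sampling_exists:
  assumes \<sigma>: "nonerasing_morphism \<sigma>" and X: "subshift X"
  obtains \<xi> j where
    "\<And>y z. agree n y z \<Longrightarrow> \<xi> y = \<xi> z"
    "\<And>y. y \<in> image_subshift \<sigma> X \<Longrightarrow> \<xi> y \<in> X \<and> j y < length (\<sigma> [\<xi> y 1]) \<and>
        agree n ((shift ^^ j y) (morphism_Z \<sigma> (\<xi> y))) y"
proof -
  define P where "P y p \<longleftrightarrow> fst p \<in> X \<and> snd p < length (\<sigma> [fst p 1]) \<and>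
    agree n ((shift ^^ snd p) (morphism_Z \<sigma> (fst p))) y" for y and p :: "(int \<Rightarrow> 'a) \<times> nat"
  define c where "c y = (SOME p. P y p)" for y
  have "P y = P z" if "agree n y z" for y z
    unfolding P_def using agree_trans that agree_sym by blast
  then have c_eq: "c y = c z" if "agree n y z" for y z using that by (simp add: c_def)
  have "P y (c y)" if y: "y \<in> image_subshift \<sigma> X" for y
  proof -
    obtain x i where "x \<in> X" "i < length (\<sigma> [x 1])" "agree n ((shift ^^ i) (morphism_Z \<sigma> x)) y"
      using image_subshift_approx[OF \<sigma> X y] by blast
    then have "P y (x, i)" by (simp add: P_def)
    then show ?thesis unfolding c_def by (rule someI)
  qed
  then show thesis using that[of "\<lambda>y. fst (c y)" "\<lambda>y. snd (c y)"] c_eq by (auto simp: P_def)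
qed

subsection \<open>Empirical counts along orbit segments\<close>

definition prefix_length :: "('a list \<Rightarrow> 'b list) \<Rightarrow> (int \<Rightarrow> 'a) \<Rightarrow> nat \<Rightarrow> nat" where
  "prefix_length \<sigma> x m = (\<Sum>i<m. length (\<sigma> [(shift ^^ i) x 1]))"

text \<open>Visits are counted over blocks of the base but will be normalized by letters of the image. The number
of blocks is therefore cut off at \<open>n\<close> image letters; this is what makes the limit transfer to \<open>\<nu>\<close>
without a factor.\<close>

definition block_count :: "('a list \<Rightarrow> 'b list) \<Rightarrow> nat \<Rightarrow> (int \<Rightarrow> 'a) \<Rightarrow> nat" where
  "block_count \<sigma> n x = (LEAST m. n \<le> prefix_length \<sigma> x m)"

definition visits :: "('a list \<Rightarrow> 'b list) \<Rightarrow> nat \<Rightarrow> (int \<Rightarrow> 'a) \<Rightarrow> (int \<Rightarrow> 'a) set \<Rightarrow> real" where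
  "visits \<sigma> n x A = (\<Sum>i<block_count \<sigma> n x. indicator A ((shift ^^ i) x))"

lemma le_prefix_length:
  assumes "nonerasing_morphism \<sigma>"
  shows "m \<le> prefix_length \<sigma> x m"
proof (induction m)
  case (Suc m)
  then show ?case using nonerasing_pos[OF assms, of "(shift ^^ m) x 1"] by (simp add: prefix_length_def)
qed (simp add: prefix_length_def)

lemma block_count_le: "nonerasing_morphism \<sigma> \<Longrightarrow> block_count \<sigma> n x \<le> n"
  by (simp add: block_count_def Least_le le_prefix_length)

lemma prefix_length_block_count:
  assumes \<sigma>: "nonerasing_morphism \<sigma>" and R: "\<And>a. length (\<sigma> [a]) \<le> R"
  shows "n \<le> prefix_length \<sigma> x (block_count \<sigma> n x)"
    and "prefix_length \<sigma> x (block_count \<sigma> n x) \<le> n + R"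
proof -
  show "n \<le> prefix_length \<sigma> x (block_count \<sigma> n x)"
    unfolding block_count_def by (rule LeastI) (rule le_prefix_length[OF \<sigma>])
  show "prefix_length \<sigma> x (block_count \<sigma> n x) \<le> n + R"
  proof (cases "block_count \<sigma> n x")
    case (Suc m)
    then have "\<not> n \<le> prefix_length \<sigma> x m" unfolding block_count_def by (metis lessI not_less_Least)
    then show ?thesis using R[of "(shift ^^ m) x 1"] by (simp add: Suc prefix_length_def)
  qed (simp add: prefix_length_def)
qed

lemma visits_bounds:
  assumes "nonerasing_morphism \<sigma>"
  shows "0 \<le> visits \<sigma> n x A" "visits \<sigma> n x A \<le> real n"
proof -
  show "0 \<le> visits \<sigma> n x A" by (simp add: visits_def sum_nonneg)
  have "visits \<sigma> n x A \<le> (\<Sum>i<block_count \<sigma> n x. 1)"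
    unfolding visits_def by (intro sum_mono) (simp add: indicator_def)
  also have "\<dots> \<le> real n" using block_count_le[OF assms] by simp
  finally show "visits \<sigma> n x A \<le> real n" .
qed

lemma visits_Un: "A \<inter> B = {} \<Longrightarrow> visits \<sigma> n x (A \<union> B) = visits \<sigma> n x A + visits \<sigma> n x B"
  unfolding visits_def sum.distrib[symmetric] by (intro sum.cong) (auto simp: indicator_def)

lemma visits_shift: "\<bar>visits \<sigma> n x (shift -` A) - visits \<sigma> n x A\<bar> \<le> 1"
proof -
  let ?a = "\<lambda>i. indicator A ((shift ^^ i) x) :: real"
  have "visits \<sigma> n x (shift -` A) - visits \<sigma> n x A = (\<Sum>i<block_count \<sigma> n x. ?a (Suc i) - ?a i)"
    by (simp add: visits_def sum_subtractf indicator_def)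
  also have "\<dots> = ?a (block_count \<sigma> n x) - ?a 0" by (rule sum_lessThan_telescope)
  finally show ?thesis by (simp add: indicator_def)
qed

lemma sum_lessThan_bounds:
  fixes a :: "nat \<Rightarrow> real"
  assumes "\<And>k. 0 \<le> a k" "\<And>k. a k \<le> 1" "m \<le> n"
  shows "sum a {..<m} \<le> sum a {..<n}" "sum a {..<n} \<le> sum a {..<m} + real (n - m)"
proof -
  obtain d where d: "n = m + d" using assms(3) le_Suc_ex by blast
  have "(\<Sum>k<d. a (m + k)) \<le> (\<Sum>k<d. 1)" by (intro sum_mono assms(2))
  moreover have "0 \<le> (\<Sum>k<d. a (m + k))" by (intro sum_nonneg assms(1))
  ultimately show "sum a {..<m} \<le> sum a {..<n}" "sum a {..<n} \<le> sum a {..<m} + real (n - m)"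
    by (simp_all add: d sum_lessThan_add)
qed

text \<open>The towers over the counted blocks make up an orbit segment of \<open>\<sigma>(x)\<close> that starts at 0 and whose length
is between \<open>n\<close> and \<open>n + R\<close>. The segment of \<open>y\<close> is shadowed by the one that starts at \<open>j \<le> R\<close> and
has length \<open>n\<close>. The two differ in at most \<open>R\<close> places at either end.\<close>

lemma visits_level_sets:
  assumes \<sigma>: "nonerasing_morphism \<sigma>" and R: "\<And>a. length (\<sigma> [a]) \<le> R"
    and j: "j < length (\<sigma> [x 1])"
    and B: "\<And>k. k < n \<Longrightarrow> (shift ^^ k) ((shift ^^ j) (morphism_Z \<sigma> x)) \<in> B \<longleftrightarrow> (shift ^^ k) y \<in> B"
  shows "\<bar>(\<Sum>i<R. visits \<sigma> n x (level_set \<sigma> B i)) - (\<Sum>k<n. indicator B ((shift ^^ k) y))\<bar> \<le> 2 * real R"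
proof -
  let ?m = "block_count \<sigma> n x" and ?S = "morphism_Z \<sigma>"
  define a where "a k = (indicator B ((shift ^^ k) (?S x)) :: real)" for k
  have a: "0 \<le> a k" "a k \<le> 1" for k by (simp_all add: a_def indicator_def)
  let ?M = "prefix_length \<sigma> x ?m"
  have M: "n \<le> ?M" "?M \<le> n + R" using prefix_length_block_count[of \<sigma> R, OF \<sigma> R] by auto
  have "(\<Sum>i<R. visits \<sigma> n x (level_set \<sigma> B i)) =
      (\<Sum>i<?m. \<Sum>j<R. indicator (level_set \<sigma> B j) ((shift ^^ i) x))"
    unfolding visits_def by (rule sum.swap)
  also have "\<dots> = (\<Sum>i<?m. \<Sum>j<length (\<sigma> [(shift ^^ i) x 1]). indicator B ((shift ^^ j) (?S ((shift ^^ i) x))))"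
    by (simp only: level_sum_eq_level_sets[of \<sigma> R, OF R])
  also have "\<dots> = sum a {..<?M}"
    unfolding nested_level_sum[OF \<sigma>] prefix_length_def a_def ..
  finally have 1: "(\<Sum>i<R. visits \<sigma> n x (level_set \<sigma> B i)) = sum a {..<?M}" .
  have "(\<Sum>k<n. indicator B ((shift ^^ k) y)) = (\<Sum>k<n. a (j + k))"
    unfolding a_def funpow_shift_add[symmetric] using B by (intro sum.cong) (auto simp: indicator_def)
  also have "\<dots> = sum a {..<j + n} - sum a {..<j}" by (simp add: sum_lessThan_add)
  finally have 2: "(\<Sum>k<n. indicator B ((shift ^^ k) y)) = sum a {..<j + n} - sum a {..<j}" .
  have jR: "j \<le> R" using j R[of "x 1"] by simp
  show ?thesis
    unfolding 1 2
    using sum_lessThan_bounds[of a n ?M, OF a M(1)] sum_lessThan_bounds[of a n "j + n", OF a]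
      sum_lessThan_bounds[of a 0 j, OF a] M(2) jR by (simp add: abs_le_iff)
qed

subsection \<open>Lifting an invariant measure\<close>

lemma integral_orbit_average:
  assumes \<nu>: "\<nu> \<in> inv_measures Y" and B: "B \<in> sets shift_borel"
  shows "(\<integral>y. (\<Sum>k<n. indicator B ((shift ^^ k) y)) \<partial>\<nu>) = real n * measure \<nu> B"
proof -
  interpret N: finite_measure \<nu> using inv_measuresD(1)[OF \<nu>] .
  note sets = inv_measuresD(2)[OF \<nu>]
  have Bk: "(shift ^^ k) -` B \<in> sets \<nu>" for k
    using vimage_in_shift_borel[OF measurable_funpow_shift B] sets by simp
  have int: "integrable \<nu> (indicator ((shift ^^ k) -` B) :: _ \<Rightarrow> real)" for k
    by (rule integrable_real_indicator[OF Bk]) (simp add: N.emeasure_finite less_top[symmetric])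
  have "(\<integral>y. (\<Sum>k<n. indicator B ((shift ^^ k) y)) \<partial>\<nu>) =
      (\<integral>y. (\<Sum>k<n. indicator ((shift ^^ k) -` B) y :: real) \<partial>\<nu>)"
    by (intro Bochner_Integration.integral_cong refl sum.cong) (simp add: indicator_def)
  also have "\<dots> = (\<Sum>k<n. \<integral>y. indicator ((shift ^^ k) -` B) y \<partial>\<nu>)"
    by (rule Bochner_Integration.integral_sum) (rule int)
  also have "\<dots> = (\<Sum>k<n. measure \<nu> ((shift ^^ k) -` B))"
    using Bk inv_measuresD(3)[OF \<nu>] by simp
  also have "\<dots> = real n * measure \<nu> B"
    using inv_measures_funpow[OF \<nu> B] by (simp add: measure_def)
  finally show ?thesis .
qed

text \<open>A finitely additive set function that has, up to errors of order \<open>1/n\<close>, all the properties of a lift of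
\<open>\<nu>\<close> to \<open>X\<close>. The last clause compares the transfer, written as a sum over level sets, with \<open>\<nu>\<close> on sets
that depend on coordinates up to \<open>n\<close>.\<close>

definition approximate_lift ::
    "('a::finite list \<Rightarrow> 'b::finite list) \<Rightarrow> (int \<Rightarrow> 'a) set \<Rightarrow> (int \<Rightarrow> 'b) measure \<Rightarrow> nat \<Rightarrow> nat \<Rightarrow>
     ((int \<Rightarrow> 'a) set \<Rightarrow> real) \<Rightarrow> bool" where
  "approximate_lift \<sigma> X \<nu> R n p \<longleftrightarrow>
     (\<forall>A. 0 \<le> p A) \<and> (\<forall>A. p A \<le> measure \<nu> UNIV) \<and>
     (\<forall>A B. A \<inter> B = {} \<longrightarrow> p (A \<union> B) = p A + p B) \<and>
     (\<forall>A. \<bar>p (shift -` A) - p A\<bar> \<le> measure \<nu> UNIV / (real n + 1)) \<and>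
     (\<forall>A. A \<inter> X = {} \<longrightarrow> p A = 0) \<and>
     (\<forall>B q. (\<forall>x y. agree q x y \<longrightarrow> (x \<in> B \<longleftrightarrow> y \<in> B)) \<longrightarrow> q \<le> n \<longrightarrow>
        \<bar>(\<Sum>i<R. p (level_set \<sigma> B i)) - measure \<nu> B\<bar> \<le> 2 * real R * measure \<nu> UNIV / (real n + 1))"

text \<open>Integrate over \<open>y\<close> the visits of the sampled point \<open>\<xi>(y)\<close> to \<open>A\<close> and divide by the length \<open>m\<close> of the
orbit segment. The averaged number of visits of \<open>y\<close> itself to \<open>B\<close> is \<open>m\<close> times the measure of \<open>B\<close> by
invariance.\<close>

lemma approximate_lift_exists:
  fixes \<sigma> :: "'a::finite list \<Rightarrow> 'b::finite list" and n :: nat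
  assumes \<sigma>: "nonerasing_morphism \<sigma>" and X: "subshift X" and R: "\<And>a. length (\<sigma> [a]) \<le> R"
    and \<nu>: "\<nu> \<in> inv_measures (image_subshift \<sigma> X)"
  shows "\<exists>p. approximate_lift \<sigma> X \<nu> R n p"
proof -
  let ?Y = "image_subshift \<sigma> X" and ?S = "morphism_Z \<sigma>"
  \<comment> \<open>the segment length is \<open>n + 1\<close> rather than \<open>n\<close>, so that one can divide by it\<close>
  define m where "m = Suc n"
  define c where "c = measure \<nu> UNIV"
  interpret N: finite_measure \<nu> using inv_measuresD(1)[OF \<nu>] .
  note sets = inv_measuresD(2)[OF \<nu>] and space = inv_measuresD(3)[OF \<nu>]
  have Y: "AE y in \<nu>. y \<in> ?Y"
    by (rule supp_AE[OF sets subshiftD(2)[OF subshift_image_subshift[OF X]] inv_measuresD(4)[OF \<nu>]])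
  \<comment> \<open>a window of twice the segment length still has room for coordinates up to \<open>n\<close> after \<open>m\<close> shifts\<close>
  obtain \<xi> j where \<xi>: "\<And>y z. agree (2 * m) y z \<Longrightarrow> \<xi> y = \<xi> z"
    and \<xi>Y: "\<And>y. y \<in> ?Y \<Longrightarrow> \<xi> y \<in> X \<and> j y < length (\<sigma> [\<xi> y 1]) \<and>
      agree (2 * m) ((shift ^^ j y) (?S (\<xi> y))) y"
    by (rule sampling_exists[OF \<sigma> X, where n = "2 * m"]) (rule that; assumption)
  define V where "V A y = visits \<sigma> m (\<xi> y) A" for A y
  have Vb: "0 \<le> V A y" "V A y \<le> real m" for A y using visits_bounds[OF \<sigma>] by (simp_all add: V_def)
  have Vm: "V A \<in> borel_measurable \<nu>" for A
  proof (rule measurable_cong_shift_borel[OF sets])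
    have "V A y = V A z" if "agree (2 * m) y z" for y z using \<xi>[OF that] by (simp add: V_def)
    then have "V A \<in> measurable shift_borel (count_space UNIV)" by (rule measurable_window_determined)
    from measurable_compose[OF this, of "\<lambda>r. r" borel] show "V A \<in> borel_measurable shift_borel"
      by simp
  qed
  have Vi: "integrable \<nu> (V A)" for A
    by (rule N.integrable_const_bound[of _ "real m"]) (use Vb Vm in auto)
  have const: "(\<integral>y. d \<partial>\<nu>) = d * c" for d :: real by (simp add: c_def space)
  define p where "p A = (\<integral>y. V A y \<partial>\<nu>) / real m" for A
  have m: "real m > 0" "real n + 1 = real m" by (simp_all add: m_def)
  have "approximate_lift \<sigma> X \<nu> R n p"
    unfolding approximate_lift_def c_def[symmetric]
  proof (intro conjI allI impI)
    show "0 \<le> p A" for A by (simp add: p_def Vb)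
    show "p A \<le> c" for A
    proof -
      have "(\<integral>y. V A y \<partial>\<nu>) \<le> real m * c"
        unfolding const[symmetric] by (rule integral_mono[OF Vi]) (simp_all add: Vb)
      then show ?thesis using m by (simp add: p_def divide_simps mult.commute)
    qed
    show "p (A \<union> B) = p A + p B" if "A \<inter> B = {}" for A B
    proof -
      have "V (A \<union> B) y = V A y + V B y" for y unfolding V_def by (rule visits_Un[OF that])
      then show ?thesis
        by (simp add: p_def Bochner_Integration.integral_add[OF Vi Vi] add_divide_distrib)
    qed
    show "\<bar>p (shift -` A) - p A\<bar> \<le> c / (real n + 1)" for A
    proof -
      have "p (shift -` A) - p A = (\<integral>y. V (shift -` A) y - V A y \<partial>\<nu>) / real m"
        by (simp add: p_def Bochner_Integration.integral_diff[OF Vi Vi] diff_divide_distrib)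
      moreover have "\<bar>\<integral>y. V (shift -` A) y - V A y \<partial>\<nu>\<bar> \<le> 1 * c"
        unfolding const[symmetric] by (rule integral_abs_bound[THEN order_trans], rule integral_mono)
          (auto simp: V_def visits_shift intro!: integrable_abs Bochner_Integration.integrable_diff Vi[unfolded V_def])
      ultimately show ?thesis using m by (simp add: divide_right_mono)
    qed
    show "p A = 0" if A: "A \<inter> X = {}" for A
    proof -
      have "AE y in \<nu>. V A y = 0"
        using Y
      proof eventually_elim
        case (elim y)
        then have "(shift ^^ i) (\<xi> y) \<notin> A" for i
          using \<xi>Y[of y] A subshift_funpow[OF X, of i "\<xi> y"] by blast
        then show ?case by (simp add: V_def visits_def)
      qed
      then have "(\<integral>y. V A y \<partial>\<nu>) = (\<integral>y. 0 \<partial>\<nu>)" by (intro integral_cong_AE Vm) simp_all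
      then show ?thesis by (simp add: p_def)
    qed
    fix B :: "(int \<Rightarrow> 'b) set" and q assume B: "\<forall>x y. agree q x y \<longrightarrow> (x \<in> B \<longleftrightarrow> y \<in> B)" and q: "q \<le> n"
    have "B \<in> window_sets" unfolding window_sets_def using B by blast
    then have Bs: "B \<in> sets shift_borel" by (rule window_set_in_shift_borel)
    let ?W = "\<lambda>y. \<Sum>k<m. indicator B ((shift ^^ k) y) :: real"
    have Wi: "integrable \<nu> ?W"
    proof (rule N.integrable_const_bound[of _ "real m"])
      have "\<bar>?W y\<bar> \<le> real m" for y
        by (rule order_trans[OF sum_abs])
          (use sum_bounded_above[of "{..<m}" "\<lambda>k. \<bar>indicator B ((shift ^^ k) y) :: real\<bar>" 1] in
            \<open>simp add: indicator_def\<close>)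
      then show "AE y in \<nu>. norm (?W y) \<le> real m" by simp
      have "(\<lambda>y. indicator B ((shift ^^ k) y) :: real) \<in> borel_measurable \<nu>" for k
        by (rule measurable_cong_shift_borel[OF sets measurable_compose[OF measurable_funpow_shift]]) (use Bs in simp)
      then show "?W \<in> borel_measurable \<nu>" by simp
    qed
    have close: "AE y in \<nu>. \<bar>(\<Sum>i<R. V (level_set \<sigma> B i) y) - ?W y\<bar> \<le> 2 * real R"
      using Y
    proof eventually_elim
      case (elim y)
      have "(shift ^^ k) ((shift ^^ j y) (?S (\<xi> y))) \<in> B \<longleftrightarrow> (shift ^^ k) y \<in> B" if "k < m" for k
      proof (rule B[rule_format], rule agree_funpow_shift)
        show "agree (q + k) ((shift ^^ j y) (?S (\<xi> y))) y"
          by (rule agree_mono[of "2 * m"]) (use \<xi>Y[OF elim] that q in \<open>auto simp: m_def\<close>)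
      qed
      then show ?case
        unfolding V_def using \<xi>Y[OF elim] by (intro visits_level_sets[OF \<sigma> R]) auto
    qed
    have sumi: "integrable \<nu> (\<lambda>y. \<Sum>i<R. V (level_set \<sigma> B i) y)" by (intro Bochner_Integration.integrable_sum Vi)
    have "(\<Sum>i<R. p (level_set \<sigma> B i)) = (\<integral>y. (\<Sum>i<R. V (level_set \<sigma> B i) y) \<partial>\<nu>) / real m"
      by (simp add: p_def Bochner_Integration.integral_sum[OF Vi] sum_divide_distrib)
    moreover have "measure \<nu> B = (\<integral>y. ?W y \<partial>\<nu>) / real m"
      using m by (simp add: integral_orbit_average[OF \<nu> Bs])
    ultimately have "(\<Sum>i<R. p (level_set \<sigma> B i)) - measure \<nu> B =
        (\<integral>y. (\<Sum>i<R. V (level_set \<sigma> B i) y) - ?W y \<partial>\<nu>) / real m"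
      by (simp add: Bochner_Integration.integral_diff[OF sumi Wi] diff_divide_distrib)
    moreover have "\<bar>\<integral>y. (\<Sum>i<R. V (level_set \<sigma> B i) y) - ?W y \<partial>\<nu>\<bar> \<le> 2 * real R * c"
      unfolding const[symmetric] by (rule integral_abs_bound[THEN order_trans], rule integral_mono_AE)
        (use close in \<open>auto intro!: integrable_abs Bochner_Integration.integrable_diff sumi Wi\<close>)
    ultimately show "\<bar>(\<Sum>i<R. p (level_set \<sigma> B i)) - measure \<nu> B\<bar> \<le> 2 * real R * c / (real n + 1)"
      using m by (simp add: divide_right_mono)
  qed
  then show ?thesis by blast
qed

text \<open>In the limit of a subsequence of approximate lifts all errors vanish.\<close>

lemma tower_measure_surjective:
  fixes \<sigma> :: "'a::finite list \<Rightarrow> 'b::finite list"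
  assumes \<sigma>: "nonerasing_morphism \<sigma>" and X: "subshift X"
    and \<nu>: "\<nu> \<in> inv_measures (image_subshift \<sigma> X)"
  shows "\<exists>\<mu>\<in>inv_measures X. tower_measure \<sigma> \<mu> = \<nu>"
proof -
  obtain R where R: "\<And>a. length (\<sigma> [a]) \<le> R" using length_image_bounded[of \<sigma>] by blast
  interpret N: finite_measure \<nu> using inv_measuresD(1)[OF \<nu>] .
  note sets\<nu> = inv_measuresD(2)[OF \<nu>]
  let ?W = "window_sets :: (int \<Rightarrow> 'a) set set"
  define c where "c = measure \<nu> UNIV"
  obtain p where p: "\<And>n. approximate_lift \<sigma> X \<nu> R n (p n)"
    using approximate_lift_exists[OF \<sigma> X R \<nu>] by metis
  have p_range: "p n A \<in> {0..c}" for n A using p[of n] by (simp add: approximate_lift_def c_def)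
  obtain r where r: "strict_mono r" and conv: "\<And>A. A \<in> ?W \<Longrightarrow> convergent (\<lambda>n. p (r n) A)"
    using convergent_subsequence_pointwise[of ?W p c, OF countable_window_sets p_range] by metis
  define L where "L A = lim (\<lambda>n. p (r n) A)" for A
  have L: "(\<lambda>n. p (r n) A) \<longlonglongrightarrow> L A" if "A \<in> ?W" for A
    using conv[OF that] by (simp add: L_def convergent_LIMSEQ_iff)
  have small: "(\<lambda>n. d / (real (r n) + 1)) \<longlonglongrightarrow> 0" for d
  proof -
    have "(\<lambda>n. d / (real n + 1)) \<longlonglongrightarrow> 0"
      using LIMSEQ_Suc[OF lim_const_over_n[of d]] by (simp add: add.commute)
    from LIMSEQ_subseq_LIMSEQ[OF this r] show ?thesis by (simp add: o_def)
  qed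
  have L_nonneg: "0 \<le> L A" if "A \<in> ?W" for A
    by (rule LIMSEQ_le_const[OF L[OF that]]) (use p_range in auto)
  have L_Un: "L (A \<union> B) = L A + L B" if "A \<in> ?W" "B \<in> ?W" "A \<inter> B = {}" for A B
  proof -
    have "A \<union> B \<in> ?W" using algebra_window_sets that(1,2) unfolding algebra_iff_Un by blast
    moreover have "p (r n) (A \<union> B) = p (r n) A + p (r n) B" for n
      using p[of "r n"] that(3) unfolding approximate_lift_def by blast
    ultimately show ?thesis
      using LIMSEQ_unique[OF _ tendsto_add[OF L[OF that(1)] L[OF that(2)]]] L[of "A \<union> B"] by simp
  qed
  obtain \<mu> where sets: "sets \<mu> = sets shift_borel"
    and \<mu>: "\<And>A. A \<in> ?W \<Longrightarrow> emeasure \<mu> A = ennreal (L A)"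
    using measure_from_window_sets[of L, OF L_nonneg L_Un] by blast
  have space: "space \<mu> = UNIV" using sets_eq_imp_space_eq[OF sets] by simp
  have fin: "finite_measure \<mu>"
  proof (rule finite_measureI)
    have "UNIV \<in> ?W" by (auto simp: window_sets_def)
    then show "emeasure \<mu> (space \<mu>) \<noteq> \<infinity>" using \<mu> by (simp add: space)
  qed
  have L_shift: "L (shift -` A) = L A" if A: "A \<in> ?W" for A
  proof -
    have "(\<lambda>n. p (r n) (shift -` A) - p (r n) A) \<longlonglongrightarrow> 0"
    proof (rule Lim_null_comparison[OF _ small[of c]])
      show "\<forall>\<^sub>F n in sequentially. norm (p (r n) (shift -` A) - p (r n) A) \<le> c / (real (r n) + 1)"
        using p unfolding approximate_lift_def c_def by simp
    qed
    moreover have "(\<lambda>n. p (r n) (shift -` A) - p (r n) A) \<longlonglongrightarrow> L (shift -` A) - L A"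
      by (intro tendsto_diff L window_set_shift_vimage A)
    ultimately show ?thesis using LIMSEQ_unique by fastforce
  qed
  have shift\<mu>: "shift \<in> measurable \<mu> shift_borel" by (rule measurable_cong_shift_borel[OF sets measurable_shift])
  have "\<mu> = distr \<mu> shift_borel shift"
  proof (rule measure_eqI_window_sets[OF fin sets])
    fix A :: "(int \<Rightarrow> 'a) set" assume A: "A \<in> window_sets"
    have "emeasure (distr \<mu> shift_borel shift) A = emeasure \<mu> (shift -` A)"
      by (subst emeasure_distr[OF shift\<mu> window_set_in_shift_borel[OF A]]) (simp add: space)
    then show "emeasure \<mu> A = emeasure (distr \<mu> shift_borel shift) A"
      by (simp add: \<mu> A window_set_shift_vimage L_shift)
  qed simp
  then have inv: "emeasure \<mu> (shift -` A) = emeasure \<mu> A" if "A \<in> sets shift_borel" for A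
    using emeasure_distr[OF shift\<mu> that] space by simp
  have supp: "supp \<mu> \<subseteq> X"
  proof
    fix x assume x: "x \<in> supp \<mu>"
    show "x \<in> X"
    proof (rule ccontr)
      assume "x \<notin> X"
      then obtain n where n: "\<forall>y\<in>X. \<not> agree n x y"
        using subshiftD(2)[OF X] unfolding closedin_full_shift_iff by blast
      let ?A = "{y. agree n x y}"
      have "?A \<inter> X = {}" using n by blast
      then have "p (r k) ?A = 0" for k using p[of "r k"] unfolding approximate_lift_def by blast
      then have "L ?A = 0" using LIMSEQ_unique[OF L[OF agree_class_window[of n x]]] by simp
      then have "emeasure \<mu> ?A = 0" by (simp add: \<mu> agree_class_window)
      then show False using x open_window_set[OF agree_class_window[of n x]] by (auto simp: in_supp_iff)
    qed
  qed
  have \<mu>X: "\<mu> \<in> inv_measures X" using fin sets inv supp by (simp add: inv_measures_def)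
  have "\<nu> = tower_measure \<sigma> \<mu>"
  proof (rule measure_eqI_window_sets[OF N.finite_measure_axioms sets\<nu>])
    fix B :: "(int \<Rightarrow> 'b) set" assume B: "B \<in> window_sets"
    then obtain q where q: "\<forall>x y. agree q x y \<longrightarrow> (x \<in> B \<longleftrightarrow> y \<in> B)" by (auto simp: window_sets_def)
    note level = level_set_window_set[OF \<sigma> B]
    have "(\<lambda>n. (\<Sum>i<R. p (r n) (level_set \<sigma> B i)) - measure \<nu> B) \<longlonglongrightarrow> 0"
    proof (rule Lim_null_comparison[OF _ small[of "2 * real R * c"]])
      have "norm ((\<Sum>i<R. p (r n) (level_set \<sigma> B i)) - measure \<nu> B) \<le> 2 * real R * c / (real (r n) + 1)"
        if n: "n \<ge> q" for n
      proof -
        have "q \<le> r n" using n seq_suble[OF r, of n] by simp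
        then show ?thesis using p[of "r n"] q unfolding approximate_lift_def c_def real_norm_def by blast
      qed
      then show "\<forall>\<^sub>F n in sequentially. norm ((\<Sum>i<R. p (r n) (level_set \<sigma> B i)) - measure \<nu> B) \<le>
          2 * real R * c / (real (r n) + 1)"
        by (auto simp: eventually_sequentially)
    qed
    moreover have "(\<lambda>n. (\<Sum>i<R. p (r n) (level_set \<sigma> B i)) - measure \<nu> B) \<longlonglongrightarrow>
        (\<Sum>i<R. L (level_set \<sigma> B i)) - measure \<nu> B"
      by (intro tendsto_diff tendsto_sum tendsto_const L level)
    ultimately have eq: "measure \<nu> B = (\<Sum>i<R. L (level_set \<sigma> B i))"
      using LIMSEQ_unique by fastforce
    have "emeasure (tower_measure \<sigma> \<mu>) B = (\<Sum>i<R. ennreal (L (level_set \<sigma> B i)))"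
      unfolding emeasure_tower_measure_level_sets[OF \<sigma> sets window_set_in_shift_borel[OF B] R]
      by (simp add: \<mu> level)
    also have "\<dots> = ennreal (\<Sum>i<R. L (level_set \<sigma> B i))"
      by (rule sum_ennreal) (rule L_nonneg[OF level])
    finally show "emeasure \<nu> B = emeasure (tower_measure \<sigma> \<mu>) B"
      by (simp add: eq N.emeasure_eq_measure)
  qed simp
  then show ?thesis using \<mu>X by auto
qed

section \<open>The measure transfer map\<close>

theorem proposition1p1:
  fixes \<sigma> :: "'a::finite list \<Rightarrow> 'b::finite list"
    and X :: "(int \<Rightarrow> 'a) set"
    and Y :: "(int \<Rightarrow> 'b) set"
  assumes "nonerasing_morphism \<sigma>"
    and "subshift X"
    and "Y = image_subshift \<sigma> X"
  shows
    \<comment> \<open>well-definedness of the restricted and co-restricted map\<close>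
    "transfer \<sigma> \<in> inv_measures X \<rightarrow> inv_measures Y \<and>
    \<comment> \<open>(1) linearity\<close>
    (\<forall>\<mu>\<in>inv_measures X. \<forall>\<nu>\<in>inv_measures X. \<forall>c d :: real. c \<ge> 0 \<longrightarrow> d \<ge> 0 \<longrightarrow>
       transfer_on \<sigma> X
         (add_measure (scale_measure (ennreal c) \<mu>) (scale_measure (ennreal d) \<nu>)) =
       add_measure (scale_measure (ennreal c) (transfer_on \<sigma> X \<mu>))
                   (scale_measure (ennreal d) (transfer_on \<sigma> X \<nu>))) \<and>
    \<comment> \<open>(2) continuity\<close>
    continuous_map (weak_star X) (weak_star Y) (transfer_on \<sigma> X) \<and>
    \<comment> \<open>(3) functoriality; equality of maps includes equality of their codomains\<close>
    (\<forall>\<sigma>' :: 'b list \<Rightarrow> 'c::finite list. nonerasing_morphism \<sigma>' \<longrightarrow>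
       image_subshift (\<sigma>' \<circ> \<sigma>) X = image_subshift \<sigma>' Y \<and>
       transfer_on (\<sigma>' \<circ> \<sigma>) X =
         compose (inv_measures X) (transfer_on \<sigma>' Y) (transfer_on \<sigma> X)) \<and>
    \<comment> \<open>(4) supports\<close>
    (\<forall>X' \<mu>. subshift X' \<longrightarrow> X' \<subseteq> X \<longrightarrow> \<mu> \<in> inv_measures X \<longrightarrow> supp \<mu> = X' \<longrightarrow>
       supp (transfer_on \<sigma> X \<mu>) = image_subshift \<sigma> X') \<and>
    \<comment> \<open>(5) ergodicity\<close>
    (\<forall>\<mu>\<in>inv_measures X. ergodic \<mu> \<longrightarrow> ergodic (transfer_on \<sigma> X \<mu>)) \<and>
    \<comment> \<open>surjectivity\<close>
    transfer_on \<sigma> X ` inv_measures X = inv_measures Y"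
proof -
  note \<sigma> = assms(1) and X = assms(2) and Y = assms(3)
  have tower: "transfer_on \<sigma> X \<mu> = tower_measure \<sigma> \<mu>" if "\<mu> \<in> inv_measures X" for \<mu>
    using that by (simp add: transfer_on_def transfer_eq_tower_measure[OF \<sigma>])
  have codomain: "tower_measure \<sigma> \<mu> \<in> inv_measures Y" if "\<mu> \<in> inv_measures X" for \<mu>
    using tower_measure_invariant[OF \<sigma> that] supp_tower_measure_subset[OF \<sigma> X that]
    unfolding Y inv_measures_iff_UNIV[of _ "image_subshift \<sigma> X"] by blast
  have "transfer \<sigma> \<in> inv_measures X \<rightarrow> inv_measures Y"
    using codomain by (simp add: transfer_eq_tower_measure[OF \<sigma>])
  moreover have "\<forall>\<mu>\<in>inv_measures X. \<forall>\<nu>\<in>inv_measures X. \<forall>c d :: real. c \<ge> 0 \<longrightarrow> d \<ge> 0 \<longrightarrow>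
       transfer_on \<sigma> X
         (add_measure (scale_measure (ennreal c) \<mu>) (scale_measure (ennreal d) \<nu>)) =
       add_measure (scale_measure (ennreal c) (transfer_on \<sigma> X \<mu>))
                   (scale_measure (ennreal d) (transfer_on \<sigma> X \<nu>))"
  proof (intro ballI allI impI)
    fix \<mu> \<nu> and c d :: real assume \<mu>: "\<mu> \<in> inv_measures X" and \<nu>: "\<nu> \<in> inv_measures X"
    show "transfer_on \<sigma> X (add_measure (scale_measure (ennreal c) \<mu>) (scale_measure (ennreal d) \<nu>)) =
        add_measure (scale_measure (ennreal c) (transfer_on \<sigma> X \<mu>))
                    (scale_measure (ennreal d) (transfer_on \<sigma> X \<nu>))"
      unfolding tower[OF \<mu>] tower[OF \<nu>]
        tower[OF add_measure_in_inv[OF scale_measure_in_inv[OF \<mu>] scale_measure_in_inv[OF \<nu>]]]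
      by (rule tower_measure_linear[OF \<sigma> inv_measuresD(2)[OF \<mu>] inv_measuresD(2)[OF \<nu>]])
  qed
  moreover have "continuous_map (weak_star X) (weak_star Y) (transfer_on \<sigma> X)"
    by (rule weak_star_continuous_tower[OF \<sigma>]) (simp add: tower codomain)
  moreover have "image_subshift (\<sigma>' \<circ> \<sigma>) X = image_subshift \<sigma>' Y \<and>
       transfer_on (\<sigma>' \<circ> \<sigma>) X = compose (inv_measures X) (transfer_on \<sigma>' Y) (transfer_on \<sigma> X)"
    if \<sigma>': "nonerasing_morphism \<sigma>'" for \<sigma>' :: "'b list \<Rightarrow> 'c list"
  proof
    show "image_subshift (\<sigma>' \<circ> \<sigma>) X = image_subshift \<sigma>' Y"
      unfolding Y by (rule image_subshift_comp[OF \<sigma> \<sigma>' X])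
    show "transfer_on (\<sigma>' \<circ> \<sigma>) X = compose (inv_measures X) (transfer_on \<sigma>' Y) (transfer_on \<sigma> X)"
    proof
      fix \<mu>
      show "transfer_on (\<sigma>' \<circ> \<sigma>) X \<mu> = compose (inv_measures X) (transfer_on \<sigma>' Y) (transfer_on \<sigma> X) \<mu>"
      proof (cases "\<mu> \<in> inv_measures X")
        case True
        have "transfer_on (\<sigma>' \<circ> \<sigma>) X \<mu> = tower_measure (\<sigma>' \<circ> \<sigma>) \<mu>"
          using True by (simp add: transfer_on_def transfer_eq_tower_measure[OF nonerasing_comp[OF \<sigma> \<sigma>']])
        also have "\<dots> = tower_measure \<sigma>' (tower_measure \<sigma> \<mu>)"
          by (rule tower_measure_comp[OF \<sigma> \<sigma>' inv_measuresD(2)[OF True]])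
        also have "\<dots> = transfer_on \<sigma>' Y (transfer_on \<sigma> X \<mu>)"
          unfolding tower[OF True] using codomain[OF True]
          by (simp add: transfer_on_def transfer_eq_tower_measure[OF \<sigma>' codomain[OF True]])
        finally show ?thesis using True by (simp add: compose_def)
      qed (simp add: transfer_on_def compose_def)
    qed
  qed
  moreover have "supp (transfer_on \<sigma> X \<mu>) = image_subshift \<sigma> X'"
    if X': "subshift X'" and \<mu>: "\<mu> \<in> inv_measures X" "supp \<mu> = X'" for X' \<mu>
    using supp_tower_measure[OF \<sigma> X' inv_measures_mono[OF \<mu>(1)] \<mu>(2)] by (simp add: tower[OF \<mu>(1)])
  moreover have "\<forall>\<mu>\<in>inv_measures X. ergodic \<mu> \<longrightarrow> ergodic (transfer_on \<sigma> X \<mu>)"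
    by (simp add: tower ergodic_tower_measure[OF \<sigma>])
  moreover have "transfer_on \<sigma> X ` inv_measures X = inv_measures Y"
  proof
    show "transfer_on \<sigma> X ` inv_measures X \<subseteq> inv_measures Y" using codomain by (auto simp: tower)
    show "inv_measures Y \<subseteq> transfer_on \<sigma> X ` inv_measures X"
    proof
      fix \<nu> assume "\<nu> \<in> inv_measures Y"
      then obtain \<mu> where "\<mu> \<in> inv_measures X" "tower_measure \<sigma> \<mu> = \<nu>"
        using tower_measure_surjective[OF \<sigma> X] unfolding Y by blast
      then show "\<nu> \<in> transfer_on \<sigma> X ` inv_measures X"
        by (intro image_eqI[of _ _ \<mu>]) (simp_all add: tower)
    qed
  qed
  ultimately show ?thesis by blast
qed

end
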